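(* Let $\Lambda\colon V\times V\to\mathbb{K}$ be an even continuous bilinear form and let $z\in\mathbb{K}$. If $R\ge\frac12$, then the Weyl algebra $\mathcal{W}_R(V,\star_{z\Lambda})$ is a locally convex algebra (i.e. its product $\star_{z\Lambda}$ is jointly continuous). Moreover, if $R>\frac12$, then $\mathcal{W}_{R^-}(V,\star_{z\Lambda})$ is a locally convex algebra. In both cases, the Weyl algebra is first countable if and only if $V$ is first countable.
   Context: $\mathbb{K}=\mathbb{R}$ or $\mathbb{C}$, and $V=V_{\mathbf 0}\oplus V_{\mathbf 1}$ is a $\mathbb{Z}_2$-graded Hausdorff locally convex $\mathbb{K}$-vector space such that the projections onto $V_{\mathbf 0}$ and $V_{\mathbf 1}$ are continuous. In exponents of $-1$ a homogeneous vector denotes its parity. Symmetric algebra: $S_n$ acts from the right on $V^{\otimes n}$ by $(v_1\otimes\cdots\otimes v_n)\triangleleft\sigma=\pm\, v_{\sigma(1)}\otimes\cdots\otimes v_{\sigma(n)}$ for homogeneous $v_i$, where $\pm$ is the Koszul sign ($-1$ to the number of pairs $i<j$ with $\sigma(i)>\sigma(j)$ and $v_{\sigma(i)},v_{\sigma(j)}$ both odd). $\mathcal{S}_n(v)=\frac1{n!}\sum_{\sigma\in S_n} v\triangleleft\sigma$, $\mathrm{S}^n(V)=\operatorname{im}\mathcal{S}_n\subseteq V^{\otimes n}$, $\mathrm{S}^0(V)=\mathbb{K}$, $\mathrm{S}^\bullet(V)=\bigoplus_n \mathrm{S}^n(V)$, with product $\mu(v\otimes w)=vw=\mathcal{S}(v\otimes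 w)$, $\mathcal{S}=\bigoplus_n\mathcal{S}_n$. Star product: a bilinear form $\Lambda$ is even if $\Lambda(v,w)=0$ for homogeneous $v,w$ of different parity. $P_\Lambda\colon \mathrm{S}^\bullet(V)\otimes \mathrm{S}^\bullet(V)\to \mathrm{S}^{\bullet-1}(V)\otimes \mathrm{S}^{\bullet-1}(V)$ is the linear extension of $$P_\Lambda(v_1\cdots v_n\otimes w_1\cdots w_m)=\sum_{k=1}^n\sum_{\ell=1}^m(-1)^{v_k(v_{k+1}+\cdots+v_n)+w_\ell(w_1+\cdots+w_{\ell-1})}\Lambda(v_k,w_\ell)\,v_1\cdots\widehat{v_k}\cdots v_n\otimes w_1\cdots\widehat{w_\ell}\cdots w_m$$ (homogeneous vectors; hats denote omission; $P_\Lambda$ vanishes if one factor is in $\mathrm{S}^0(V)$). Then $a\star_{z\Lambda}b=\sum_{k\ge0}\frac{z^k}{k!}\mu(P_\Lambda^k(a\otimes b))$, a finite sum for $a,b\in \mathrm{S}^\bullet(V)$; this is an associative product with unit $1\in\mathrm{S}^0(V)$. Topology: for a continuous seminorm $p$ on $V$ let $p^n=p\otimes\cdots\otimes p$ be the projective tensor seminorm on $V^{\otimes n}$ ($p^0=|\cdot|$), and for $R\in\mathbb{R}$ set $p_R(v)=\sum_{n\ge0}p^n(v_n)\,n!^R$ for $v=\sum_n v_n$ with $v_n\in V^{\otimes n}$. $\mathcal{W}_R(V,\star_{z\Lambda})$ is $\mathrm{S}^\bullet(V)$ with product $\star_{z\Lambda}$ and the locally convex topology defined by all $p_R$, $p$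 a continuous seminorm on $V$. $\mathcal{W}_{R^-}(V,\star_{z\Lambda})$ is $\mathrm{S}^\bullet(V)$ with product $\star_{z\Lambda}$ and the topology defined by all $p_{R-\epsilon}$, $\epsilon>0$, $p$ a continuous seminorm on $V$. *)

theory Defs
  imports
    "HOL-Analysis.Analysis"
    "HOL-Combinatorics.Permutations"
    "HOL-Library.Function_Algebras"
    "HOL-Library.Groups_Big_Fun"
begin

text \<open>
  The ground field is a type of class \<^class>\<open>real_normed_field\<close>; by Ostrowski's theorem such a
  field is, up to isometric isomorphism, \<open>\<real>\<close> or \<open>\<complex>\<close>.  A vector space over it
  is a type with a scalar multiplication satisfying \<^locale>\<open>vector_space\<close>.
\<close>

section \<open>Locally convex spaces and algebras\<close>

text \<open>The carrier \<open>A\<close> is a linear subspace of a vector space type.\<close>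

definition seminorm_on :: "('k::real_normed_field \<Rightarrow> 'a::ab_group_add \<Rightarrow> 'a) \<Rightarrow> 'a set \<Rightarrow> ('a \<Rightarrow> real) \<Rightarrow> bool"
  where "seminorm_on smul A p \<longleftrightarrow>
    (\<forall>x\<in>A. 0 \<le> p x) \<and>
    (\<forall>x\<in>A. \<forall>y\<in>A. p (x + y) \<le> p x + p y) \<and>
    (\<forall>c. \<forall>x\<in>A. p (smul c x) = norm c * p x)"

definition seminorm_topology :: "'a::ab_group_add set \<Rightarrow> ('a \<Rightarrow> real) set \<Rightarrow> 'a topology"
  where "seminorm_topology A P = topology_generated_by
    (insert A {{y \<in> A. p (y - x) < e} | p x e. p \<in> P \<and> x \<in> A \<and> 0 < e})"

definition locally_convex_space ::
    "('k::real_normed_field \<Rightarrow> 'a::ab_group_add \<Rightarrow> 'a) \<Rightarrow> 'a set \<Rightarrow> 'a topology \<Rightarrow> bool"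
  where "locally_convex_space smul A T \<longleftrightarrow>
    vector_space smul \<and> module.subspace smul A \<and>
    (\<exists>P. (\<forall>p\<in>P. seminorm_on smul A p) \<and> T = seminorm_topology A P)"

definition bilinear_on ::
    "('k::field \<Rightarrow> 'a::ab_group_add \<Rightarrow> 'a) \<Rightarrow> 'a set \<Rightarrow> ('k \<Rightarrow> 'b::ab_group_add \<Rightarrow> 'b) \<Rightarrow> ('a \<Rightarrow> 'a \<Rightarrow> 'b) \<Rightarrow> bool"
  where "bilinear_on smul A smul' m \<longleftrightarrow>
    (\<forall>x\<in>A. \<forall>y\<in>A. \<forall>w\<in>A. m (x + y) w = m x w + m y w \<and> m w (x + y) = m w x + m w y) \<and>
    (\<forall>c. \<forall>x\<in>A. \<forall>y\<in>A. m (smul c x) y = smul' c (m x y) \<and> m x (smul c y) = smul' c (m x y))"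

definition locally_convex_algebra ::
    "('k::real_normed_field \<Rightarrow> 'a::ab_group_add \<Rightarrow> 'a) \<Rightarrow> 'a set \<Rightarrow> 'a topology \<Rightarrow> ('a \<Rightarrow> 'a \<Rightarrow> 'a) \<Rightarrow> bool"
  where "locally_convex_algebra smul A T m \<longleftrightarrow>
    locally_convex_space smul A T \<and>
    (\<forall>x\<in>A. \<forall>y\<in>A. m x y \<in> A) \<and> bilinear_on smul A smul m \<and>
    continuous_map (prod_topology T T) T (\<lambda>(x, y). m x y)"

definition continuous_seminorm ::
    "('k::real_normed_field \<Rightarrow> 'a::ab_group_add \<Rightarrow> 'a) \<Rightarrow> 'a topology \<Rightarrow> ('a \<Rightarrow> real) \<Rightarrow> bool"
  where "continuous_seminorm smul T p \<longleftrightarrow>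
    seminorm_on smul UNIV p \<and> continuous_map T euclideanreal p"

text \<open>For \<open>UNIV = A \<oplus> B\<close>, the projection onto \<open>A\<close> along \<open>B\<close>.\<close>

definition projection_along :: "'a::ab_group_add set \<Rightarrow> 'a set \<Rightarrow> 'a \<Rightarrow> 'a"
  where "projection_along A B v = (THE a. a \<in> A \<and> v - a \<in> B)"

locale graded_lcs =
  fixes smul :: "'k::real_normed_field \<Rightarrow> 'v::ab_group_add \<Rightarrow> 'v"
    and T :: "'v topology"
    and V0 V1 :: "'v set"
  assumes locally_convex: "locally_convex_space smul UNIV T"
    and hausdorff: "Hausdorff_space T"
    and subspace_even: "module.subspace smul V0"
    and subspace_odd: "module.subspace smul V1"
    and trivial_Int: "V0 \<inter> V1 = {0}"
    and sum_UNIV: "\<And>v. \<exists>a\<in>V0. \<exists>b\<in>V1. v = a + b"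
    and continuous_projection_even: "continuous_map T T (projection_along V0 V1)"
    and continuous_projection_odd: "continuous_map T T (projection_along V1 V0)"

section \<open>Tensor powers\<close>

text \<open>
  The vector \<open>v\<^sub>1 \<otimes> \<dots> \<otimes> v\<^sub>n\<close> is realised as evaluation of \<open>n\<close>-linear forms at \<open>(v\<^sub>1, \<dots>, v\<^sub>n)\<close>
  (extended by zero to functions that are not \<open>n\<close>-linear), and the algebraic tensor power as the
  span of these vectors.  It has the universal property; see \<open>tensor_power_universal\<close> below.
\<close>

type_synonym ('v, 'k) tensor = "('v list \<Rightarrow> 'k) \<Rightarrow> 'k"

definition multilinear ::
    "('k::field \<Rightarrow> 'v::ab_group_add \<Rightarrow> 'v) \<Rightarrow> ('k \<Rightarrow> 'u::ab_group_add \<Rightarrow> 'u) \<Rightarrow> nat \<Rightarrow> ('v list \<Rightarrow> 'u) \<Rightarrow> bool"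
  where "multilinear smul smul' n f \<longleftrightarrow>
    (\<forall>xs ys. length xs + length ys + 1 = n \<longrightarrow> Vector_Spaces.linear smul smul' (\<lambda>x. f (xs @ x # ys)))"

definition tensor_scale :: "'k::field \<Rightarrow> ('x \<Rightarrow> 'k) \<Rightarrow> ('x \<Rightarrow> 'k)"
  where "tensor_scale c t = (\<lambda>b. c * t b)"

definition pure_tensor :: "('k::field \<Rightarrow> 'v::ab_group_add \<Rightarrow> 'v) \<Rightarrow> 'v list \<Rightarrow> ('v, 'k) tensor"
  where "pure_tensor smul v = (\<lambda>b. if multilinear smul (*) (length v) b then b v else 0)"

definition tensor_power :: "('k::field \<Rightarrow> 'v::ab_group_add \<Rightarrow> 'v) \<Rightarrow> nat \<Rightarrow> ('v, 'k) tensor set"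
  where "tensor_power smul n = module.span tensor_scale (pure_tensor smul ` {v. length v = n})"

text \<open>The scalars \<open>c i\<close> are redundant for \<open>n \<ge> 1\<close>; for \<open>n = 0\<close> they make this the absolute value.\<close>

definition projective_seminorm ::
    "('k::real_normed_field \<Rightarrow> 'v::ab_group_add \<Rightarrow> 'v) \<Rightarrow> nat \<Rightarrow> ('v \<Rightarrow> real) \<Rightarrow> ('v, 'k) tensor \<Rightarrow> real"
  where "projective_seminorm smul n p t =
    Inf {(\<Sum>i<N. norm (c i) * (\<Prod>x\<leftarrow>v i. p x)) | N (c :: nat \<Rightarrow> 'k) (v :: nat \<Rightarrow> 'v list).
      (\<forall>i<N. length (v i) = n) \<and> t = (\<Sum>i<N. tensor_scale (c i) (pure_tensor smul (v i)))}"

text \<open>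
  A linear map with \<open>L (g x) = f x\<close> for all \<open>x \<in> X\<close>.  Only its values on the span of \<open>g ` X\<close>, which
  are determined by this, are ever used.  It exists if \<open>f\<close> respects the linear relations between
  the \<open>g x\<close>; see \<open>linear_extension\<close> below.
\<close>

definition linear_extension ::
    "('k::field \<Rightarrow> 'a::ab_group_add \<Rightarrow> 'a) \<Rightarrow> ('k \<Rightarrow> 'b::ab_group_add \<Rightarrow> 'b) \<Rightarrow>
      'x set \<Rightarrow> ('x \<Rightarrow> 'a) \<Rightarrow> ('x \<Rightarrow> 'b) \<Rightarrow> 'a \<Rightarrow> 'b"
  where "linear_extension smul smul' X g f =
    (SOME L. Vector_Spaces.linear smul smul' L \<and> (\<forall>x\<in>X. L (g x) = f x))"

lemma linear_extension:
  assumes "vector_space s1" "vector_space s2"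
    and rel: "\<And>A c. finite A \<Longrightarrow> A \<subseteq> X \<Longrightarrow> (\<Sum>x\<in>A. s1 (c x) (g x)) = 0 \<Longrightarrow> (\<Sum>x\<in>A. s2 (c x) (f x)) = 0"
  shows "Vector_Spaces.linear s1 s2 (linear_extension s1 s2 X g f)"
    and "\<And>x. x \<in> X \<Longrightarrow> linear_extension s1 s2 X g f (g x) = f x"
proof -
  interpret s1: vector_space s1 by fact
  interpret s2: vector_space s2 by fact
  interpret vector_space_pair s1 s2 ..
  obtain B where B: "B \<subseteq> g ` X" "s1.independent B" "g ` X \<subseteq> s1.span B"
    using s1.maximal_independent_subset by metis
  define h where "h = inv_into X g"
  have h: "h b \<in> X" "g (h b) = b" if "b \<in> B" for b
    using that B(1) by (auto simp: h_def inv_into_into f_inv_into_f)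
  obtain L where L: "Vector_Spaces.linear s1 s2 L" "\<forall>b\<in>B. L b = f (h b)"
    using linear_independent_extend[OF B(2), of "\<lambda>b. f (h b)"] by blast
  have "L (g x) = f x" if x: "x \<in> X" for x
  proof -
    interpret L: Vector_Spaces.linear s1 s2 L by (rule L(1))
    have "g x \<in> s1.span B" using B(3) x by auto
    then obtain t r where t: "finite t" "t \<subseteq> B" and gx: "g x = (\<Sum>b\<in>t. s1 (r b) b)"
      unfolding s1.span_explicit by blast
    have Lgx: "L (g x) = (\<Sum>b\<in>t. s2 (r b) (f (h b)))"
      unfolding gx L.sum L.scale using L(2) t by (intro sum.cong) auto
    show ?thesis
    proof (cases "x \<in> h ` t")
      case True
      then obtain b where "b \<in> t" "x = h b" by auto
      then show ?thesis using h t L(2) by auto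
    next
      case False
      define c where "c y = (if y = x then - 1 else r (g y))" for y
      have inj: "inj_on h t" using h t by (metis inj_onI subsetD)
      have c: "c (h b) = r b" if "b \<in> t" for b
        using that False h t unfolding c_def by auto
      have fin: "finite (h ` t)" using t by simp
      have cx: "c x = - 1" by (simp add: c_def)
      have "(\<Sum>y\<in>h ` t. s1 (c y) (g y)) = (\<Sum>b\<in>t. s1 (r b) b)"
        using c h t by (simp add: sum.reindex[OF inj] subset_iff)
      then have "(\<Sum>y\<in>insert x (h ` t). s1 (c y) (g y)) = s1 (- 1) (g x) + (\<Sum>b\<in>t. s1 (r b) b)"
        by (simp only: sum.insert[OF fin False] cx)
      also have "\<dots> = 0" using gx s1.scale_minus_left[of 1 "g x"] by simp
      finally have "(\<Sum>y\<in>insert x (h ` t). s2 (c y) (f y)) = 0"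
        using fin h t x by (intro rel) auto
      moreover have "(\<Sum>y\<in>h ` t. s2 (c y) (f y)) = (\<Sum>b\<in>t. s2 (r b) (f (h b)))"
        using c by (simp add: sum.reindex[OF inj])
      then have "(\<Sum>y\<in>insert x (h ` t). s2 (c y) (f y)) = s2 (- 1) (f x) + (\<Sum>b\<in>t. s2 (r b) (f (h b)))"
        by (simp only: sum.insert[OF fin False] cx)
      ultimately show ?thesis using Lgx s2.scale_minus_left[of 1 "f x"] by simp
    qed
  qed
  then have "\<exists>L. Vector_Spaces.linear s1 s2 L \<and> (\<forall>x\<in>X. L (g x) = f x)"
    using L(1) by blast
  from someI_ex[OF this]
  show "Vector_Spaces.linear s1 s2 (linear_extension s1 s2 X g f)"
    and "\<And>x. x \<in> X \<Longrightarrow> linear_extension s1 s2 X g f (g x) = f x"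
    unfolding linear_extension_def by auto
qed

lemma vector_space_tensor_scale: "vector_space (tensor_scale :: 'k::field \<Rightarrow> ('x \<Rightarrow> 'k) \<Rightarrow> 'x \<Rightarrow> 'k)"
  by unfold_locales (auto simp: tensor_scale_def algebra_simps plus_fun_def)

lemma tensor_power_universal:
  assumes s': "vector_space (smul' :: 'k::field \<Rightarrow> 'u::ab_group_add \<Rightarrow> 'u)"
    and f: "multilinear smul smul' n f"
  defines "L \<equiv> linear_extension tensor_scale smul' {v. length v = n} (pure_tensor smul) f"
  shows "Vector_Spaces.linear tensor_scale smul' L"
    and "\<And>v. length v = n \<Longrightarrow> L (pure_tensor smul v) = f v"
proof -
  interpret s': vector_space smul' by fact
  have K: "vector_space ((*) :: 'k \<Rightarrow> 'k \<Rightarrow> 'k)" by unfold_locales (auto simp: algebra_simps)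
  interpret K: vector_space "(*) :: 'k \<Rightarrow> 'k \<Rightarrow> 'k" by (rule K)
  interpret D: vector_space_pair smul' "(*) :: 'k \<Rightarrow> 'k \<Rightarrow> 'k" ..
  have rel: "(\<Sum>v\<in>A. smul' (c v) (f v)) = 0"
    if A: "finite A" "A \<subseteq> {v. length v = n}"
      and 0: "(\<Sum>v\<in>A. tensor_scale (c v) (pure_tensor smul v)) = 0" for A c
  proof (rule ccontr)
    assume ne: "(\<Sum>v\<in>A. smul' (c v) (f v)) \<noteq> 0"
    obtain \<phi> where \<phi>: "Vector_Spaces.linear smul' (*) \<phi>" "\<phi> (\<Sum>v\<in>A. smul' (c v) (f v)) = 1"
      using D.linear_independent_extend[of "{\<Sum>v\<in>A. smul' (c v) (f v)}" "\<lambda>_. 1"] ne by auto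
    interpret \<phi>: Vector_Spaces.linear smul' "(*)" \<phi> by fact
    have ml: "multilinear smul (*) n (\<lambda>v. \<phi> (f v))"
      using f Vector_Spaces.linear_compose[OF _ \<phi>(1)]
      unfolding multilinear_def by (auto simp: o_def)
    have "(\<Sum>v\<in>A. c v * \<phi> (f v)) = (\<Sum>v\<in>A. tensor_scale (c v) (pure_tensor smul v)) (\<lambda>v. \<phi> (f v))"
      using A(1,2)
    proof (induction A rule: finite_induct)
      case (insert a B)
      then show ?case
        using ml by (simp add: tensor_scale_def pure_tensor_def)
    qed simp
    also have "\<dots> = 0" unfolding 0 by simp
    finally show False using \<phi>(2) by (simp add: \<phi>.sum \<phi>.scale)
  qed
  show "Vector_Spaces.linear tensor_scale smul' L"
    unfolding L_def by (rule linear_extension(1)[OF vector_space_tensor_scale s' rel])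
  show "L (pure_tensor smul v) = f v" if "length v = n" for v
    unfolding L_def using that
    by (intro linear_extension(2)[OF vector_space_tensor_scale s' rel]) simp_all
qed

section \<open>The symmetric algebra\<close>

text \<open>Elements of the direct sum of all tensor powers are families of tensors.\<close>

type_synonym ('v, 'k) tensor_alg = "nat \<Rightarrow> ('v, 'k) tensor"

definition alg_scale :: "'k::field \<Rightarrow> ('v, 'k) tensor_alg \<Rightarrow> ('v, 'k) tensor_alg"
  where "alg_scale c a = (\<lambda>n. tensor_scale c (a n))"

definition in_degree :: "nat \<Rightarrow> ('v, 'k::field) tensor \<Rightarrow> ('v, 'k) tensor_alg"
  where "in_degree n t = (\<lambda>m. if m = n then t else 0)"

text \<open>
  The zero vector is homogeneous of both parities.  The choice made here is immaterial, as all
  signs involving it multiply zero.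
\<close>

definition parity :: "'v set \<Rightarrow> 'v \<Rightarrow> nat"
  where "parity V1 v = (if v \<in> V1 then 1 else 0)"

definition homogeneous_lists :: "'v set \<Rightarrow> 'v set \<Rightarrow> 'v list set"
  where "homogeneous_lists V0 V1 = lists (V0 \<union> V1)"

definition koszul_sign :: "'v set \<Rightarrow> nat \<Rightarrow> (nat \<Rightarrow> nat) \<Rightarrow> 'v list \<Rightarrow> 'k::field"
  where "koszul_sign V1 n \<sigma> v =
    (-1) ^ card {(i, j). i < j \<and> j < n \<and> \<sigma> j < \<sigma> i \<and>
      parity V1 (v ! \<sigma> i) = 1 \<and> parity V1 (v ! \<sigma> j) = 1}"

text \<open>Tensor factors are numbered from \<open>0\<close>, so \<open>\<sigma>\<close> permutes \<open>{..<n}\<close>.\<close>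

definition perm_action ::
    "('k::field \<Rightarrow> 'v::ab_group_add \<Rightarrow> 'v) \<Rightarrow> 'v set \<Rightarrow> 'v set \<Rightarrow> nat \<Rightarrow> (nat \<Rightarrow> nat) \<Rightarrow>
      ('v, 'k) tensor \<Rightarrow> ('v, 'k) tensor"
  where "perm_action smul V0 V1 n \<sigma> =
    linear_extension tensor_scale tensor_scale {v \<in> homogeneous_lists V0 V1. length v = n}
      (pure_tensor smul)
      (\<lambda>v. tensor_scale (koszul_sign V1 n \<sigma> v) (pure_tensor smul (map (\<lambda>i. v ! \<sigma> i) [0..<n])))"

definition symmetrizer ::
    "('k::field_char_0 \<Rightarrow> 'v::ab_group_add \<Rightarrow> 'v) \<Rightarrow> 'v set \<Rightarrow> 'v set \<Rightarrow> nat \<Rightarrow>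
      ('v, 'k) tensor \<Rightarrow> ('v, 'k) tensor"
  where "symmetrizer smul V0 V1 n t =
    tensor_scale (1 / fact n) (\<Sum>\<sigma> | \<sigma> permutes {..<n}. perm_action smul V0 V1 n \<sigma> t)"

definition sym_power ::
    "('k::field_char_0 \<Rightarrow> 'v::ab_group_add \<Rightarrow> 'v) \<Rightarrow> 'v set \<Rightarrow> 'v set \<Rightarrow> nat \<Rightarrow> ('v, 'k) tensor set"
  where "sym_power smul V0 V1 n = symmetrizer smul V0 V1 n ` tensor_power smul n"

definition sym_algebra ::
    "('k::field_char_0 \<Rightarrow> 'v::ab_group_add \<Rightarrow> 'v) \<Rightarrow> 'v set \<Rightarrow> 'v set \<Rightarrow> ('v, 'k) tensor_alg set"
  where "sym_algebra smul V0 V1 =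
    {a. finite {n. a n \<noteq> 0} \<and> (\<forall>n. a n \<in> sym_power smul V0 V1 n)}"

text \<open>\<open>v\<^sub>1 \<cdots> v\<^sub>n\<close>, the product in the symmetric algebra of a list of vectors\<close>

definition sym_monomial ::
    "('k::field_char_0 \<Rightarrow> 'v::ab_group_add \<Rightarrow> 'v) \<Rightarrow> 'v set \<Rightarrow> 'v set \<Rightarrow> 'v list \<Rightarrow> ('v, 'k) tensor_alg"
  where "sym_monomial smul V0 V1 v =
    in_degree (length v) (symmetrizer smul V0 V1 (length v) (pure_tensor smul v))"

text \<open>
  \<open>a \<otimes> b\<close> in the tensor product of the algebra with itself, i.e. the construction above applied to
  the vector space of families of tensors
\<close>

definition tensor2 ::
    "('v, 'k::field) tensor_alg \<Rightarrow> ('v, 'k) tensor_alg \<Rightarrow> (('v, 'k) tensor_alg, 'k) tensor"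
  where "tensor2 a b = pure_tensor alg_scale [a, b]"

text \<open>
  The identification of \<open>V\<^sup>\<otimes>\<^sup>n \<otimes> V\<^sup>\<otimes>\<^sup>m\<close> with \<open>V\<^sup>\<otimes>\<^sup>(\<^sup>n\<^sup>+\<^sup>m\<^sup>)\<close>, which is implicit in \<open>vw = \<S>(v \<otimes> w)\<close>
\<close>

definition tensor_concat ::
    "('k::field \<Rightarrow> 'v::ab_group_add \<Rightarrow> 'v) \<Rightarrow> (('v, 'k) tensor_alg, 'k) tensor \<Rightarrow> ('v, 'k) tensor_alg"
  where "tensor_concat smul =
    linear_extension tensor_scale alg_scale UNIV
      (\<lambda>(v, w). tensor2 (in_degree (length v) (pure_tensor smul v))
                        (in_degree (length w) (pure_tensor smul w)))
      (\<lambda>(v, w). in_degree (length (v @ w)) (pure_tensor smul (v @ w)))"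

definition sym_mult ::
    "('k::field_char_0 \<Rightarrow> 'v::ab_group_add \<Rightarrow> 'v) \<Rightarrow> 'v set \<Rightarrow> 'v set \<Rightarrow>
      (('v, 'k) tensor_alg, 'k) tensor \<Rightarrow> ('v, 'k) tensor_alg"
  where "sym_mult smul V0 V1 x = (\<lambda>n. symmetrizer smul V0 V1 n (tensor_concat smul x n))"

section \<open>The star product\<close>

definition even_form :: "'v set \<Rightarrow> 'v set \<Rightarrow> ('v \<Rightarrow> 'v \<Rightarrow> 'k::zero) \<Rightarrow> bool"
  where "even_form V0 V1 \<Lambda> \<longleftrightarrow> (\<forall>v\<in>V0. \<forall>w\<in>V1. \<Lambda> v w = 0 \<and> \<Lambda> w v = 0)"

definition omit :: "nat \<Rightarrow> 'v list \<Rightarrow> 'v list"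
  where "omit k v = take k v @ drop (Suc k) v"

definition P_op ::
    "('k::field_char_0 \<Rightarrow> 'v::ab_group_add \<Rightarrow> 'v) \<Rightarrow> 'v set \<Rightarrow> 'v set \<Rightarrow> ('v \<Rightarrow> 'v \<Rightarrow> 'k) \<Rightarrow>
      (('v, 'k) tensor_alg, 'k) tensor \<Rightarrow> (('v, 'k) tensor_alg, 'k) tensor"
  where "P_op smul V0 V1 \<Lambda> =
    linear_extension tensor_scale tensor_scale (homogeneous_lists V0 V1 \<times> homogeneous_lists V0 V1)
      (\<lambda>(v, w). tensor2 (sym_monomial smul V0 V1 v) (sym_monomial smul V0 V1 w))
      (\<lambda>(v, w). \<Sum>k<length v. \<Sum>l<length w.
        tensor_scale
          ((-1) ^ (parity V1 (v ! k) * (\<Sum>i\<in>{k<..<length v}. parity V1 (v ! i)) +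
                   parity V1 (w ! l) * (\<Sum>j<l. parity V1 (w ! j))) * \<Lambda> (v ! k) (w ! l))
          (tensor2 (sym_monomial smul V0 V1 (omit k v)) (sym_monomial smul V0 V1 (omit l w))))"

text \<open>The sums over all \<open>k\<close> resp. \<open>n\<close> below, \<^const>\<open>Sum_any\<close>, have finitely many nonzero terms.\<close>

definition star ::
    "('k::field_char_0 \<Rightarrow> 'v::ab_group_add \<Rightarrow> 'v) \<Rightarrow> 'v set \<Rightarrow> 'v set \<Rightarrow> ('v \<Rightarrow> 'v \<Rightarrow> 'k) \<Rightarrow> 'k \<Rightarrow>
      ('v, 'k) tensor_alg \<Rightarrow> ('v, 'k) tensor_alg \<Rightarrow> ('v, 'k) tensor_alg"
  where "star smul V0 V1 \<Lambda> z a b =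
    Sum_any (\<lambda>k. alg_scale (z ^ k / fact k)
      (sym_mult smul V0 V1 ((P_op smul V0 V1 \<Lambda> ^^ k) (tensor2 a b))))"

section \<open>The topologies of the Weyl algebra\<close>

definition weyl_seminorm ::
    "('k::real_normed_field \<Rightarrow> 'v::ab_group_add \<Rightarrow> 'v) \<Rightarrow> ('v \<Rightarrow> real) \<Rightarrow> real \<Rightarrow> ('v, 'k) tensor_alg \<Rightarrow> real"
  where "weyl_seminorm smul p R a =
    Sum_any (\<lambda>n. projective_seminorm smul n p (a n) * fact n powr R)"

definition weyl_topology ::
    "('k::real_normed_field \<Rightarrow> 'v::ab_group_add \<Rightarrow> 'v) \<Rightarrow> 'v topology \<Rightarrow> 'v set \<Rightarrow> 'v set \<Rightarrow> real \<Rightarrow>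
      ('v, 'k) tensor_alg topology"
  where "weyl_topology smul T V0 V1 R =
    seminorm_topology (sym_algebra smul V0 V1)
      {weyl_seminorm smul p R | p. continuous_seminorm smul T p}"

definition weyl_topology_minus ::
    "('k::real_normed_field \<Rightarrow> 'v::ab_group_add \<Rightarrow> 'v) \<Rightarrow> 'v topology \<Rightarrow> 'v set \<Rightarrow> 'v set \<Rightarrow> real \<Rightarrow>
      ('v, 'k) tensor_alg topology"
  where "weyl_topology_minus smul T V0 V1 R =
    seminorm_topology (sym_algebra smul V0 V1)
      {weyl_seminorm smul p (R - \<epsilon>) | p \<epsilon>. continuous_seminorm smul T p \<and> 0 < \<epsilon>}"

end

theory Submission
  imports Defs
begin

text \<open>
  Two facts carry the proof: a formula for the bidifferential operator \<open>P\<close> that makes no reference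
  to symmetrization, and an inequality between factorials that explains the bound \<open>R \<ge> 1/2\<close>.

  \<open>P\<close> is prescribed on the products \<open>v\<^sub>1 \<cdots> v\<^sub>n \<otimes> w\<^sub>1 \<cdots> w\<^sub>m\<close>, which satisfy many linear relations,
  so neither its existence nor its size can be read off from the formula.  But on symmetric tensors
  it agrees with an operator on all tensors: apply \<open>\<Lambda>\<close> to the last factor of the first tensor and
  to the first factor of the second one, and multiply by \<open>nm\<close>.  Indeed \<open>v\<^sub>1 \<cdots> v\<^sub>n\<close> is an average
  over permutations, a permutation is given by the index that it puts last and a permutation of the
  others, and the Koszul sign splits accordingly; for \<open>w\<^sub>1 \<cdots> w\<^sub>m\<close> the same holds with the index put
  first.  This is \<open>contraction_mono\<close>.  As symmetric tensors are mapped to symmetric ones, all powers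
  of \<open>P\<close> are powers of this contraction, and these have an obvious value on pure tensors
  (\<open>contraction_power_word\<close>).

  For the continuity estimate, every continuous seminorm is dominated by a continuous \<open>p\<close> with
  \<open>p v = p v\<^sub>0 + p v\<^sub>1\<close> for the homogeneous components of \<open>v\<close> and with \<open>|\<Lambda>(v, w)| \<le> p v \<sqdot> p w\<close>, since the
  projections and \<open>\<Lambda>\<close> are continuous.  For such \<open>p\<close> permuting tensor factors with Koszul signs, hence
  also symmetrizing, does not increase projective seminorms (\<open>symmetrizer_bound\<close>), and the
  \<open>k\<close>-th term of the star product of tensors of degrees \<open>n\<close> and \<open>m\<close> costs at most \<open>|z|\<^sup>k\<close> times
  \<open>n! m! / ((n - k)! (m - k)! k!) \<sqdot> (n + m - 2k)!\<^sup>R\<close>.  For \<open>R \<ge> 1/2\<close> this is at most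
  \<open>c\<^sup>n\<^sup>+\<^sup>m n!\<^sup>R m!\<^sup>R\<close> (\<open>contraction_cost_le\<close>), and the factor \<open>c\<^sup>n\<^sup>+\<^sup>m\<close> disappears when \<open>p\<close> is replaced by a
  multiple \<open>C p\<close>.  The result is \<open>p\<^sub>R(a \<star> b) \<le> (C p)\<^sub>R(a) (C p)\<^sub>R(b)\<close> (\<open>star_bound\<close>), which says that
  multiplication is jointly continuous.  For the topology with index \<open>R\<^sup>-\<close> and \<open>R > 1/2\<close>, every exponent
  below \<open>R\<close> lies below one in the interval from \<open>1/2\<close> to \<open>R\<close>.

  A topology given by a directed family of seminorms is first countable iff the family is dominated
  by multiples of countably many of its members.  Since \<open>p \<mapsto> p\<^sub>R\<close> is monotone in \<open>p\<close> and \<open>R\<close>, such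
  countable families pass from \<open>V\<close> to the Weyl algebra; since \<open>p\<^sub>R\<close> restricts to \<open>p\<close> on the copy of
  \<open>V\<close> in degree one, they pass back.
\<close>

section \<open>Linear maps on tensors\<close>

abbreviation "linmap \<equiv> Vector_Spaces.linear"
lemmas linmap_iff = Vector_Spaces.linear_iff

lemma vector_space_alg_scale: "vector_space (alg_scale :: 'k::field \<Rightarrow> ('v, 'k) tensor_alg \<Rightarrow> _)"
  by unfold_locales (auto simp: alg_scale_def tensor_scale_def algebra_simps fun_eq_iff)

interpretation tensor: vector_space "tensor_scale :: 'k::field \<Rightarrow> ('x \<Rightarrow> 'k) \<Rightarrow> 'x \<Rightarrow> 'k"
  by (rule vector_space_tensor_scale)

interpretation alg: vector_space "alg_scale :: 'k::field \<Rightarrow> ('v, 'k) tensor_alg \<Rightarrow> ('v, 'k) tensor_alg"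
  by (rule vector_space_alg_scale)

text \<open>
  A linear map with the prescribed values witnesses that the choice in \<open>linear_extension\<close> succeeds,
  so the linear relations between the \<open>g x\<close> never have to be examined.
\<close>

lemma linear_extension_of_linear:
  assumes "linmap s1 s2 L" "\<And>x. x \<in> X \<Longrightarrow> L (g x) = f x"
  shows "linmap s1 s2 (linear_extension s1 s2 X g f)"
    and "\<And>x. x \<in> X \<Longrightarrow> linear_extension s1 s2 X g f (g x) = f x"
proof -
  have "\<exists>L. linmap s1 s2 L \<and> (\<forall>x\<in>X. L (g x) = f x)"
    using assms by blast
  from someI_ex[OF this]
  show "linmap s1 s2 (linear_extension s1 s2 X g f)"
    and "\<And>x. x \<in> X \<Longrightarrow> linear_extension s1 s2 X g f (g x) = f x"
    unfolding linear_extension_def by auto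
qed

lemma linear_eq_on_span_of:
  assumes "linmap s1 s2 f" "linmap s1 s2 g"
    and "\<And>x. x \<in> X \<Longrightarrow> f x = g x" and "y \<in> module.span s1 X"
  shows "f y = g y"
proof -
  interpret vector_space_pair s1 s2
    using assms(1) by (simp add: vector_space_pair_def linmap_iff)
  show ?thesis using linear_eq_on[OF assms(1,2,4)] assms(3) by blast
qed

text \<open>
  Linearity in each slot for lists of every length at once, so that a single map can be defined on
  tensors of all degrees.
\<close>

definition slotwise_linear ::
    "('k::field \<Rightarrow> 'v::ab_group_add \<Rightarrow> 'v) \<Rightarrow> ('k \<Rightarrow> 'u::ab_group_add \<Rightarrow> 'u) \<Rightarrow> ('v list \<Rightarrow> 'u) \<Rightarrow> bool"
  where "slotwise_linear smul smul' f \<longleftrightarrow>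
    (\<forall>xs ys. linmap smul smul' (\<lambda>x. f (xs @ x # ys)))"

lemma multilinear_if_slotwise_linear:
  "slotwise_linear smul smul' f \<Longrightarrow> multilinear smul smul' n f"
  by (simp add: slotwise_linear_def multilinear_def)

text \<open>Permuted lists are given by indexing functions, which is why slot \<open>j\<close> is singled out in this way.\<close>

lemma slotwise_linear_update:
  assumes f: "slotwise_linear smul smul' f" and \<phi>: "linmap smul smul \<phi>" and j: "j < n"
  shows "linmap smul smul' (\<lambda>x. f (map (\<lambda>i. if i = j then \<phi> x else u i) [0..<n]))"
proof -
  have "map (\<lambda>i. if i = j then \<phi> x else u i) [0..<n] = map u [0..<j] @ \<phi> x # map u [Suc j..<n]" for x
  proof -
    have "[0..<n] = [0..<j] @ j # [Suc j..<n]"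
      using j upt_add_eq_append[of 0 j "n - j"] by (simp add: upt_conv_Cons)
    then show ?thesis by simp
  qed
  then show ?thesis
    using f Vector_Spaces.linear_compose[OF \<phi>, of smul' "\<lambda>x. f (map u [0..<j] @ x # map u [Suc j..<n])"]
    by (simp add: slotwise_linear_def o_def)
qed

lemma slotwise_linear_zero:
  assumes "slotwise_linear smul smul' f" "0 \<in> set v"
  shows "f v = 0"
proof -
  obtain xs ys where v: "v = xs @ 0 # ys" using assms(2) by (meson split_list)
  interpret L: Vector_Spaces.linear smul smul' "\<lambda>x. f (xs @ x # ys)"
    using assms(1) by (simp add: slotwise_linear_def)
  show ?thesis using L.zero by (simp add: v)
qed

lemma slotwise_linear_pure_tensor:
  assumes "vector_space smul"
  shows "slotwise_linear smul tensor_scale (pure_tensor smul)"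
proof -
  have "pure_tensor smul (xs @ (x + y) # ys) b
      = pure_tensor smul (xs @ x # ys) b + pure_tensor smul (xs @ y # ys) b"
    "pure_tensor smul (xs @ smul c x # ys) b = c * pure_tensor smul (xs @ x # ys) b" for xs ys x y c b
  proof -
    have "linmap smul (*) (\<lambda>x. b (xs @ x # ys))"
      if "multilinear smul (*) (Suc (length xs + length ys)) b"
      using that by (simp add: multilinear_def)
    then show "pure_tensor smul (xs @ (x + y) # ys) b
      = pure_tensor smul (xs @ x # ys) b + pure_tensor smul (xs @ y # ys) b"
      "pure_tensor smul (xs @ smul c x # ys) b = c * pure_tensor smul (xs @ x # ys) b"
      unfolding pure_tensor_def by (auto simp: linmap_iff)
  qed
  then show ?thesis
    using assms vector_space_tensor_scale
    by (auto simp: slotwise_linear_def linmap_iff tensor_scale_def fun_eq_iff)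
qed

lemma linear_in_degree: "linmap tensor_scale alg_scale (in_degree n)"
  using vector_space_tensor_scale vector_space_alg_scale
  by (auto simp: linmap_iff in_degree_def alg_scale_def tensor_scale_def fun_eq_iff)

text \<open>The pure tensor \<open>v\<^sub>1 \<otimes> \<cdots> \<otimes> v\<^sub>n\<close>, placed in degree \<open>n\<close> of the tensor algebra.\<close>

definition word :: "('k::field \<Rightarrow> 'v::ab_group_add \<Rightarrow> 'v) \<Rightarrow> 'v list \<Rightarrow> ('v, 'k) tensor_alg"
  where "word smul v = in_degree (length v) (pure_tensor smul v)"

lemma slotwise_linear_word:
  assumes "vector_space smul"
  shows "slotwise_linear smul alg_scale (word smul)"
  unfolding slotwise_linear_def
proof (intro allI)
  fix xs ys
  have "linmap smul tensor_scale (\<lambda>x. pure_tensor smul (xs @ x # ys))"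
    using slotwise_linear_pure_tensor[OF assms] by (simp add: slotwise_linear_def)
  from Vector_Spaces.linear_compose[OF this linear_in_degree[of "Suc (length xs + length ys)"]]
  show "linmap smul alg_scale (\<lambda>x. word smul (xs @ x # ys))"
    by (simp add: word_def o_def)
qed

text \<open>
  A relation between words holds in each degree separately, and in each degree the universal
  property of the tensor power applies.
\<close>

lemma tensor_alg_universal:
  assumes s': "vector_space smul'" and f: "slotwise_linear smul smul' f"
  shows "\<exists>L. linmap alg_scale smul' L \<and> (\<forall>v. L (word smul v) = f v)"
proof -
  interpret s': vector_space smul' by fact
  have rel: "(\<Sum>v\<in>A. smul' (c v) (f v)) = 0"
    if A: "finite A" and 0: "(\<Sum>v\<in>A. alg_scale (c v) (word smul v)) = 0" for A c
  proof -
    have deg: "(\<Sum>v\<in>{v\<in>A. length v = n}. smul' (c v) (f v)) = 0" for n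
    proof -
      obtain L where L: "linmap tensor_scale smul' L"
        "\<And>v. length v = n \<Longrightarrow> L (pure_tensor smul v) = f v"
        using tensor_power_universal[OF s' multilinear_if_slotwise_linear[OF f]] by metis
      interpret L: Vector_Spaces.linear tensor_scale smul' L by fact
      have "(\<Sum>v\<in>{v\<in>A. length v = n}. tensor_scale (c v) (pure_tensor smul v))
          = (\<Sum>v\<in>A. alg_scale (c v) (word smul v) n)"
        using A by (intro sum.mono_neutral_cong_left)
          (auto simp: word_def in_degree_def alg_scale_def)
      also have "\<dots> = (\<Sum>v\<in>A. alg_scale (c v) (word smul v)) n"
        using A by (induction A rule: finite_induct) auto
      finally have "L (\<Sum>v\<in>{v\<in>A. length v = n}. tensor_scale (c v) (pure_tensor smul v)) = 0"
        using 0 L.zero by simp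
      then show ?thesis by (simp add: L.sum L.scale L(2))
    qed
    have "(\<Sum>v\<in>A. smul' (c v) (f v)) = (\<Sum>n\<in>length ` A. \<Sum>v\<in>{v\<in>A. length v = n}. smul' (c v) (f v))"
      by (rule sum.image_gen[OF A])
    then show ?thesis by (simp add: deg)
  qed
  show ?thesis
    using linear_extension[OF vector_space_alg_scale s', of UNIV "word smul" f] rel by blast
qed

text \<open>
  Used to replace arbitrary families of tensors by combinations of words, on which values are known.
\<close>

lemma (in vector_space) exists_projection_onto_span:
  "\<exists>\<pi>. linmap scale scale \<pi> \<and> (\<forall>x. \<pi> x \<in> span X) \<and> (\<forall>x\<in>span X. \<pi> x = x)"
proof -
  interpret pair: vector_space_pair scale scale ..
  obtain B where B: "B \<subseteq> X" "independent B" "X \<subseteq> span B"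
    using maximal_independent_subset by metis
  have span: "span X = span B"
    by (metis B(1,3) span_mono span_span subset_antisym)
  let ?\<pi> = "pair.construct B (\<lambda>x. x)"
  have lin: "linmap scale scale ?\<pi>" by (rule pair.linear_construct[OF B(2)])
  have "?\<pi> x = x" if "x \<in> span B" for x
    by (rule linear_eq_on_span_of[OF lin linear_id[unfolded id_def] _ that])
      (use pair.construct_basis[OF B(2)] in auto)
  moreover have "?\<pi> x \<in> span B" for x
    using pair.construct_in_span[OF B(2), of "\<lambda>x. x" x] by simp
  ultimately show ?thesis using lin span by metis
qed

lemma linear_tensor2:
  fixes a b :: "('v, 'k::field) tensor_alg"
  shows "linmap alg_scale tensor_scale (\<lambda>a. tensor2 a b)"
  "linmap alg_scale tensor_scale (\<lambda>b. tensor2 a b)"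
proof -
  have "linmap alg_scale tensor_scale (\<lambda>x. pure_tensor alg_scale (xs @ x # ys))"
    for xs ys :: "('v, 'k) tensor_alg list"
    by (rule slotwise_linear_pure_tensor[OF vector_space_alg_scale, unfolded slotwise_linear_def, rule_format])
  from this[of "[]" "[b]"] this[of "[a]" "[]"]
  show "linmap alg_scale tensor_scale (\<lambda>a. tensor2 a b)"
    "linmap alg_scale tensor_scale (\<lambda>b. tensor2 a b)"
    by (simp_all add: tensor2_def)
qed

lemma tensor2_bilinear:
  fixes a a' b b' :: "('v, 'k::field) tensor_alg"
  shows "tensor2 (a + a') b = tensor2 a b + tensor2 a' b"
  "tensor2 a (b + b') = tensor2 a b + tensor2 a b'"
  "tensor2 (alg_scale c a) b = tensor_scale c (tensor2 a b)"
  "tensor2 a (alg_scale c b) = tensor_scale c (tensor2 a b)"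
  using linear_tensor2(1)[of b] linear_tensor2(2)[of a] by (simp_all add: linmap_iff)

lemma tensor2_sum:
  "tensor2 (\<Sum>i\<in>I. f i) b = (\<Sum>i\<in>I. tensor2 (f i) b)"
  "tensor2 a (\<Sum>i\<in>I. g i) = (\<Sum>i\<in>I. tensor2 a (g i))"
proof -
  interpret l: Vector_Spaces.linear alg_scale tensor_scale "\<lambda>a. tensor2 a b" by (rule linear_tensor2)
  interpret r: Vector_Spaces.linear alg_scale tensor_scale "\<lambda>b. tensor2 a b" by (rule linear_tensor2)
  show "tensor2 (\<Sum>i\<in>I. f i) b = (\<Sum>i\<in>I. tensor2 (f i) b)"
    "tensor2 a (\<Sum>i\<in>I. g i) = (\<Sum>i\<in>I. tensor2 a (g i))"
    by (rule l.sum r.sum)+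
qed

text \<open>
  The tensor product of the tensor algebra with itself is formed over the space of all families of
  tensors, which words do not span.  The bilinear map with the values \<open>F v w\<close> is therefore obtained by
  extending in one variable at a time, after projecting the other one to the span of the words; outside
  this span additivity in the first variable could fail.
\<close>

lemma tensor2_word_universal:
  assumes s: "vector_space smul" and s': "vector_space smul'"
    and F1: "\<And>w. slotwise_linear smul smul' (\<lambda>v. F v w)"
    and F2: "\<And>v. slotwise_linear smul smul' (\<lambda>w. F v w)"
  shows "\<exists>L. linmap tensor_scale smul' L \<and>
    (\<forall>v w. L (tensor2 (word smul v) (word smul w)) = F v w)"
proof -
  interpret s': vector_space smul' by fact
  let ?W = "alg.span (range (word smul))"
  obtain \<pi> :: "('b, 'a) tensor_alg \<Rightarrow> ('b, 'a) tensor_alg"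
    where \<pi>: "linmap alg_scale alg_scale \<pi>" "\<And>x. \<pi> x \<in> ?W" "\<And>x. x \<in> ?W \<Longrightarrow> \<pi> x = x"
    using alg.exists_projection_onto_span by metis
  have word: "word smul v \<in> ?W" for v by (intro alg.span_base) auto
  obtain L where L: "\<And>w. linmap alg_scale smul' (L w)" "\<And>v w. L w (word smul v) = F v w"
    using tensor_alg_universal[OF s' F1] by metis
  have L_lin: "L w 0 = 0" "L w (x + y) = L w x + L w y" "L w (alg_scale c x) = smul' c (L w x)" for w x y c
    using L(1)[of w] linmap_iff[of alg_scale smul' "L w"] s'.scale_zero_left
    by (metis alg.scale_zero_left)+
  have "alg.subspace {a. slotwise_linear smul smul' (\<lambda>w. L w a)}"
    unfolding alg.subspace_def slotwise_linear_def linmap_iff mem_Collect_eq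
    using s s' by (simp add: L_lin algebra_simps s'.scale_right_distrib)
  moreover have "slotwise_linear smul smul' (\<lambda>w. L w x)" if "x \<in> range (word smul)" for x
    using that L(2) F2 by auto
  ultimately have "slotwise_linear smul smul' (\<lambda>w. L w a)" if "a \<in> ?W" for a
    using alg.span_minimal[of "range (word smul)" "{a. slotwise_linear smul smul' (\<lambda>w. L w a)}"] that by blast
  then have "slotwise_linear smul smul' (\<lambda>w. L w (\<pi> a))" for a using \<pi>(2) by blast
  from tensor_alg_universal[OF s' this]
  obtain M where M: "\<And>a. linmap alg_scale smul' (M a)"
    "\<And>a w. M a (word smul w) = L w (\<pi> a)"
    by metis
  have M_lin: "M a (x + y) = M a x + M a y" "M a (alg_scale c x) = smul' c (M a x)" for a x y c
    using M(1)[of a] by (simp_all add: linmap_iff)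
  have \<pi>_lin: "\<pi> (x + y) = \<pi> x + \<pi> y" "\<pi> (alg_scale c x) = alg_scale c (\<pi> x)" for x y c
    using \<pi>(1) by (simp_all add: linmap_iff)
  have add: "M (a + a') b = M a b + M a' b" if "b \<in> ?W" for a a' b
  proof (rule linear_eq_on_span_of[OF M(1) _ _ that])
    show "linmap alg_scale smul' (\<lambda>b. M a b + M a' b)"
      using s' vector_space_alg_scale
      by (simp add: linmap_iff M_lin algebra_simps s'.scale_right_distrib)
    show "M (a + a') x = M a x + M a' x" if "x \<in> range (word smul)" for x
      using that by (auto simp: M(2) \<pi>_lin L_lin)
  qed
  have scale: "M (alg_scale c a) b = smul' c (M a b)" if "b \<in> ?W" for a c b
  proof (rule linear_eq_on_span_of[OF M(1) _ _ that])
    show "linmap alg_scale smul' (\<lambda>b. smul' c (M a b))"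
      using s' vector_space_alg_scale
      by (simp add: linmap_iff M_lin s'.scale_right_distrib s'.scale_left_commute)
    show "M (alg_scale c a) x = smul' c (M a x)" if "x \<in> range (word smul)" for x
      using that by (auto simp: M(2) \<pi>_lin L_lin)
  qed
  define \<beta> where "\<beta> l = M (l ! 0) (\<pi> (l ! 1))" for l
  have \<beta>: "multilinear alg_scale smul' 2 \<beta>"
    unfolding multilinear_def
  proof (intro allI impI)
    fix xs ys :: "('b, 'a) tensor_alg list" assume "length xs + length ys + 1 = 2"
    then consider y where "xs = []" "ys = [y]" | x where "xs = [x]" "ys = []"
      by (cases xs; cases ys) auto
    then show "linmap alg_scale smul' (\<lambda>x. \<beta> (xs @ x # ys))"
    proof cases
      case 1
      then show ?thesis
        using s' vector_space_alg_scale by (simp add: linmap_iff \<beta>_def add scale \<pi>(2))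
    next
      case 2
      then show ?thesis
        using s' vector_space_alg_scale by (simp add: linmap_iff \<beta>_def M_lin \<pi>_lin)
    qed
  qed
  obtain K where K: "linmap tensor_scale smul' K"
    "\<And>v. length v = 2 \<Longrightarrow> K (pure_tensor alg_scale v) = \<beta> v"
    using tensor_power_universal[OF s' \<beta>] by metis
  have "K (tensor2 (word smul v) (word smul w)) = F v w" for v w
    by (simp add: tensor2_def K(2) \<beta>_def M(2) L(2) \<pi>(3) word)
  then show ?thesis using K(1) by blast
qed

section \<open>The Koszul action and the symmetrizer\<close>

context vector_space
begin

context
  fixes A B assumes A: "subspace A" and B: "subspace B" and Int: "A \<inter> B = {0}"
    and sum: "\<And>v. \<exists>a\<in>A. \<exists>b\<in>B. v = a + b"
begin

lemma projection_along_unique: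
  assumes "a \<in> A" "v - a \<in> B"
  shows "projection_along A B v = a"
  unfolding projection_along_def
proof (rule the_equality)
  show "a' = a" if "a' \<in> A \<and> v - a' \<in> B" for a'
  proof -
    have "a' - a \<in> A" using that assms subspace_diff[OF A] by blast
    moreover have "(v - a) - (v - a') \<in> B" using that assms subspace_diff[OF B] by blast
    ultimately have "a' - a \<in> A \<inter> B" by simp
    then show ?thesis using Int by simp
  qed
qed (use assms in simp)

lemma projection_along_in: "projection_along A B v \<in> A" "v - projection_along A B v \<in> B"
proof -
  obtain a b where ab: "a \<in> A" "b \<in> B" "v = a + b" using sum by blast
  then have "projection_along A B v = a" by (intro projection_along_unique) auto
  then show "projection_along A B v \<in> A" "v - projection_along A B v \<in> B" using ab by auto
qed

lemma linear_projection_along: "linmap scale scale (projection_along A B)"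
proof -
  have "projection_along A B (x + y) = projection_along A B x + projection_along A B y" for x y
    using subspace_add[OF A projection_along_in(1)[of x] projection_along_in(1)[of y]]
      subspace_add[OF B projection_along_in(2)[of x] projection_along_in(2)[of y]]
    by (intro projection_along_unique) (auto simp: algebra_simps)
  moreover have "projection_along A B (scale c x) = scale c (projection_along A B x)" for x c
    using subspace_scale[OF A projection_along_in(1)[of x], of c]
      subspace_scale[OF B projection_along_in(2)[of x], of c]
    by (intro projection_along_unique) (auto simp: scale_right_diff_distrib)
  ultimately show ?thesis
    using vector_space_axioms by (simp add: linmap_iff)
qed

end

end

lemma linear_sum_of_linear:
  assumes "vector_space s1" "vector_space s2" "\<And>i. i \<in> I \<Longrightarrow> linmap s1 s2 (f i)"
  shows "linmap s1 s2 (\<lambda>x. \<Sum>i\<in>I. f i x)"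
proof -
  interpret vector_space_pair s1 s2 using assms(1,2) by (simp add: vector_space_pair_def)
  show ?thesis using assms(3) by (intro linear_compose_sum) auto
qed

lemma linear_scale_of_linear:
  assumes "linmap s1 s2 f"
  shows "linmap s1 s2 (\<lambda>x. s2 c (f x))"
proof -
  interpret vector_space_pair s1 s2
    using assms by (simp add: vector_space_pair_def linmap_iff)
  show ?thesis using assms by (rule linear_compose_scale_right)
qed

definition odd_inversions :: "nat \<Rightarrow> (nat \<Rightarrow> nat) \<Rightarrow> nat set \<Rightarrow> nat"
  where "odd_inversions n \<sigma> s = card {(i, j). i < j \<and> j < n \<and> \<sigma> j < \<sigma> i \<and> \<sigma> i \<in> s \<and> \<sigma> j \<in> s}"

locale graded_vector_space = V: vector_space smul
  for smul :: "'k::field_char_0 \<Rightarrow> 'v::ab_group_add \<Rightarrow> 'v" +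
  fixes V0 V1 :: "'v set"
  assumes even_subspace: "V.subspace V0" and odd_subspace: "V.subspace V1"
    and even_Int_odd: "V0 \<inter> V1 = {0}"
    and even_plus_odd: "\<And>v. \<exists>a\<in>V0. \<exists>b\<in>V1. v = a + b"
begin

definition part :: "bool \<Rightarrow> 'v \<Rightarrow> 'v"
  where "part b = (if b then projection_along V1 V0 else projection_along V0 V1)"

lemma odd_Int_even: "V1 \<inter> V0 = {0}" and odd_plus_even: "\<exists>a\<in>V1. \<exists>b\<in>V0. v = a + b"
  using even_Int_odd even_plus_odd[of v] by (blast, metis add.commute)

lemma linear_part: "linmap smul smul (part b)"
  using V.linear_projection_along[OF even_subspace odd_subspace even_Int_odd even_plus_odd]
    V.linear_projection_along[OF odd_subspace even_subspace odd_Int_even odd_plus_even]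
  by (simp add: part_def)

lemma part_in: "part b v \<in> (if b then V1 else V0)"
  using V.projection_along_in(1)[OF even_subspace odd_subspace even_Int_odd even_plus_odd]
    V.projection_along_in(1)[OF odd_subspace even_subspace odd_Int_even odd_plus_even]
  by (simp add: part_def)

lemma part_even: "v \<in> V0 \<Longrightarrow> part b v = (if b then 0 else v)"
  using V.projection_along_unique[OF even_subspace odd_subspace even_Int_odd even_plus_odd, of v v]
    V.projection_along_unique[OF odd_subspace even_subspace odd_Int_even odd_plus_even, of 0 v]
    V.subspace_0[OF odd_subspace]
  by (simp add: part_def V.subspace_0[OF odd_subspace])

lemma part_odd: "v \<in> V1 \<Longrightarrow> part b v = (if b then v else 0)"
  using V.projection_along_unique[OF even_subspace odd_subspace even_Int_odd even_plus_odd, of 0 v]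
    V.projection_along_unique[OF odd_subspace even_subspace odd_Int_even odd_plus_even, of v v]
    V.subspace_0[OF even_subspace] V.subspace_0[OF odd_subspace]
  by (simp add: part_def)

lemma part_sum: "part False v + part True v = v"
proof -
  obtain a b where ab: "a \<in> V0" "b \<in> V1" "v = a + b" using even_plus_odd by blast
  interpret L: Vector_Spaces.linear smul smul "part c" for c by (rule linear_part)
  show ?thesis using ab by (simp add: L.add part_even part_odd)
qed

abbreviation "ptensor \<equiv> pure_tensor smul"
abbreviation "tpower \<equiv> tensor_power smul"
abbreviation "symm \<equiv> symmetrizer smul V0 V1"
abbreviation "hom_lists \<equiv> homogeneous_lists V0 V1"

text \<open>
  The factors are split into homogeneous components one by one; \<open>us\<close> holds those already treated.
\<close>

lemma pure_tensor_in_span_homogeneous: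
  "us \<in> hom_lists \<Longrightarrow> ptensor (us @ v) \<in>
    tensor.span (ptensor ` {u \<in> hom_lists. length u = length us + length v})"
proof (induction v arbitrary: us)
  case Nil
  then show ?case by (intro tensor.span_base) auto
next
  case (Cons x v)
  have hom: "us @ [part b x] \<in> hom_lists" for b
    using Cons.prems part_in[of b x] by (auto simp: homogeneous_lists_def split: if_splits)
  have "linmap smul tensor_scale (\<lambda>x. ptensor (us @ x # v))"
    using slotwise_linear_pure_tensor[OF V.vector_space_axioms] unfolding slotwise_linear_def by blast
  then have sum: "ptensor (us @ (part False x + part True x) # v)
      = ptensor ((us @ [part False x]) @ v) + ptensor ((us @ [part True x]) @ v)"
    by (simp add: linmap_iff)
  have "ptensor ((us @ [part b x]) @ v) \<in>
      tensor.span (ptensor ` {u \<in> hom_lists. length u = length us + length (x # v)})" for b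
    using Cons.IH[OF hom[of b]] by simp
  from tensor.span_add[OF this[of False] this[of True]]
  show ?case unfolding sum[unfolded part_sum] .
qed

lemma tensor_power_homogeneous:
  "tpower n = tensor.span (ptensor ` {u \<in> hom_lists. length u = n})"
proof
  have "ptensor v \<in> tensor.span (ptensor ` {u \<in> hom_lists. length u = n})"
    if "length v = n" for v
    using pure_tensor_in_span_homogeneous[of "[]" v] that by (simp add: homogeneous_lists_def)
  then show "tpower n \<subseteq> tensor.span (ptensor ` {u \<in> hom_lists. length u = n})"
    unfolding tensor_power_def by (intro tensor.span_minimal) (auto simp: tensor.subspace_span)
  show "tensor.span (ptensor ` {u \<in> hom_lists. length u = n}) \<subseteq> tpower n"
    unfolding tensor_power_def by (intro tensor.span_mono) auto
qed

lemma pure_tensor_in_tensor_power: "length v = n \<Longrightarrow> ptensor v \<in> tpower n"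
  unfolding tensor_power_def by (intro tensor.span_base) auto

lemma subspace_tensor_power: "tensor.subspace (tpower n)"
  unfolding tensor_power_def by (rule tensor.subspace_span)

text \<open>
  The summand of \<open>v\<close> in the expansion of \<open>v\<^sub>1 \<otimes> \<cdots> \<otimes> v\<^sub>n\<close> into homogeneous pure tensors whose set of odd
  positions is \<open>s\<close>.
\<close>

definition component :: "nat set \<Rightarrow> 'v list \<Rightarrow> 'v list"
  where "component s v = map (\<lambda>i. part (i \<in> s) (v ! i)) [0..<length v]"

lemma length_component [simp]: "length (component s v) = length v"
  by (simp add: component_def)

lemma nth_component: "i < length v \<Longrightarrow> component s v ! i = part (i \<in> s) (v ! i)"
  by (simp add: component_def)

text \<open>
  The Koszul sign depends on parities and so is not linear in the vectors.  Summing over all parity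
  patterns \<open>s\<close>, each with its own sign, gives a multilinear formula for the action of \<open>\<sigma>\<close>.
\<close>

definition perm_image :: "nat \<Rightarrow> (nat \<Rightarrow> nat) \<Rightarrow> 'v list \<Rightarrow> ('v, 'k) tensor"
  where "perm_image n \<sigma> v = (\<Sum>s\<in>Pow {..<n}. tensor_scale ((-1) ^ odd_inversions n \<sigma> s)
    (ptensor (map (\<lambda>i. component s v ! \<sigma> i) [0..<n])))"

lemma multilinear_perm_image:
  assumes \<sigma>: "\<sigma> permutes {..<n}"
  shows "multilinear smul tensor_scale n (perm_image n \<sigma>)"
  unfolding multilinear_def
proof (intro allI impI)
  fix xs ys :: "'v list" assume len: "length xs + length ys + 1 = n"
  define k where "k = length xs"
  define j where "j = inv \<sigma> k"
  have k: "k < n" using len by (simp add: k_def)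
  have \<sigma>j: "\<sigma> j = k" unfolding j_def using permutes_inverses(1)[OF \<sigma>] by simp
  have j: "j < n" using permutes_in_image[OF \<sigma>, of j] k \<sigma>j by simp
  have "linmap smul tensor_scale
      (\<lambda>x. ptensor (map (\<lambda>i. component s (xs @ x # ys) ! \<sigma> i) [0..<n]))" for s
  proof -
    have nth: "component s (xs @ x # ys) ! \<sigma> i
        = (if i = j then part (k \<in> s) x else component s (xs @ 0 # ys) ! \<sigma> i)" if i: "i < n" for x i
    proof -
      have \<sigma>i: "\<sigma> i < n" using permutes_in_image[OF \<sigma>, of i] i by simp
      have ne: "\<sigma> i \<noteq> k" if "i \<noteq> j"
        using that \<sigma>j permutes_inj[OF \<sigma>] by (auto dest: injD)
      have "(xs @ x # ys) ! \<sigma> i = (xs @ 0 # ys) ! \<sigma> i" if "i \<noteq> j"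
        using ne[OF that] by (auto simp: nth_append nth_Cons' k_def)
      then show ?thesis
        using \<sigma>i len \<sigma>j by (auto simp: nth_component k_def)
    qed
    have map: "map (\<lambda>i. component s (xs @ x # ys) ! \<sigma> i) [0..<n]
        = map (\<lambda>i. if i = j then part (k \<in> s) x else component s (xs @ 0 # ys) ! \<sigma> i) [0..<n]" for x
      using nth by (intro map_cong) auto
    show ?thesis
      unfolding map
      by (rule slotwise_linear_update[OF slotwise_linear_pure_tensor[OF V.vector_space_axioms] linear_part j])
  qed
  then show "linmap smul tensor_scale (\<lambda>x. perm_image n \<sigma> (xs @ x # ys))"
    unfolding perm_image_def
    by (intro linear_sum_of_linear linear_scale_of_linear V.vector_space_axioms vector_space_tensor_scale)
qed

text \<open>
  On homogeneous vectors a pattern other than the actual one selects a zero component somewhere, so that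
  only one summand survives.  This covers zero vectors too, whatever parity they are given.
\<close>

lemma perm_image_homogeneous:
  assumes \<sigma>: "\<sigma> permutes {..<n}" and v: "v \<in> hom_lists" "length v = n"
  shows "perm_image n \<sigma> v =
    tensor_scale (koszul_sign V1 n \<sigma> v) (ptensor (map (\<lambda>i. v ! \<sigma> i) [0..<n]))"
proof -
  define s0 where "s0 = {i. i < n \<and> v ! i \<in> V1}"
  have \<sigma>n: "\<sigma> i < n \<longleftrightarrow> i < n" for i using permutes_in_image[OF \<sigma>, of i] by simp
  have vi: "v ! i \<in> V0 \<union> V1" if "i < n" for i
    using v that by (auto simp: homogeneous_lists_def in_lists_conv_set)
  have other: "ptensor (map (\<lambda>i. component s v ! \<sigma> i) [0..<n]) = 0"
    if s: "s \<in> Pow {..<n}" "s \<noteq> s0" for s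
  proof -
    have "\<exists>i<n. (i \<in> s) \<noteq> (i \<in> s0)" using s unfolding s0_def by auto
    then obtain i where i: "i < n" "(i \<in> s) \<noteq> (i \<in> s0)" by blast
    have "component s v ! i = 0"
    proof (cases "i \<in> s0")
      case True
      then show ?thesis using i v part_odd[of "v ! i"] by (auto simp: nth_component s0_def)
    next
      case False
      then show ?thesis using i v vi[of i] part_even[of "v ! i"] by (auto simp: nth_component s0_def)
    qed
    moreover have "inv \<sigma> i < n" "\<sigma> (inv \<sigma> i) = i"
      using permutes_inverses(1)[OF \<sigma>, of i] \<sigma>n[of "inv \<sigma> i"] i(1) by auto
    ultimately have "0 \<in> set (map (\<lambda>i. component s v ! \<sigma> i) [0..<n])"
      by (auto simp: image_iff intro!: bexI[of _ "inv \<sigma> i"])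
    then show ?thesis
      by (rule slotwise_linear_zero[OF slotwise_linear_pure_tensor[OF V.vector_space_axioms]])
  qed
  have "component s0 v = v"
  proof (rule nth_equalityI)
    fix i assume "i < length (component s0 v)"
    then show "component s0 v ! i = v ! i"
      using v vi[of i] part_odd[of "v ! i"] part_even[of "v ! i"]
      by (cases "i \<in> s0") (auto simp: nth_component s0_def)
  qed simp
  moreover have "odd_inversions n \<sigma> s0 = card {(i, j). i < j \<and> j < n \<and> \<sigma> j < \<sigma> i \<and>
      parity V1 (v ! \<sigma> i) = 1 \<and> parity V1 (v ! \<sigma> j) = 1}"
    unfolding odd_inversions_def
    by (intro arg_cong[of _ _ card]) (auto simp: s0_def parity_def \<sigma>n split: if_splits)
  moreover have "perm_image n \<sigma> v = (\<Sum>s\<in>{s0}. tensor_scale ((-1) ^ odd_inversions n \<sigma> s)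
    (ptensor (map (\<lambda>i. component s v ! \<sigma> i) [0..<n])))"
    unfolding perm_image_def
    by (intro sum.mono_neutral_right) (use other in \<open>auto simp: s0_def\<close>)
  ultimately show ?thesis by (simp add: koszul_sign_def)
qed

lemma perm_action_linear_and_pure:
  assumes \<sigma>: "\<sigma> permutes {..<n}"
  shows linear_perm_action: "linmap tensor_scale tensor_scale (perm_action smul V0 V1 n \<sigma>)"
    and perm_action_pure: "length v = n \<Longrightarrow> perm_action smul V0 V1 n \<sigma> (ptensor v) = perm_image n \<sigma> v"
proof -
  obtain L where L: "linmap tensor_scale tensor_scale L"
    "\<And>v. length v = n \<Longrightarrow> L (ptensor v) = perm_image n \<sigma> v"
    using tensor_power_universal[OF vector_space_tensor_scale multilinear_perm_image[OF \<sigma>]] by blast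
  have hom: "L (ptensor v) =
      tensor_scale (koszul_sign V1 n \<sigma> v) (ptensor (map (\<lambda>i. v ! \<sigma> i) [0..<n]))"
    if "v \<in> {v \<in> hom_lists. length v = n}" for v
    using that L(2) perm_image_homogeneous[OF \<sigma>] by simp
  show lin: "linmap tensor_scale tensor_scale (perm_action smul V0 V1 n \<sigma>)"
    unfolding perm_action_def by (rule linear_extension_of_linear(1)[OF L(1)]) (rule hom)
  have ext: "perm_action smul V0 V1 n \<sigma> (ptensor u) = L (ptensor u)"
    if "u \<in> {v \<in> hom_lists. length v = n}" for u
    unfolding perm_action_def hom[OF that]
    by (rule linear_extension_of_linear(2)[OF L(1) _ that]) (rule hom)
  assume v: "length v = n"
  have "perm_action smul V0 V1 n \<sigma> (ptensor v) = L (ptensor v)"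
  proof (rule linear_eq_on_span_of[OF lin L(1)])
    show "ptensor v \<in> tensor.span (ptensor ` {u \<in> hom_lists. length u = n})"
      using pure_tensor_in_tensor_power[OF v] tensor_power_homogeneous by simp
    show "perm_action smul V0 V1 n \<sigma> x = L x"
      if "x \<in> ptensor ` {u \<in> hom_lists. length u = n}" for x
      using that ext by auto
  qed
  then show "perm_action smul V0 V1 n \<sigma> (ptensor v) = perm_image n \<sigma> v"
    using L(2)[OF v] by simp
qed

lemma linear_symmetrizer:
  "linmap tensor_scale tensor_scale (symm n)"
  unfolding symmetrizer_def
  by (intro linear_scale_of_linear linear_sum_of_linear vector_space_tensor_scale linear_perm_action) auto

lemma symmetrizer_homogeneous:
  assumes "v \<in> hom_lists" "length v = n"
  shows "symm n (ptensor v) = tensor_scale (1 / fact n)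
    (\<Sum>\<sigma> | \<sigma> permutes {..<n}. tensor_scale (koszul_sign V1 n \<sigma> v)
      (ptensor (map (\<lambda>i. v ! \<sigma> i) [0..<n])))"
  unfolding symmetrizer_def
  using assms by (intro arg_cong2[of _ _ _ _ tensor_scale] sum.cong)
    (auto simp: perm_action_pure perm_image_homogeneous)

lemma symmetrizer_in_tensor_power:
  assumes "t \<in> tpower n"
  shows "symm n t \<in> tpower n"
proof -
  interpret S: Vector_Spaces.linear tensor_scale tensor_scale "symm n"
    by (rule linear_symmetrizer)
  have "symm n ` tpower n
      = tensor.span (symm n ` ptensor ` {u \<in> hom_lists. length u = n})"
    unfolding tensor_power_homogeneous by (rule S.span_image[symmetric])
  also have "\<dots> \<subseteq> tpower n"
    by (intro tensor.span_minimal subspace_tensor_power)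
      (auto simp: symmetrizer_homogeneous intro!: pure_tensor_in_tensor_power
        tensor.subspace_scale[OF subspace_tensor_power] tensor.subspace_sum[OF subspace_tensor_power])
  finally show ?thesis using assms by blast
qed

lemma sym_power_subset: "sym_power smul V0 V1 n \<subseteq> tpower n"
  unfolding sym_power_def using symmetrizer_in_tensor_power by blast

lemma subspace_sym_power: "tensor.subspace (sym_power smul V0 V1 n)"
proof -
  interpret S: Vector_Spaces.linear tensor_scale tensor_scale "symm n"
    by (rule linear_symmetrizer)
  show ?thesis unfolding sym_power_def by (intro S.subspace_image subspace_tensor_power)
qed

text \<open>Degree one carries the copy of \<open>V\<close> from which the topology of \<open>V\<close> is recovered.\<close>

lemma sym_power_one: "t \<in> tpower 1 \<Longrightarrow> t \<in> sym_power smul V0 V1 1"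
proof -
  assume t: "t \<in> tpower 1"
  have perm: "{\<sigma>. \<sigma> permutes {..<1::nat}} = {id}"
    by (simp add: lessThan_Suc permutes_sing)
  have id: "symm 1 (ptensor u) = ptensor u"
    if "u \<in> hom_lists" "length u = 1" for u
  proof -
    have "koszul_sign V1 1 id u = (1 :: 'k)"
    proof -
      have "{(i, j). i < j \<and> j < 1 \<and> id j < id i \<and>
          parity V1 (u ! id i) = 1 \<and> parity V1 (u ! id j) = 1} = {}" by auto
      then show ?thesis unfolding koszul_sign_def by (simp only: card.empty power_0)
    qed
    moreover have "map (\<lambda>i. u ! id i) [0..<1] = u" using that(2) by (cases u) auto
    ultimately show ?thesis
      unfolding symmetrizer_homogeneous[OF that] perm by simp
  qed
  have "symm 1 t = t"
    by (rule linear_eq_on_span_of[OF linear_symmetrizer tensor.linear_id[unfolded id_def]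
          _ t[unfolded tensor_power_homogeneous]]) (use id in auto)
  then show "t \<in> sym_power smul V0 V1 1" unfolding sym_power_def using t by force
qed

end

section \<open>Permutations with one prescribed value\<close>

text \<open>
  \<open>skip k\<close> enumerates the indices other than \<open>k\<close> increasingly, and \<open>unskip k\<close> is its inverse there.
\<close>

definition skip :: "nat \<Rightarrow> nat \<Rightarrow> nat"
  where "skip k i = (if i < k then i else Suc i)"

definition unskip :: "nat \<Rightarrow> nat \<Rightarrow> nat"
  where "unskip k i = (if i < k then i else i - 1)"

lemma skip_neq [simp]: "skip k i \<noteq> k" "k \<noteq> skip k i"
  by (auto simp: skip_def)

lemma unskip_skip [simp]: "unskip k (skip k i) = i"
  by (auto simp: skip_def unskip_def)

lemma skip_unskip: "i \<noteq> k \<Longrightarrow> skip k (unskip k i) = i"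
  by (auto simp: skip_def unskip_def)

lemma skip_less_iff [simp]: "skip k i < skip k j \<longleftrightarrow> i < j"
  by (auto simp: skip_def)

lemma skip_eq_iff [simp]: "skip k i = skip k j \<longleftrightarrow> i = j"
  by (auto simp: skip_def)

lemma skip_bound: "i < n \<Longrightarrow> skip k i < Suc n"
  by (auto simp: skip_def)

lemma unskip_bound: "i < Suc n \<Longrightarrow> i \<noteq> k \<Longrightarrow> k \<le> n \<Longrightarrow> unskip k i < n"
  by (auto simp: unskip_def)

text \<open>
  The permutation of \<open>{..n}\<close> that takes the value \<open>k\<close> at \<open>q\<close> and behaves like the permutation \<open>\<rho>\<close> of
  \<open>{..<n}\<close> between the remaining positions and values.
\<close>

definition insert_perm :: "nat \<Rightarrow> nat \<Rightarrow> nat \<Rightarrow> (nat \<Rightarrow> nat) \<Rightarrow> nat \<Rightarrow> nat"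
  where "insert_perm n q k \<rho> i =
    (if i = q then k else if i < Suc n then skip k (\<rho> (unskip q i)) else i)"

lemma insert_perm_at [simp]: "insert_perm n q k \<rho> q = k"
  by (simp add: insert_perm_def)

lemma insert_perm_skip: "i < n \<Longrightarrow> insert_perm n q k \<rho> (skip q i) = skip k (\<rho> i)"
  using skip_bound[of i n q] by (simp add: insert_perm_def)

lemma insert_perm_permutes:
  assumes \<rho>: "\<rho> permutes {..<n}" and "q \<le> n" "k \<le> n"
  shows "insert_perm n q k \<rho> permutes {..<Suc n}"
proof -
  let ?\<sigma> = "insert_perm n q k \<rho>"
  have \<rho>n: "\<rho> i < n \<longleftrightarrow> i < n" for i using permutes_in_image[OF \<rho>, of i] by simp
  have "inj_on ?\<sigma> {..<Suc n}"
  proof (rule inj_onI)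
    fix i j assume ij: "i \<in> {..<Suc n}" "j \<in> {..<Suc n}" "?\<sigma> i = ?\<sigma> j"
    show "i = j"
    proof (cases "i = q \<or> j = q")
      case True
      then show ?thesis using ij by (auto simp: insert_perm_def split: if_splits)
    next
      case False
      then have "\<rho> (unskip q i) = \<rho> (unskip q j)" using ij by (simp add: insert_perm_def)
      then have "unskip q i = unskip q j" using permutes_inj[OF \<rho>] by (simp add: inj_def)
      then show ?thesis using False skip_unskip by metis
    qed
  qed
  moreover have "?\<sigma> ` {..<Suc n} \<subseteq> {..<Suc n}"
    using assms unskip_bound[of _ n q] \<rho>n skip_bound by (auto simp: insert_perm_def)
  ultimately have "bij_betw ?\<sigma> {..<Suc n} {..<Suc n}"
    by (simp add: bij_betw_def endo_inj_surj)
  then show ?thesis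
    by (rule bij_imp_permutes) (use assms in \<open>auto simp: insert_perm_def\<close>)
qed

text \<open>
  \<open>k\<close> and \<open>\<rho>\<close> can be recovered from the permutation; surjectivity follows by counting, as
  \<open>(n + 1) \<sqdot> n! = (n + 1)!\<close>.
\<close>

lemma bij_betw_insert_perm:
  assumes "q \<le> n"
  shows "bij_betw (\<lambda>(k, \<rho>). insert_perm n q k \<rho>) ({..n} \<times> {\<rho>. \<rho> permutes {..<n}}) {\<sigma>. \<sigma> permutes {..<Suc n}}"
proof -
  let ?f = "\<lambda>(k, \<rho>). insert_perm n q k \<rho>" and ?D = "{..n} \<times> {\<rho>. \<rho> permutes {..<n}}"
  have inj: "inj_on ?f ?D"
  proof (rule inj_onI, clarify)
    fix k \<rho> l \<tau> assume \<rho>: "\<rho> permutes {..<n}" and \<tau>: "\<tau> permutes {..<n}"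
      and eq: "insert_perm n q k \<rho> = insert_perm n q l \<tau>"
    have kl: "k = l" using fun_cong[OF eq, of q] by simp
    have "\<rho> i = \<tau> i" for i
    proof (cases "i < n")
      case True
      then show ?thesis using fun_cong[OF eq, of "skip q i"] kl by (simp add: insert_perm_skip)
    next
      case False
      then show ?thesis using permutes_not_in[OF \<rho>, of i] permutes_not_in[OF \<tau>, of i] by simp
    qed
    then show "k = l \<and> \<rho> = \<tau>" using kl by auto
  qed
  have sub: "?f ` ?D \<subseteq> {\<sigma>. \<sigma> permutes {..<Suc n}}"
    using insert_perm_permutes[OF _ assms] by auto
  have "card ?D = card {\<sigma>. \<sigma> permutes {..<Suc n}}"
    by (simp add: card_cartesian_product card_permutations)
  then have "card (?f ` ?D) = card {\<sigma>. \<sigma> permutes {..<Suc n}}"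
    by (simp add: card_image[OF inj])
  then have "?f ` ?D = {\<sigma>. \<sigma> permutes {..<Suc n}}"
    using sub by (intro card_subset_eq finite_permutations) auto
  then show ?thesis using inj by (simp add: bij_betw_def)
qed

lemma sum_permutes_Suc:
  assumes "q \<le> n"
  shows "(\<Sum>\<sigma> | \<sigma> permutes {..<Suc n}. g \<sigma>) =
    (\<Sum>k<Suc n. \<Sum>\<rho> | \<rho> permutes {..<n}. g (insert_perm n q k \<rho>))"
proof -
  have "(\<Sum>\<sigma> | \<sigma> permutes {..<Suc n}. g \<sigma>)
      = (\<Sum>(k, \<rho>)\<in>{..n} \<times> {\<rho>. \<rho> permutes {..<n}}. g (insert_perm n q k \<rho>))"
    using sum.reindex_bij_betw[OF bij_betw_insert_perm[OF assms], of g]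
    by (simp add: case_prod_unfold)
  also have "\<dots> = (\<Sum>k<Suc n. \<Sum>\<rho> | \<rho> permutes {..<n}. g (insert_perm n q k \<rho>))"
    by (simp only: sum.cartesian_product[symmetric] lessThan_Suc_atMost)
  finally show ?thesis .
qed

text \<open>
  Inversions not involving position \<open>q\<close> are those of \<open>\<rho>\<close>, because skipping an index is monotone.  The
  other two summands count the inversions between \<open>q\<close> and an earlier or later position.
\<close>

lemma odd_inversions_insert_perm:
  fixes k :: nat
  assumes \<rho>: "\<rho> permutes {..<n}" and q: "q \<le> n"
  defines "\<sigma> \<equiv> insert_perm n q k \<rho>"
  shows "odd_inversions (Suc n) \<sigma> s = odd_inversions n \<rho> (skip k -` s) +
    card {i. i < q \<and> k < \<sigma> i \<and> \<sigma> i \<in> s \<and> k \<in> s} +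
    card {j. q < j \<and> j < Suc n \<and> \<sigma> j < k \<and> \<sigma> j \<in> s \<and> k \<in> s}"
proof -
  let ?I = "{(i, j). i < j \<and> j < Suc n \<and> \<sigma> j < \<sigma> i \<and> \<sigma> i \<in> s \<and> \<sigma> j \<in> s}"
  let ?J = "{(i, j). i < j \<and> j < n \<and> \<rho> j < \<rho> i \<and> \<rho> i \<in> skip k -` s \<and> \<rho> j \<in> skip k -` s}"
  let ?A = "{i. i < q \<and> k < \<sigma> i \<and> \<sigma> i \<in> s \<and> k \<in> s}"
  let ?B = "{j. q < j \<and> j < Suc n \<and> \<sigma> j < k \<and> \<sigma> j \<in> s \<and> k \<in> s}"
  have \<sigma>q: "\<sigma> q = k" by (simp add: \<sigma>_def)
  have \<sigma>_skip: "\<sigma> (skip q i) = skip k (\<rho> i)" if "i < n" for i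
    using that by (simp add: \<sigma>_def insert_perm_skip)
  have "?I \<subseteq> map_prod (skip q) (skip q) ` ?J \<union> (\<lambda>i. (i, q)) ` ?A \<union> (\<lambda>j. (q, j)) ` ?B"
  proof
    fix x assume "x \<in> ?I"
    then obtain i j where x: "x = (i, j)" and ij: "i < j" "j < Suc n" "\<sigma> j < \<sigma> i" "\<sigma> i \<in> s" "\<sigma> j \<in> s"
      by blast
    consider "j = q" | "i = q" "j \<noteq> q" | "i \<noteq> q" "j \<noteq> q" by blast
    then show "x \<in> map_prod (skip q) (skip q) ` ?J \<union> (\<lambda>i. (i, q)) ` ?A \<union> (\<lambda>j. (q, j)) ` ?B"
    proof cases
      case 1
      then show ?thesis using ij x \<sigma>q by auto
    next
      case 2
      then show ?thesis using ij x \<sigma>q by auto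
    next
      case 3
      define i' j' where "i' = unskip q i" and "j' = unskip q j"
      have i: "i = skip q i'" and j: "j = skip q j'"
        using 3 by (simp_all add: i'_def j'_def skip_unskip)
      have "j' < n" using 3 ij q by (simp add: j'_def unskip_bound)
      moreover have "i' < j'" using ij(1) by (simp add: i j)
      ultimately have "(i', j') \<in> ?J" using ij by (simp add: i j \<sigma>_skip)
      then have "x \<in> map_prod (skip q) (skip q) ` ?J" unfolding x i j by (rule rev_image_eqI) simp
      then show ?thesis by blast
    qed
  qed
  moreover have "map_prod (skip q) (skip q) ` ?J \<union> (\<lambda>i. (i, q)) ` ?A \<union> (\<lambda>j. (q, j)) ` ?B \<subseteq> ?I"
    using q by (auto simp: \<sigma>q \<sigma>_skip skip_bound)
  ultimately have I: "?I = map_prod (skip q) (skip q) ` ?J \<union> (\<lambda>i. (i, q)) ` ?A \<union> (\<lambda>j. (q, j)) ` ?B"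
    by (rule subset_antisym)
  have fJ: "finite ?J" by (rule finite_subset[of _ "{..<n} \<times> {..<n}"]) auto
  have fA: "finite ?A" and fB: "finite ?B" by auto
  have "card ?I = card (map_prod (skip q) (skip q) ` ?J) + card ((\<lambda>i. (i, q)) ` ?A) + card ((\<lambda>j. (q, j)) ` ?B)"
    unfolding I using fJ fA fB by (subst card_Un_disjoint; auto)+
  also have "card (map_prod (skip q) (skip q) ` ?J) = card ?J"
    by (rule card_image) (auto simp: inj_on_def)
  also have "card ((\<lambda>i. (i, q)) ` ?A) = card ?A" by (rule card_image) (auto simp: inj_on_def)
  also have "card ((\<lambda>j. (q, j)) ` ?B) = card ?B" by (rule card_image) (auto simp: inj_on_def)
  finally show ?thesis by (simp add: odd_inversions_def)
qed

lemma card_permutes_Collect: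
  assumes "\<sigma> permutes {..<n}"
  shows "card {i. i < n \<and> Q (\<sigma> i)} = card {j. j < n \<and> Q j}"
proof -
  have "\<sigma> i < n \<longleftrightarrow> i < n" for i using permutes_in_image[OF assms, of i] by simp
  moreover have "j = \<sigma> (inv \<sigma> j)" for j using permutes_inverses(1)[OF assms] by simp
  ultimately have "\<sigma> ` {i. i < n \<and> Q (\<sigma> i)} = {j. j < n \<and> Q j}"
    unfolding image_def set_eq_iff mem_Collect_eq Bex_def by metis
  then show ?thesis
    using card_image[OF inj_on_subset[OF permutes_inj[OF assms] subset_UNIV], of "{i. i < n \<and> Q (\<sigma> i)}"]
    by simp
qed

text \<open>
  Every position other than the last precedes it, so the values counted are simply those above \<open>k\<close>.
\<close>

lemma odd_inversions_insert_last:
  assumes \<rho>: "\<rho> permutes {..<n}" and k: "k \<le> n"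
  shows "odd_inversions (Suc n) (insert_perm n n k \<rho>) s = odd_inversions n \<rho> (skip k -` s) +
    card {j. j < Suc n \<and> k < j \<and> j \<in> s \<and> k \<in> s}"
proof -
  let ?\<sigma> = "insert_perm n n k \<rho>"
  have "{i. i < n \<and> k < ?\<sigma> i \<and> ?\<sigma> i \<in> s \<and> k \<in> s} = {i. i < Suc n \<and> k < ?\<sigma> i \<and> ?\<sigma> i \<in> s \<and> k \<in> s}"
    by (auto simp: less_Suc_eq)
  moreover have "{j. n < j \<and> j < Suc n \<and> ?\<sigma> j < k \<and> ?\<sigma> j \<in> s \<and> k \<in> s} = {}" by auto
  ultimately show ?thesis
    using odd_inversions_insert_perm[OF \<rho> order_refl, of k s]
      card_permutes_Collect[OF insert_perm_permutes[OF \<rho> order_refl k], of "\<lambda>j. k < j \<and> j \<in> s \<and> k \<in> s"]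
    by simp
qed

lemma odd_inversions_insert_first:
  assumes \<rho>: "\<rho> permutes {..<n}" and k: "k \<le> n"
  shows "odd_inversions (Suc n) (insert_perm n 0 k \<rho>) s = odd_inversions n \<rho> (skip k -` s) +
    card {j. j < Suc n \<and> j < k \<and> j \<in> s \<and> k \<in> s}"
proof -
  let ?\<sigma> = "insert_perm n 0 k \<rho>"
  have "{j. 0 < j \<and> j < Suc n \<and> ?\<sigma> j < k \<and> ?\<sigma> j \<in> s \<and> k \<in> s} = {i. i < Suc n \<and> ?\<sigma> i < k \<and> ?\<sigma> i \<in> s \<and> k \<in> s}"
    by (auto intro: gr0I)
  then show ?thesis
    using odd_inversions_insert_perm[OF \<rho> le0, of k s]
      card_permutes_Collect[OF insert_perm_permutes[OF \<rho> le0 k], of "\<lambda>j. j < k \<and> j \<in> s \<and> k \<in> s"]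
    by simp
qed

lemma koszul_sign_odd_inversions:
  "koszul_sign V1 n \<sigma> v = (- 1) ^ odd_inversions n \<sigma> {i. v ! i \<in> V1}"
  unfolding koszul_sign_def odd_inversions_def
  by (intro arg_cong[of _ _ "\<lambda>S. (- 1) ^ card S"]) (auto simp: parity_def split: if_splits)

lemma nth_omit: "i < length v - 1 \<Longrightarrow> k < length v \<Longrightarrow> omit k v ! i = v ! skip k i"
  by (auto simp: omit_def skip_def nth_append min_def)

lemma length_omit: "k < length v \<Longrightarrow> length (omit k v) = length v - 1"
  by (auto simp: omit_def)

lemma card_parity_sum: "finite I \<Longrightarrow> card {j \<in> I. v ! j \<in> V1} = (\<Sum>j\<in>I. parity V1 (v ! j))"
  by (simp add: parity_def sum.If_cases Int_def)

lemma odd_inversions_cong: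
  assumes "\<sigma> permutes {..<n}" "\<And>i. i < n \<Longrightarrow> i \<in> s \<longleftrightarrow> i \<in> t"
  shows "odd_inversions n \<sigma> s = odd_inversions n \<sigma> t"
  unfolding odd_inversions_def
  using assms(2) permutes_in_image[OF assms(1)]
  by (intro arg_cong[of _ _ card]) (auto simp: lessThan_iff dest: less_trans)

text \<open>
  The signs on the right are those in the definition of \<open>P\<close>: moving \<open>v\<^sub>k\<close> to the end passes the odd
  vectors behind it, moving it to the front passes those before it.
\<close>

lemma koszul_sign_insert:
  assumes v: "length v = Suc n" and k: "k < Suc n" and \<rho>: "\<rho> permutes {..<n}"
  shows koszul_sign_insert_last: "koszul_sign V1 (Suc n) (insert_perm n n k \<rho>) v =
      (- 1) ^ (parity V1 (v ! k) * (\<Sum>i\<in>{k<..<Suc n}. parity V1 (v ! i))) * koszul_sign V1 n \<rho> (omit k v)"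
    and koszul_sign_insert_first: "koszul_sign V1 (Suc n) (insert_perm n 0 k \<rho>) v =
      (- 1) ^ (parity V1 (v ! k) * (\<Sum>j<k. parity V1 (v ! j))) * koszul_sign V1 n \<rho> (omit k v)"
proof -
  let ?s = "{i. v ! i \<in> V1}"
  have k': "k \<le> n" using k by simp
  have inner: "odd_inversions n \<rho> (skip k -` ?s) = odd_inversions n \<rho> {i. omit k v ! i \<in> V1}"
    using v k by (intro odd_inversions_cong[OF \<rho>]) (auto simp: nth_omit)
  have "card {j. j < Suc n \<and> k < j \<and> j \<in> ?s \<and> k \<in> ?s} = parity V1 (v ! k) * card {j \<in> {k<..<Suc n}. v ! j \<in> V1}"
  proof (cases "v ! k \<in> V1")
    case True
    then have "{j. j < Suc n \<and> k < j \<and> j \<in> ?s \<and> k \<in> ?s} = {j \<in> {k<..<Suc n}. v ! j \<in> V1}" by auto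
    then show ?thesis using True by (simp add: parity_def)
  qed (simp add: parity_def)
  then show "koszul_sign V1 (Suc n) (insert_perm n n k \<rho>) v =
      (- 1) ^ (parity V1 (v ! k) * (\<Sum>i\<in>{k<..<Suc n}. parity V1 (v ! i))) * koszul_sign V1 n \<rho> (omit k v)"
    unfolding koszul_sign_odd_inversions odd_inversions_insert_last[OF \<rho> k'] inner power_add
    by (simp only: card_parity_sum finite_greaterThanLessThan finite_lessThan mult.commute)
  have "card {j. j < Suc n \<and> j < k \<and> j \<in> ?s \<and> k \<in> ?s} = parity V1 (v ! k) * card {j \<in> {..<k}. v ! j \<in> V1}"
  proof (cases "v ! k \<in> V1")
    case True
    then have "{j. j < Suc n \<and> j < k \<and> j \<in> ?s \<and> k \<in> ?s} = {j \<in> {..<k}. v ! j \<in> V1}" using k by auto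
    then show ?thesis using True by (simp add: parity_def)
  qed (simp add: parity_def)
  then show "koszul_sign V1 (Suc n) (insert_perm n 0 k \<rho>) v =
      (- 1) ^ (parity V1 (v ! k) * (\<Sum>j<k. parity V1 (v ! j))) * koszul_sign V1 n \<rho> (omit k v)"
    unfolding koszul_sign_odd_inversions odd_inversions_insert_first[OF \<rho> k'] inner power_add
    by (simp only: card_parity_sum finite_greaterThanLessThan finite_lessThan mult.commute)
qed

definition perm_list :: "(nat \<Rightarrow> nat) \<Rightarrow> 'a list \<Rightarrow> 'a list"
  where "perm_list \<sigma> v = map (\<lambda>i. v ! \<sigma> i) [0..<length v]"

lemma length_perm_list [simp]: "length (perm_list \<sigma> v) = length v"
  by (simp add: perm_list_def)

lemma perm_list_insert:
  assumes v: "length v = Suc n" and k: "k < Suc n" and \<rho>: "\<rho> permutes {..<n}"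
  shows perm_list_insert_last: "perm_list (insert_perm n n k \<rho>) v = perm_list \<rho> (omit k v) @ [v ! k]"
    and perm_list_insert_first: "perm_list (insert_perm n 0 k \<rho>) v = v ! k # perm_list \<rho> (omit k v)"
proof -
  have \<rho>n: "\<rho> i < n" if "i < n" for i using permutes_in_image[OF \<rho>, of i] that by simp
  have omit: "omit k v ! \<rho> i = v ! skip k (\<rho> i)" if "i < n" for i
    using \<rho>n[OF that] v k by (simp add: nth_omit)
  have "insert_perm n n k \<rho> i = skip k (\<rho> i)" if "i < n" for i
    using insert_perm_skip[OF that, of n k \<rho>] that by (simp add: skip_def)
  then show "perm_list (insert_perm n n k \<rho>) v = perm_list \<rho> (omit k v) @ [v ! k]"
    unfolding perm_list_def using v k by (simp add: length_omit omit)
  have "insert_perm n 0 k \<rho> (Suc i) = skip k (\<rho> i)" if "i < n" for i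
    using insert_perm_skip[OF that, of 0 k \<rho>] by (simp add: skip_def)
  then show "perm_list (insert_perm n 0 k \<rho>) v = v ! k # perm_list \<rho> (omit k v)"
    unfolding perm_list_def using v k
    by (simp add: length_omit omit upt_conv_Cons map_Suc_upt[symmetric] del: upt_Suc)
qed

section \<open>The star product as a contraction\<close>

lemma linear_funpow: "linmap s s L \<Longrightarrow> linmap s s (L ^^ k)"
proof (induction k)
  case 0
  then show ?case by (auto simp: linmap_iff)
next
  case (Suc k)
  then show ?case by (auto simp: linmap_iff)
qed

lemma sum_in_degree:
  assumes "finite I" "\<And>n. n \<notin> I \<Longrightarrow> a n = 0"
  shows "a = (\<Sum>n\<in>I. in_degree n (a n))"
proof
  fix m
  have "(\<Sum>n\<in>I. in_degree n (a n)) m = (\<Sum>n\<in>I. in_degree n (a n) m)"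
    using assms(1) by (induction I rule: finite_induct) auto
  then show "a m = (\<Sum>n\<in>I. in_degree n (a n)) m"
    using assms by (simp add: in_degree_def)
qed

context graded_vector_space
begin

abbreviation "S \<equiv> sym_algebra smul V0 V1"
abbreviation "wd \<equiv> word smul"
abbreviation "mono_of \<equiv> sym_monomial smul V0 V1"

lemma word_linear: "linmap smul alg_scale (\<lambda>x. wd (xs @ x # ys))"
  using slotwise_linear_word[OF V.vector_space_axioms] unfolding slotwise_linear_def by blast

lemma concat_linear_and_word:
  shows linear_tensor_concat: "linmap tensor_scale alg_scale (tensor_concat smul)"
    and tensor_concat_word: "tensor_concat smul (tensor2 (wd v) (wd w)) = wd (v @ w)"
proof -
  have "slotwise_linear smul alg_scale (\<lambda>v. wd (v @ w))" for w
    unfolding slotwise_linear_def using word_linear by simp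
  moreover have "slotwise_linear smul alg_scale (\<lambda>w. wd (v @ w))" for v
    unfolding slotwise_linear_def append_assoc[symmetric] using word_linear by blast
  ultimately obtain L where L: "linmap tensor_scale alg_scale L"
    "\<And>v w. L (tensor2 (wd v) (wd w)) = wd (v @ w)"
    using tensor2_word_universal[OF V.vector_space_axioms vector_space_alg_scale,
        of "\<lambda>v w. wd (v @ w)"] by blast
  let ?g = "\<lambda>(v, w). tensor2 (in_degree (length v) (ptensor v))
      (in_degree (length w) (ptensor w))"
  let ?f = "\<lambda>(v, w). in_degree (length (v @ w)) (ptensor (v @ w))"
  have L': "L (?g x) = ?f x" for x
    using L(2) by (cases x) (simp add: word_def)
  note ext = linear_extension_of_linear[of tensor_scale alg_scale L UNIV ?g ?f, OF L(1) L',
      folded tensor_concat_def]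
  show "linmap tensor_scale alg_scale (tensor_concat smul)"
    by (rule ext(1))
  show "tensor_concat smul (tensor2 (wd v) (wd w)) = wd (v @ w)"
    using ext(2)[of "(v, w)"] by (simp add: word_def)
qed

lemma linear_sym_mult: "linmap tensor_scale alg_scale (sym_mult smul V0 V1)"
proof -
  have c: "tensor_concat smul (x + y) = tensor_concat smul x + tensor_concat smul y"
    "tensor_concat smul (tensor_scale r x) = alg_scale r (tensor_concat smul x)" for x y r
    using linear_tensor_concat by (simp_all add: linmap_iff)
  have s: "symm n (x + y) = symm n x + symm n y"
    "symm n (tensor_scale r x) = tensor_scale r (symm n x)" for n x y r
    using linear_symmetrizer by (simp_all add: linmap_iff)
  have "sym_mult smul V0 V1 (x + y) = sym_mult smul V0 V1 x + sym_mult smul V0 V1 y" for x y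
    unfolding sym_mult_def c plus_fun_def[of "tensor_concat smul x"] s by (simp only: plus_fun_def)
  moreover have "sym_mult smul V0 V1 (tensor_scale r x) = alg_scale r (sym_mult smul V0 V1 x)" for r x
    unfolding sym_mult_def c alg_scale_def s by (rule refl)
  ultimately show ?thesis
    using vector_space_tensor_scale vector_space_alg_scale by (simp add: linmap_iff)
qed

lemma symmetrizer_zero [simp]: "symm n 0 = 0"
proof -
  interpret S: Vector_Spaces.linear tensor_scale tensor_scale "symm n"
    by (rule linear_symmetrizer)
  show ?thesis by (rule S.zero)
qed

lemma sym_mult_word: "sym_mult smul V0 V1 (tensor2 (wd v) (wd w)) = mono_of (v @ w)"
  unfolding sym_mult_def tensor_concat_word unfolding sym_monomial_def word_def in_degree_def
  by (auto simp: fun_eq_iff)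

lemma in_degree_sum: "in_degree n (\<Sum>i\<in>I. f i) = (\<Sum>i\<in>I. in_degree n (f i))"
proof -
  interpret L: Vector_Spaces.linear tensor_scale alg_scale "in_degree n" by (rule linear_in_degree)
  show ?thesis by (rule L.sum)
qed

lemma in_degree_scale: "in_degree n (tensor_scale c t) = alg_scale c (in_degree n t)"
proof -
  interpret L: Vector_Spaces.linear tensor_scale alg_scale "in_degree n" by (rule linear_in_degree)
  show ?thesis by (rule L.scale)
qed

lemma mono_homogeneous:
  assumes "v \<in> hom_lists"
  shows "mono_of v = (\<Sum>\<sigma> | \<sigma> permutes {..<length v}.
    alg_scale (1 / fact (length v) * koszul_sign V1 (length v) \<sigma> v) (wd (perm_list \<sigma> v)))"
  unfolding sym_monomial_def symmetrizer_homogeneous[OF assms refl] tensor.scale_sum_right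
    in_degree_sum tensor.scale_scale in_degree_scale
  by (intro sum.cong) (auto simp: word_def perm_list_def)

lemma tensor2_mono:
  assumes "v \<in> hom_lists" "w \<in> hom_lists"
  shows "tensor2 (mono_of v) (mono_of w) =
    (\<Sum>\<sigma> | \<sigma> permutes {..<length v}. \<Sum>\<tau> | \<tau> permutes {..<length w}.
      tensor_scale (1 / fact (length v) * koszul_sign V1 (length v) \<sigma> v *
          (1 / fact (length w) * koszul_sign V1 (length w) \<tau> w))
        (tensor2 (wd (perm_list \<sigma> v)) (wd (perm_list \<tau> w))))"
  unfolding mono_homogeneous[OF assms(1)] mono_homogeneous[OF assms(2)]
    tensor2_sum(1) tensor2_bilinear(3)
  unfolding tensor2_sum(2) tensor2_bilinear(4) tensor.scale_scale tensor.scale_sum_right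
  by (rule refl)

end

locale graded_form = graded_vector_space smul V0 V1
  for smul :: "'k::field_char_0 \<Rightarrow> 'v::ab_group_add \<Rightarrow> 'v" and V0 V1 +
  fixes \<Lambda> :: "'v \<Rightarrow> 'v \<Rightarrow> 'k"
  assumes bilinear_form: "bilinear_on smul UNIV (*) \<Lambda>"
begin

text \<open>
  \<open>\<Lambda>\<close> is applied to the two factors that face each other in \<open>v \<otimes> w\<close>, so no sign arises.  The factor \<open>nm\<close>
  accounts for the choice of a factor on either side, which symmetric tensors do not distinguish.
\<close>

definition contract_words :: "'v list \<Rightarrow> 'v list \<Rightarrow> (('v, 'k) tensor_alg, 'k) tensor"
  where "contract_words v w = (if v = [] \<or> w = [] then 0
    else tensor_scale (of_nat (length v * length w) * \<Lambda> (last v) (hd w))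
      (tensor2 (wd (butlast v)) (wd (tl w))))"

lemma contract_words_snoc_Cons:
  "contract_words (u @ [x]) (y # t) =
    tensor_scale (of_nat (Suc (length u)) * of_nat (Suc (length t)) * \<Lambda> x y) (tensor2 (wd u) (wd t))"
  unfolding contract_words_def of_nat_mult[symmetric] by simp

lemma form_linear: "linmap smul (*) (\<lambda>x. \<Lambda> x w)" "linmap smul (*) (\<Lambda> v)"
  using bilinear_form V.vector_space_axioms
  by (auto simp: linmap_iff bilinear_on_def algebra_simps intro!: vector_space.intro)

lemma slotwise_linear_contract_words:
  "slotwise_linear smul tensor_scale (\<lambda>v. contract_words v w)"
  "slotwise_linear smul tensor_scale (\<lambda>w. contract_words v w)"
proof -
  have scal: "linmap smul tensor_scale (\<lambda>x. tensor_scale (c * \<phi> x) t)"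
    if "linmap smul (*) \<phi>" for c \<phi> and t :: "(('v, 'k) tensor_alg, 'k) tensor"
    using that vector_space_tensor_scale
    by (simp add: linmap_iff distrib_left tensor.scale_left_distrib mult.left_commute)
  have l: "linmap smul tensor_scale (\<lambda>x. tensor_scale c (tensor2 (wd (xs @ x # ys)) b))"
    "linmap smul tensor_scale (\<lambda>x. tensor_scale c (tensor2 a (wd (xs @ x # ys))))"
    for c xs ys a b
    using Vector_Spaces.linear_compose[OF word_linear linear_tensor2(1)]
      Vector_Spaces.linear_compose[OF word_linear linear_tensor2(2)]
    by (auto simp: o_def intro!: linear_scale_of_linear)
  have zero: "linmap smul tensor_scale (\<lambda>x. 0 :: (('v, 'k) tensor_alg, 'k) tensor)"
    using V.vector_space_axioms vector_space_tensor_scale by (simp add: linmap_iff)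
  show "slotwise_linear smul tensor_scale (\<lambda>v. contract_words v w)"
    unfolding slotwise_linear_def
  proof (intro allI)
    fix xs ys
    show "linmap smul tensor_scale (\<lambda>x. contract_words (xs @ x # ys) w)"
    proof (cases "w = []")
      case True
      then show ?thesis using zero by (simp add: contract_words_def)
    next
      case False
      show ?thesis
      proof (cases "ys = []")
        case True
        then show ?thesis using False scal[OF form_linear(1)]
          by (simp add: contract_words_def del: of_nat_mult)
      next
        case ys: False
        then have "butlast (xs @ x # ys) = xs @ x # butlast ys" for x by (simp add: butlast_append)
        then show ?thesis using False ys l(1)
          by (simp add: contract_words_def del: of_nat_mult)
      qed
    qed
  qed
  show "slotwise_linear smul tensor_scale (\<lambda>w. contract_words v w)"
    unfolding slotwise_linear_def
  proof (intro allI)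
    fix xs ys
    show "linmap smul tensor_scale (\<lambda>x. contract_words v (xs @ x # ys))"
    proof (cases "v = []")
      case True
      then show ?thesis using zero by (simp add: contract_words_def)
    next
      case False
      show ?thesis
      proof (cases xs)
        case Nil
        then show ?thesis using False scal[OF form_linear(2)]
          by (simp add: contract_words_def del: of_nat_mult)
      next
        case (Cons y xs')
        then show ?thesis using False l(2)
          by (simp add: contract_words_def del: of_nat_mult)
      qed
    qed
  qed
qed

definition contraction ::
    "(('v, 'k) tensor_alg, 'k) tensor \<Rightarrow> (('v, 'k) tensor_alg, 'k) tensor"
  where "contraction = (SOME L. linmap tensor_scale tensor_scale L \<and>
    (\<forall>v w. L (tensor2 (wd v) (wd w)) = contract_words v w))"

lemma linear_contraction: "linmap tensor_scale tensor_scale contraction"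
  and contraction_word: "contraction (tensor2 (wd v) (wd w)) = contract_words v w"
proof -
  have "\<exists>L. linmap tensor_scale tensor_scale L \<and>
    (\<forall>v w. L (tensor2 (wd v) (wd w)) = contract_words v w)"
    using tensor2_word_universal[OF V.vector_space_axioms vector_space_tensor_scale
        slotwise_linear_contract_words] .
  from someI_ex[OF this]
  show "linmap tensor_scale tensor_scale contraction"
    "contraction (tensor2 (wd v) (wd w)) = contract_words v w"
    unfolding contraction_def by blast+
qed

definition P_value :: "'v list \<Rightarrow> 'v list \<Rightarrow> (('v, 'k) tensor_alg, 'k) tensor"
  where "P_value v w = (\<Sum>k<length v. \<Sum>l<length w.
        tensor_scale
          ((-1) ^ (parity V1 (v ! k) * (\<Sum>i\<in>{k<..<length v}. parity V1 (v ! i)) +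
                   parity V1 (w ! l) * (\<Sum>j<l. parity V1 (w ! j))) * \<Lambda> (v ! k) (w ! l))
          (tensor2 (mono_of (omit k v)) (mono_of (omit l w))))"

lemma omit_hom: "v \<in> hom_lists \<Longrightarrow> omit k v \<in> hom_lists"
  unfolding homogeneous_lists_def omit_def by (auto dest: in_set_takeD in_set_dropD)

text \<open>
  Both products are averages over permutations.  Permutations of the left factor are sorted by the
  index \<open>k\<close> that they put last, those of the right factor by the index \<open>l\<close> that they put first.  The
  remaining permutations form the products with \<open>v\<^sub>k\<close> and \<open>w\<^sub>l\<close> omitted; the factor \<open>nm\<close> turns
  \<open>1 / (n! m!)\<close> into \<open>1 / ((n - 1)! (m - 1)!)\<close>.
\<close>

lemma contraction_mono:
  assumes v: "v \<in> hom_lists" and w: "w \<in> hom_lists"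
  shows "contraction (tensor2 (mono_of v) (mono_of w)) = P_value v w"
proof -
  interpret C: Vector_Spaces.linear tensor_scale tensor_scale contraction by (rule linear_contraction)
  let ?c = "\<lambda>u \<sigma>. 1 / fact (length u) * koszul_sign V1 (length u) \<sigma> u"
  have expand: "contraction (tensor2 (mono_of v) (mono_of w)) =
    (\<Sum>\<sigma> | \<sigma> permutes {..<length v}. \<Sum>\<tau> | \<tau> permutes {..<length w}.
      tensor_scale (?c v \<sigma> * ?c w \<tau>) (contract_words (perm_list \<sigma> v) (perm_list \<tau> w)))"
    unfolding tensor2_mono[OF v w] by (simp only: C.sum C.scale contraction_word)
  show ?thesis
  proof (cases "v = [] \<or> w = []")
    case True
    then have "contract_words (perm_list \<sigma> v) (perm_list \<tau> w) = 0" for \<sigma> \<tau>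
      by (auto simp: contract_words_def perm_list_def)
    moreover have "P_value v w = 0" using True by (auto simp: P_value_def)
    ultimately show ?thesis unfolding expand by simp
  next
    case False
    then obtain n m where n: "length v = Suc n" and m: "length w = Suc m"
      by (metis length_0_conv not0_implies_Suc)
    define S where "S k = (-1 :: 'k) ^ (parity V1 (v ! k) * (\<Sum>i\<in>{k<..<Suc n}. parity V1 (v ! i)))" for k
    define S' where "S' l = (-1 :: 'k) ^ (parity V1 (w ! l) * (\<Sum>j<l. parity V1 (w ! j)))" for l
    let ?t = "\<lambda>k l \<rho> \<rho>'. tensor_scale (S k * S' l * \<Lambda> (v ! k) (w ! l))
      (tensor_scale (?c (omit k v) \<rho> * ?c (omit l w) \<rho>')
        (tensor2 (wd (perm_list \<rho> (omit k v))) (wd (perm_list \<rho>' (omit l w)))))"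
    have term_eq: "tensor_scale (?c v (insert_perm n n k \<rho>) * ?c w (insert_perm m 0 l \<rho>'))
        (contract_words (perm_list (insert_perm n n k \<rho>) v) (perm_list (insert_perm m 0 l \<rho>') w))
      = ?t k l \<rho> \<rho>'"
      if k: "k < Suc n" and l: "l < Suc m" and \<rho>: "\<rho> permutes {..<n}" and \<rho>': "\<rho>' permutes {..<m}"
      for k l \<rho> \<rho>'
    proof -
      have len: "length (omit k v) = n" "length (omit l w) = m"
        using length_omit[of k v] length_omit[of l w] k l n m by simp_all
      have c: "?c v (insert_perm n n k \<rho>) * of_nat (Suc n) = S k * ?c (omit k v) \<rho>"
        unfolding n koszul_sign_insert_last[OF n k \<rho>] len S_def
        by (simp add: fact_Suc field_simps del: of_nat_Suc)
      have c': "?c w (insert_perm m 0 l \<rho>') * of_nat (Suc m) = S' l * ?c (omit l w) \<rho>'"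
        unfolding m koszul_sign_insert_first[OF m l \<rho>'] len S'_def
        by (simp add: fact_Suc field_simps del: of_nat_Suc)
      have "contract_words (perm_list (insert_perm n n k \<rho>) v) (perm_list (insert_perm m 0 l \<rho>') w)
          = tensor_scale (of_nat (Suc n) * of_nat (Suc m) * \<Lambda> (v ! k) (w ! l))
            (tensor2 (wd (perm_list \<rho> (omit k v))) (wd (perm_list \<rho>' (omit l w))))"
        unfolding perm_list_insert_last[OF n k \<rho>] perm_list_insert_first[OF m l \<rho>'] contract_words_snoc_Cons
          length_perm_list len by (rule refl)
      moreover have "?c v (insert_perm n n k \<rho>) * ?c w (insert_perm m 0 l \<rho>') *
          (of_nat (Suc n) * of_nat (Suc m) * \<Lambda> (v ! k) (w ! l))
          = (?c v (insert_perm n n k \<rho>) * of_nat (Suc n)) *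
            (?c w (insert_perm m 0 l \<rho>') * of_nat (Suc m)) * \<Lambda> (v ! k) (w ! l)"
        by (simp only: mult_ac)
      moreover have "\<dots> = S k * S' l * \<Lambda> (v ! k) (w ! l) * (?c (omit k v) \<rho> * ?c (omit l w) \<rho>')"
        unfolding c c' by (simp only: mult_ac)
      ultimately show ?thesis by (simp only: tensor.scale_scale)
    qed
    have "contraction (tensor2 (mono_of v) (mono_of w)) =
      (\<Sum>k<Suc n. \<Sum>\<rho> | \<rho> permutes {..<n}. \<Sum>l<Suc m. \<Sum>\<rho>' | \<rho>' permutes {..<m}.
        tensor_scale (?c v (insert_perm n n k \<rho>) * ?c w (insert_perm m 0 l \<rho>'))
          (contract_words (perm_list (insert_perm n n k \<rho>) v) (perm_list (insert_perm m 0 l \<rho>') w)))"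
      unfolding expand unfolding n m
      by (simp only: sum_permutes_Suc[OF order_refl[of n]] sum_permutes_Suc[OF le0[of m]])
    also have "\<dots> = (\<Sum>k<Suc n. \<Sum>\<rho> | \<rho> permutes {..<n}. \<Sum>l<Suc m. \<Sum>\<rho>' | \<rho>' permutes {..<m}. ?t k l \<rho> \<rho>')"
      by (intro sum.cong refl term_eq) auto
    also have "\<dots> = (\<Sum>k<Suc n. \<Sum>l<Suc m. \<Sum>\<rho> | \<rho> permutes {..<n}. \<Sum>\<rho>' | \<rho>' permutes {..<m}. ?t k l \<rho> \<rho>')"
      by (intro sum.cong refl sum.swap)
    also have "\<dots> = (\<Sum>k<Suc n. \<Sum>l<Suc m. tensor_scale (S k * S' l * \<Lambda> (v ! k) (w ! l))
        (tensor2 (mono_of (omit k v)) (mono_of (omit l w))))"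
    proof (intro sum.cong refl)
      fix k l assume "k \<in> {..<Suc n}" "l \<in> {..<Suc m}"
      then have len: "length (omit k v) = n" "length (omit l w) = m"
        using length_omit[of k v] length_omit[of l w] n m by simp_all
      show "(\<Sum>\<rho> | \<rho> permutes {..<n}. \<Sum>\<rho>' | \<rho>' permutes {..<m}. ?t k l \<rho> \<rho>') =
        tensor_scale (S k * S' l * \<Lambda> (v ! k) (w ! l)) (tensor2 (mono_of (omit k v)) (mono_of (omit l w)))"
        unfolding tensor2_mono[OF omit_hom[OF v] omit_hom[OF w]] len tensor.scale_sum_right by (rule refl)
    qed
    also have "\<dots> = P_value v w"
      unfolding P_value_def n m S_def S'_def power_add by (rule refl)
    finally show ?thesis .
  qed
qed

lemma P_op_linear_and_mono:
  shows linear_P_op: "linmap tensor_scale tensor_scale (P_op smul V0 V1 \<Lambda>)"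
    and P_op_mono: "v \<in> hom_lists \<Longrightarrow> w \<in> hom_lists \<Longrightarrow>
      P_op smul V0 V1 \<Lambda> (tensor2 (mono_of v) (mono_of w)) = P_value v w"
proof -
  let ?g = "\<lambda>(v, w). tensor2 (mono_of v) (mono_of w)"
  let ?f = "\<lambda>(v, w). P_value v w"
  have *: "contraction (?g x) = ?f x" if "x \<in> hom_lists \<times> hom_lists" for x
    using that contraction_mono by auto
  note ext = linear_extension_of_linear[of tensor_scale tensor_scale contraction
      "hom_lists \<times> hom_lists" ?g ?f, OF linear_contraction *, unfolded P_value_def, folded P_op_def]
  show "linmap tensor_scale tensor_scale (P_op smul V0 V1 \<Lambda>)"
    by (rule ext(1))
  show "P_op smul V0 V1 \<Lambda> (tensor2 (mono_of v) (mono_of w)) = P_value v w"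
    if "v \<in> hom_lists" "w \<in> hom_lists"
    using ext(2)[of "(v, w)"] that by (simp add: P_value_def)
qed

definition mono_span :: "(('v, 'k) tensor_alg, 'k) tensor set"
  where "mono_span = tensor.span {tensor2 (mono_of v) (mono_of w) | v w. v \<in> hom_lists \<and> w \<in> hom_lists}"

lemma P_op_eq_contraction: "x \<in> mono_span \<Longrightarrow> P_op smul V0 V1 \<Lambda> x = contraction x"
  unfolding mono_span_def
  by (erule linear_eq_on_span_of[OF linear_P_op linear_contraction, rotated])
    (auto simp: P_op_mono contraction_mono)

lemma contraction_mono_span:
  assumes "x \<in> mono_span" shows "contraction x \<in> mono_span"
proof -
  interpret C: Vector_Spaces.linear tensor_scale tensor_scale contraction by (rule linear_contraction)
  have "P_value v w \<in> mono_span" if "v \<in> hom_lists" "w \<in> hom_lists" for v w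
    unfolding P_value_def mono_span_def using that
    by (intro tensor.span_sum tensor.span_scale tensor.span_base) (auto intro: omit_hom)
  then have "contraction ` {tensor2 (mono_of v) (mono_of w) | v w. v \<in> hom_lists \<and> w \<in> hom_lists} \<subseteq> mono_span"
    by (auto simp: contraction_mono)
  then have "tensor.span (contraction ` {tensor2 (mono_of v) (mono_of w) | v w. v \<in> hom_lists \<and> w \<in> hom_lists})
      \<subseteq> mono_span"
    unfolding mono_span_def by (intro tensor.span_minimal tensor.subspace_span)
  then show ?thesis using assms unfolding C.span_image mono_span_def by blast
qed

text \<open>
  The contraction agrees with \<open>P\<close> only on products of symmetric tensors, so powers agree because the
  formula for \<open>P\<close> does not lead out of the span of such products.
\<close>

lemma P_op_power: "x \<in> mono_span \<Longrightarrow> (P_op smul V0 V1 \<Lambda> ^^ k) x = (contraction ^^ k) x \<and>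
    (contraction ^^ k) x \<in> mono_span"
  by (induction k) (auto simp: P_op_eq_contraction contraction_mono_span)

lemma sym_algebra_in_mono_span:
  assumes a: "a \<in> sym_algebra smul V0 V1"
  shows "a \<in> alg.span (mono_of ` hom_lists)"
proof -
  have fin: "finite {n. a n \<noteq> 0}" and an: "\<And>n. a n \<in> sym_power smul V0 V1 n"
    using a by (auto simp: sym_algebra_def)
  have "a = (\<Sum>n | a n \<noteq> 0. in_degree n (a n))" by (rule sum_in_degree[OF fin]) simp
  also have "\<dots> \<in> alg.span (mono_of ` hom_lists)"
  proof (rule alg.span_sum)
    fix n
    let ?L = "\<lambda>t. in_degree n (symm n t)"
    interpret L: Vector_Spaces.linear tensor_scale alg_scale ?L
      using Vector_Spaces.linear_compose[OF linear_symmetrizer linear_in_degree] by (simp add: o_def)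
    have "in_degree n (a n) \<in> ?L ` tensor.span (ptensor ` {u \<in> hom_lists. length u = n})"
      using an[of n] unfolding sym_power_def tensor_power_homogeneous by auto
    also have "\<dots> = alg.span (?L ` ptensor ` {u \<in> hom_lists. length u = n})"
      by (rule L.span_image[symmetric])
    also have "\<dots> \<subseteq> alg.span (mono_of ` hom_lists)"
      by (intro alg.span_mono) (auto simp: sym_monomial_def)
    finally show "in_degree n (a n) \<in> alg.span (mono_of ` hom_lists)" .
  qed
  finally show ?thesis .
qed

lemma tensor2_in_mono_span:
  assumes "a \<in> sym_algebra smul V0 V1" "b \<in> sym_algebra smul V0 V1"
  shows "tensor2 a b \<in> mono_span"
proof -
  have a: "a \<in> alg.span (mono_of ` hom_lists)" by (rule sym_algebra_in_mono_span[OF assms(1)])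
  have b: "b \<in> alg.span (mono_of ` hom_lists)" by (rule sym_algebra_in_mono_span[OF assms(2)])
  interpret l: Vector_Spaces.linear alg_scale tensor_scale "\<lambda>x. tensor2 x u" for u :: "('v, 'k) tensor_alg"
    by (rule linear_tensor2)
  interpret r: Vector_Spaces.linear alg_scale tensor_scale "\<lambda>x. tensor2 u x" for u :: "('v, 'k) tensor_alg"
    by (rule linear_tensor2)
  have 1: "tensor2 (mono_of v) b \<in> mono_span" if v: "v \<in> hom_lists" for v
  proof -
    have "tensor2 (mono_of v) ` mono_of ` hom_lists
        \<subseteq> {tensor2 (mono_of v) (mono_of w) | v w. v \<in> hom_lists \<and> w \<in> hom_lists}"
      using v by auto
    from tensor.span_mono[OF this] show ?thesis
      unfolding r.span_image mono_span_def using imageI[OF b, of "tensor2 (mono_of v)"] by (rule subsetD)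
  qed
  have "(\<lambda>a. tensor2 a b) ` mono_of ` hom_lists \<subseteq> mono_span" using 1 by auto
  from tensor.span_minimal[OF this[unfolded mono_span_def] tensor.subspace_span]
  show ?thesis
    unfolding l.span_image mono_span_def using imageI[OF a, of "\<lambda>a. tensor2 a b"] by (rule subsetD)
qed

text \<open>
  For \<open>k\<close> beyond the length of either list the factor \<open>i = length v\<close> or \<open>i = length w\<close> vanishes.
\<close>

definition star_coeff :: "nat \<Rightarrow> 'v list \<Rightarrow> 'v list \<Rightarrow> 'k"
  where "star_coeff k v w = (\<Prod>i<k. of_nat ((length v - i) * (length w - i)) *
    \<Lambda> (v ! (length v - Suc i)) (w ! i))"

lemma contraction_power_word:
  "(contraction ^^ k) (tensor2 (wd v) (wd w)) =
    tensor_scale (star_coeff k v w) (tensor2 (wd (take (length v - k) v)) (wd (drop k w)))"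
proof (induction k)
  case 0
  show ?case by (simp add: star_coeff_def)
next
  case (Suc k)
  interpret C: Vector_Spaces.linear tensor_scale tensor_scale contraction by (rule linear_contraction)
  let ?v = "take (length v - k) v" and ?w = "drop k w"
  have "contract_words ?v ?w = tensor_scale (of_nat ((length v - k) * (length w - k)) *
      \<Lambda> (v ! (length v - Suc k)) (w ! k)) (tensor2 (wd (take (length v - Suc k) v)) (wd (drop (Suc k) w)))"
  proof (cases "k < length v \<and> k < length w")
    case True
    have "last ?v = v ! (length v - Suc k)" using True by (subst last_conv_nth) auto
    moreover have "butlast ?v = take (length v - Suc k) v" using True by (simp add: butlast_take)
    moreover have "hd ?w = w ! k" using True by (simp add: hd_drop_conv_nth)
    moreover have "tl ?w = drop (Suc k) w" by (simp add: tl_drop drop_Suc)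
    moreover have "?v \<noteq> []" "?w \<noteq> []" using True by auto
    ultimately show ?thesis using True by (simp only: contract_words_def) simp
  next
    case False
    then show ?thesis by (auto simp: contract_words_def)
  qed
  then show ?case
    by (simp add: Suc C.scale contraction_word star_coeff_def mult.commute)
qed

text \<open>
  Up to the factor \<open>z\<^sup>k / k!\<close>, the \<open>k\<close>-th term of the star product.  It is defined through the
  contraction and therefore on all tensors, where representations by pure tensors can be used.
\<close>

definition star_term :: "nat \<Rightarrow> ('v, 'k) tensor_alg \<Rightarrow> ('v, 'k) tensor_alg \<Rightarrow> ('v, 'k) tensor_alg"
  where "star_term k a b = sym_mult smul V0 V1 ((contraction ^^ k) (tensor2 a b))"

lemma star_term_word:
  "star_term k (wd v) (wd w) = alg_scale (star_coeff k v w) (mono_of (take (length v - k) v @ drop k w))"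
proof -
  interpret M: Vector_Spaces.linear tensor_scale alg_scale "sym_mult smul V0 V1" by (rule linear_sym_mult)
  show ?thesis unfolding star_term_def contraction_power_word M.scale sym_mult_word by (rule refl)
qed

lemma star_coeff_zero: "length v < k \<or> length w < k \<Longrightarrow> star_coeff k v w = 0"
  unfolding star_coeff_def by (auto simp: prod_zero_iff)

lemma star_term_linear:
  "linmap alg_scale alg_scale (\<lambda>a. star_term k a b)"
  "linmap alg_scale alg_scale (\<lambda>b. star_term k a b)"
proof -
  have "linmap tensor_scale alg_scale (sym_mult smul V0 V1 \<circ> (contraction ^^ k))"
    by (rule Vector_Spaces.linear_compose[OF linear_funpow[OF linear_contraction] linear_sym_mult])
  from Vector_Spaces.linear_compose[OF linear_tensor2(1) this] Vector_Spaces.linear_compose[OF linear_tensor2(2) this]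
  show "linmap alg_scale alg_scale (\<lambda>a. star_term k a b)"
    "linmap alg_scale alg_scale (\<lambda>b. star_term k a b)"
    by (simp_all add: star_term_def o_def)
qed

lemma star_term_bilinear:
  "star_term k (a + a') b = star_term k a b + star_term k a' b"
  "star_term k a (b + b') = star_term k a b + star_term k a b'"
  "star_term k (alg_scale c a) b = alg_scale c (star_term k a b)"
  "star_term k a (alg_scale c b) = alg_scale c (star_term k a b)"
  using star_term_linear(1)[of k b] star_term_linear(2)[of k a] by (simp_all add: linmap_iff)

lemma star_term_sum:
  "star_term k (\<Sum>i\<in>I. f i) b = (\<Sum>i\<in>I. star_term k (f i) b)"
  "star_term k a (\<Sum>i\<in>I. g i) = (\<Sum>i\<in>I. star_term k a (g i))"
proof -
  interpret l: Vector_Spaces.linear alg_scale alg_scale "\<lambda>a. star_term k a b" by (rule star_term_linear)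
  interpret r: Vector_Spaces.linear alg_scale alg_scale "\<lambda>b. star_term k a b" by (rule star_term_linear)
  show "star_term k (\<Sum>i\<in>I. f i) b = (\<Sum>i\<in>I. star_term k (f i) b)"
    "star_term k a (\<Sum>i\<in>I. g i) = (\<Sum>i\<in>I. star_term k a (g i))"
    by (rule l.sum r.sum)+
qed

lemma star_eq_star_terms:
  assumes "a \<in> sym_algebra smul V0 V1" "b \<in> sym_algebra smul V0 V1"
  shows "star smul V0 V1 \<Lambda> z a b = Sum_any (\<lambda>k. alg_scale (z ^ k / fact k) (star_term k a b))"
  unfolding star_def star_term_def
  using P_op_power[OF tensor2_in_mono_span[OF assms]] by simp

end

section \<open>Topologies defined by seminorms\<close>

lemma seminorm_onD:
  assumes "seminorm_on smul A p"
  shows "\<And>x. x \<in> A \<Longrightarrow> 0 \<le> p x" "\<And>x y. x \<in> A \<Longrightarrow> y \<in> A \<Longrightarrow> p (x + y) \<le> p x + p y"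
    "\<And>c x. x \<in> A \<Longrightarrow> p (smul c x) = norm c * p x"
  using assms by (auto simp: seminorm_on_def)

locale seminorm_family = vector_space smul
  for smul :: "'k::real_normed_field \<Rightarrow> 'a::ab_group_add \<Rightarrow> 'a" +
  fixes A :: "'a set" and PP :: "('a \<Rightarrow> real) set"
  assumes subspace_carrier: "subspace A"
    and seminorm: "\<And>p. p \<in> PP \<Longrightarrow> seminorm_on smul A p"
begin

lemma carrier_closed:
  "0 \<in> A" "x \<in> A \<Longrightarrow> y \<in> A \<Longrightarrow> x + y \<in> A" "x \<in> A \<Longrightarrow> y \<in> A \<Longrightarrow> x - y \<in> A"
  using subspace_carrier subspace_0 subspace_add subspace_diff by blast+

lemma seminorm_zero: "p \<in> PP \<Longrightarrow> p 0 = 0"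
  using seminorm_onD(3)[OF seminorm carrier_closed(1), of p 0] by simp

lemma seminorm_minus_commute: "p \<in> PP \<Longrightarrow> x \<in> A \<Longrightarrow> y \<in> A \<Longrightarrow> p (x - y) = p (y - x)"
  using seminorm_onD(3)[OF seminorm, of p "y - x" "- 1"] carrier_closed(3)
  by (simp add: scale_minus_left)

lemma seminorm_triangle:
  assumes "p \<in> PP" "x \<in> A" "y \<in> A" "w \<in> A"
  shows "p (x - w) \<le> p (x - y) + p (y - w)"
  using seminorm_onD(2)[OF seminorm, of p "x - y" "y - w"] assms carrier_closed(3) by simp

abbreviation "topo \<equiv> seminorm_topology A PP"

lemma topspace_seminorm_topology: "topspace topo = A"
  by (auto simp: seminorm_topology_def topology_generated_by_topspace)

lemma openin_ball:
  assumes "p \<in> PP" "x \<in> A" "0 < e"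
  shows "openin topo {y \<in> A. p (y - x) < e}"
  unfolding seminorm_topology_def using assms by (intro topology_generated_by_Basis) blast

lemma openin_finite_ball:
  assumes "finite F" "F \<subseteq> PP" "x \<in> A" "0 < e"
  shows "openin topo {y \<in> A. \<forall>p\<in>F. p (y - x) < e}"
  using assms(1,2)
proof (induction F rule: finite_induct)
  case empty
  show ?case using openin_topspace[of "topo"] by (simp add: topspace_seminorm_topology)
next
  case (insert p F)
  have "{y \<in> A. \<forall>q\<in>insert p F. q (y - x) < e} = {y \<in> A. p (y - x) < e} \<inter> {y \<in> A. \<forall>p\<in>F. p (y - x) < e}"
    by auto
  then show ?case using insert assms openin_ball by (simp add: openin_Int)
qed

lemma finite_ball_subset_open:
  assumes "openin topo U" "x \<in> U"
  shows "\<exists>F e. finite F \<and> F \<subseteq> PP \<and> 0 < e \<and> {y \<in> A. \<forall>p\<in>F. p (y - x) < e} \<subseteq> U"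
proof -
  have "generate_topology_on
      (insert A {{y \<in> A. p (y - x) < e} | p x e. p \<in> PP \<and> x \<in> A \<and> 0 < e}) U"
    using assms(1) by (simp add: seminorm_topology_def openin_topology_generated_by_iff)
  then show ?thesis using assms(2)
  proof (induction rule: generate_topology_on.induct)
    case Empty
    then show ?case by simp
  next
    case (Int U V)
    then obtain F e G d where F: "finite F" "F \<subseteq> PP" "0 < e" "{y \<in> A. \<forall>p\<in>F. p (y - x) < e} \<subseteq> U"
      and G: "finite G" "G \<subseteq> PP" "0 < d" "{y \<in> A. \<forall>p\<in>G. p (y - x) < d} \<subseteq> V"
      by blast
    have "{y \<in> A. \<forall>p\<in>F \<union> G. p (y - x) < min e d} \<subseteq> U \<inter> V" using F(4) G(4) by auto
    moreover have "finite (F \<union> G)" "F \<union> G \<subseteq> PP" "0 < min e d" using F G by auto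
    ultimately show ?case by blast
  next
    case (UN K)
    then obtain k where "k \<in> K" "x \<in> k" by blast
    then show ?case using UN.IH[of k] by (meson Union_upper order_trans)
  next
    case (Basis S)
    show ?case
    proof (cases "S = A")
      case True
      then show ?thesis by (intro exI[of _ "{}"] exI[of _ 1]) auto
    next
      case False
      then obtain p c e where p: "p \<in> PP" "c \<in> A" "0 < e" and S: "S = {y \<in> A. p (y - c) < e}"
        using Basis.hyps by blast
      have x: "x \<in> A" "p (x - c) < e" using Basis.prems unfolding S by simp_all
      have "p (y - c) < e" if "y \<in> A" "p (y - x) < e - p (x - c)" for y
        using seminorm_triangle[OF p(1) that(1) x(1) p(2)] that(2) by simp
      then have "{y \<in> A. \<forall>q\<in>{p}. q (y - x) < e - p (x - c)} \<subseteq> S" unfolding S by auto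
      then show ?thesis using p(1) x(2) by (intro exI[of _ "{p}"] exI[of _ "e - p (x - c)"]) auto
    qed
  qed
qed

lemma openin_if_contains_balls:
  assumes "U \<subseteq> A"
    and "\<And>x. x \<in> U \<Longrightarrow> \<exists>F e. finite F \<and> F \<subseteq> PP \<and> 0 < e \<and> {y \<in> A. \<forall>p\<in>F. p (y - x) < e} \<subseteq> U"
  shows "openin topo U"
proof (subst openin_subopen, intro ballI)
  fix x assume x: "x \<in> U"
  obtain F e where F: "finite F" "F \<subseteq> PP" "0 < e" "{y \<in> A. \<forall>p\<in>F. p (y - x) < e} \<subseteq> U"
    using assms(2)[OF x] by (elim exE conjE)
  have zero_F: "p 0 = 0" if "p \<in> F" for p using seminorm_zero[of p] that F(2) by auto
  have "x \<in> {y \<in> A. \<forall>p\<in>F. p (y - x) < e}"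
    using F(3) x assms(1) by (auto simp: zero_F)
  moreover have "openin topo {y \<in> A. \<forall>p\<in>F. p (y - x) < e}"
    by (rule openin_finite_ball[OF F(1,2) _ F(3)]) (use x assms(1) in auto)
  ultimately show "\<exists>W. openin topo W \<and> x \<in> W \<and> W \<subseteq> U" using F(4) by blast
qed

end

locale directed_seminorm_family = seminorm_family +
  assumes nonempty: "PP \<noteq> {}"
    and directed: "\<And>p q. p \<in> PP \<Longrightarrow> q \<in> PP \<Longrightarrow> \<exists>r\<in>PP. \<forall>x\<in>A. p x \<le> r x \<and> q x \<le> r x"
begin

lemma directed_finite:
  "finite F \<Longrightarrow> F \<subseteq> PP \<Longrightarrow> \<exists>r\<in>PP. \<forall>p\<in>F. \<forall>x\<in>A. p x \<le> r x"
proof (induction F rule: finite_induct)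
  case empty
  then show ?case using nonempty by auto
next
  case (insert p F)
  then obtain r where r: "r \<in> PP" "\<forall>p\<in>F. \<forall>x\<in>A. p x \<le> r x" by auto
  obtain s where s: "s \<in> PP" "\<forall>x\<in>A. p x \<le> s x \<and> r x \<le> s x" using directed[of p r] insert r by auto
  have "\<forall>q\<in>insert p F. \<forall>x\<in>A. q x \<le> s x" using r(2) s(2) by (metis insert_iff order_trans)
  then show ?case using s(1) by blast
qed

lemma ball_subset_open:
  assumes "openin topo U" "x \<in> U"
  shows "\<exists>p\<in>PP. \<exists>e>0. {y \<in> A. p (y - x) < e} \<subseteq> U"
proof -
  obtain F e where F: "finite F" "F \<subseteq> PP" "0 < e" "{y \<in> A. \<forall>p\<in>F. p (y - x) < e} \<subseteq> U"
    using finite_ball_subset_open[OF assms] by blast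
  obtain r where r: "r \<in> PP" "\<forall>p\<in>F. \<forall>x\<in>A. p x \<le> r x" using directed_finite[OF F(1,2)] by blast
  have "x \<in> A" using assms openin_subset topspace_seminorm_topology by blast
  then have "{y \<in> A. r (y - x) < e} \<subseteq> U" using F(4) r(2) carrier_closed(3) by fastforce
  then show ?thesis using r F by blast
qed

text \<open>
  Expand \<open>m x y - m x\<^sub>0 y\<^sub>0 = m (x - x\<^sub>0) (y - y\<^sub>0) + m (x - x\<^sub>0) y\<^sub>0 + m x\<^sub>0 (y - y\<^sub>0)\<close> and bound each term.
\<close>

lemma continuous_bilinear:
  assumes closed: "\<And>x y. x \<in> A \<Longrightarrow> y \<in> A \<Longrightarrow> m x y \<in> A"
    and bilinear: "bilinear_on smul A smul m"
    and bound: "\<And>p. p \<in> PP \<Longrightarrow> \<exists>q\<in>PP. \<forall>x\<in>A. \<forall>y\<in>A. p (m x y) \<le> q x * q y"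
  shows "continuous_map (prod_topology topo topo)
    topo (\<lambda>(x, y). m x y)"
proof -
  have ball: "openin (prod_topology topo topo) {a \<in> A \<times> A. p (m (fst a) (snd a) - c) < e}"
    if p: "p \<in> PP" and c: "c \<in> A" and e: "0 < e" for p c e
  proof (subst openin_subopen, intro ballI)
    fix a assume "a \<in> {a \<in> A \<times> A. p (m (fst a) (snd a) - c) < e}"
    then obtain x0 y0 where a: "a = (x0, y0)" "x0 \<in> A" "y0 \<in> A" "p (m x0 y0 - c) < e" by auto
    obtain q where q: "q \<in> PP" "\<forall>x\<in>A. \<forall>y\<in>A. p (m x y) \<le> q x * q y" using bound[OF p] by blast
    define r where "r = e - p (m x0 y0 - c)"
    define S where "S = 1 + q x0 + q y0"
    have q0: "0 \<le> q x" if "x \<in> A" for x using seminorm_onD(1)[OF seminorm[OF q(1)]] that .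
    have r: "r > 0" using a by (simp add: r_def)
    have S: "S \<ge> 1" using q0 a by (simp add: S_def)
    define d where "d = min 1 (r / (2 * S))"
    have d: "0 < d" "d \<le> 1" "d * S < r"
    proof -
      show "0 < d" "d \<le> 1" using r S by (auto simp: d_def)
      have "d * S \<le> r / (2 * S) * S" using S by (intro mult_right_mono) (auto simp: d_def)
      then show "d * S < r" using r S by simp
    qed
    let ?W = "{x \<in> A. q (x - x0) < d} \<times> {y \<in> A. q (y - y0) < d}"
    have "p (m x y - c) < e" if xy: "x \<in> A" "y \<in> A" "q (x - x0) < d" "q (y - y0) < d" for x y
    proof -
      have dx: "x - x0 \<in> A" and dy: "y - y0 \<in> A" using xy a carrier_closed by auto
      have bl: "m (u + u') w = m u w + m u' w" "m w (u + u') = m w u + m w u'"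
        if "u \<in> A" "u' \<in> A" "w \<in> A" for u u' w
        using bilinear that by (auto simp: bilinear_on_def)
      have "m x y - c = (m (x - x0) (y - y0) + (m (x - x0) y0 + m x0 (y - y0))) + (m x0 y0 - c)"
        using bl(1)[OF dx a(2) xy(2)] bl(2)[OF dy a(3) dx] bl(2)[OF dy a(3) a(2)] by simp
      also have "p \<dots> \<le> (p (m (x - x0) (y - y0)) + (p (m (x - x0) y0) + p (m x0 (y - y0)))) + p (m x0 y0 - c)"
        using dx dy a c closed carrier_closed
        by (intro order.trans[OF seminorm_onD(2)[OF seminorm[OF p]]] add_mono order_refl) auto
      also have "\<dots> \<le> (q (x - x0) * q (y - y0) + (q (x - x0) * q y0 + q x0 * q (y - y0))) + p (m x0 y0 - c)"
        using q(2) dx dy a by (intro add_mono) auto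
      also have "\<dots> \<le> (d * 1 + (d * q y0 + q x0 * d)) + p (m x0 y0 - c)"
        using xy q0 dx dy a d by (intro add_mono mult_mono) auto
      also have "\<dots> = d * S + p (m x0 y0 - c)" by (simp add: S_def algebra_simps)
      also have "\<dots> < e" using d(3) by (simp add: r_def)
      finally show ?thesis .
    qed
    then have "?W \<subseteq> {a \<in> A \<times> A. p (m (fst a) (snd a) - c) < e}" by auto
    moreover have "a \<in> ?W" using a d(1) seminorm_zero[OF q(1)] by simp
    moreover have "openin (prod_topology topo topo) ?W"
      using openin_ball[OF q(1) a(2) d(1)] openin_ball[OF q(1) a(3) d(1)]
      by (simp add: openin_prod_Times_iff)
    ultimately show "\<exists>W. openin (prod_topology topo topo) W \<and> a \<in> W \<and>
        W \<subseteq> {a \<in> A \<times> A. p (m (fst a) (snd a) - c) < e}" by blast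
  qed
  have top: "topspace (prod_topology topo topo) = A \<times> A"
    by (simp add: topspace_seminorm_topology)
  have "continuous_map (prod_topology topo topo) (topology_generated_by
      (insert A {{y \<in> A. p (y - x) < e} | p x e. p \<in> PP \<and> x \<in> A \<and> 0 < e})) (\<lambda>(x, y). m x y)"
  proof (rule continuous_on_generated_topo)
    fix U assume "U \<in> insert A {{y \<in> A. p (y - x) < e} | p x e. p \<in> PP \<and> x \<in> A \<and> 0 < e}"
    then consider "U = A" | p c e where "U = {y \<in> A. p (y - c) < e}" "p \<in> PP" "c \<in> A" "0 < e"
      by blast
    then show "openin (prod_topology topo topo) ((\<lambda>(x, y). m x y) -` U \<inter> topspace (prod_topology topo topo))"
    proof cases
      case 1
      have "(\<lambda>(x, y). m x y) -` U \<inter> (A \<times> A) = A \<times> A" using 1 closed by auto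
      then show ?thesis using openin_topspace[of "prod_topology topo topo"] by (simp only: top)
    next
      case 2
      have "(\<lambda>(x, y). m x y) -` U \<inter> (A \<times> A) = {a \<in> A \<times> A. p (m (fst a) (snd a) - c) < e}"
        using 2 closed by auto
      then show ?thesis using ball[OF 2(2-4)] by (simp only: top)
    qed
  next
    show "(\<lambda>(x, y). m x y) ` topspace (prod_topology topo topo)
        \<subseteq> \<Union> (insert A {{y \<in> A. p (y - x) < e} | p x e. p \<in> PP \<and> x \<in> A \<and> 0 < e})"
      using closed unfolding top by auto
  qed
  then show ?thesis by (simp add: seminorm_topology_def)
qed

lemma first_countable_if_countable_cofinal:
  assumes C: "countable C" "C \<subseteq> PP" "\<And>p. p \<in> PP \<Longrightarrow> \<exists>q\<in>C. \<forall>x\<in>A. p x \<le> q x"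
  shows "first_countable topo"
  unfolding first_countable_def topspace_seminorm_topology
proof (intro ballI)
  fix x assume x: "x \<in> A"
  define B where "B = (\<lambda>(q, n). {y \<in> A. q (y - x) < inverse (real (Suc n))}) ` (C \<times> UNIV)"
  have "countable B" unfolding B_def using C(1) by (intro countable_image countable_SIGMA) auto
  moreover have "\<forall>W\<in>B. openin topo W"
  proof
    fix W assume "W \<in> B"
    then obtain q n where "q \<in> C" "W = {y \<in> A. q (y - x) < inverse (real (Suc n))}"
      unfolding B_def by auto
    then show "openin topo W"
      using openin_ball[of q x "inverse (real (Suc n))"] x C(2) by (auto simp del: of_nat_Suc)
  qed
  moreover have "\<exists>W\<in>B. x \<in> W \<and> W \<subseteq> U" if U: "openin topo U" "x \<in> U" for U
  proof -
    obtain p e where p: "p \<in> PP" "0 < e" "{y \<in> A. p (y - x) < e} \<subseteq> U"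
      using ball_subset_open[OF U] by blast
    obtain q where q: "q \<in> C" "\<forall>x\<in>A. p x \<le> q x" using C(3)[OF p(1)] by blast
    obtain n where n: "inverse (real (Suc n)) < e" using reals_Archimedean[OF p(2)] by blast
    have "p (y - x) < e" if "y \<in> A" "q (y - x) < inverse (real (Suc n))" for y
    proof -
      have "p (y - x) \<le> q (y - x)" using q(2) carrier_closed(3)[OF that(1) x] by blast
      then show ?thesis using that n by linarith
    qed
    then have "{y \<in> A. q (y - x) < inverse (real (Suc n))} \<subseteq> U" using p(3) by auto
    moreover have "x \<in> {y \<in> A. q (y - x) < inverse (real (Suc n))}"
      using x seminorm_zero[of q] q(1) C(2) by (auto simp del: of_nat_Suc)
    moreover have "{y \<in> A. q (y - x) < inverse (real (Suc n))} \<in> B"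
      using q(1) unfolding B_def by (intro image_eqI[of _ _ "(q, n)"]) auto
    ultimately show ?thesis by (intro bexI conjI)
  qed
  ultimately show "\<exists>B. countable B \<and> (\<forall>V\<in>B. openin topo V) \<and>
      (\<forall>U. openin topo U \<and> x \<in> U \<longrightarrow> (\<exists>V\<in>B. x \<in> V \<and> V \<subseteq> U))"
    by (intro exI[of _ B] conjI allI impI) auto
qed

text \<open>
  Each neighbourhood in a countable base at \<open>0\<close> contains a ball of some seminorm in the family, and
  inclusion of balls at \<open>0\<close> bounds one seminorm by a multiple of the other.
\<close>

lemma countable_cofinal_if_first_countable:
  assumes "first_countable topo"
  shows "\<exists>C. countable C \<and> C \<subseteq> PP \<and> (\<forall>q\<in>PP. \<exists>p\<in>C. \<exists>N::nat. \<forall>x\<in>A. q x \<le> real N * p x)"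
proof -
  obtain B where B: "countable B" "\<And>V. V \<in> B \<Longrightarrow> openin topo V"
    "\<And>U. openin topo U \<and> 0 \<in> U \<Longrightarrow> \<exists>V\<in>B. 0 \<in> V \<and> V \<subseteq> U"
    using bspec[OF assms[unfolded first_countable_def topspace_seminorm_topology] carrier_closed(1)]
    by (elim exE conjE) (simp only: Ball_def)
  have "\<forall>V\<in>{V \<in> B. 0 \<in> V}. \<exists>pe. fst pe \<in> PP \<and> 0 < snd pe \<and> {y \<in> A. fst pe y < snd pe} \<subseteq> V"
  proof
    fix V assume "V \<in> {V \<in> B. 0 \<in> V}"
    then have "\<exists>p\<in>PP. \<exists>e>0. {y \<in> A. p (y - 0) < e} \<subseteq> V" by (intro ball_subset_open B(2)) auto
    then obtain p e where "p \<in> PP" "0 < e" "{y \<in> A. p (y - 0) < e} \<subseteq> V" by (elim bexE exE conjE)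
    then show "\<exists>pe. fst pe \<in> PP \<and> 0 < snd pe \<and> {y \<in> A. fst pe y < snd pe} \<subseteq> V"
      by (intro exI[of _ "(p, e)"]) simp
  qed
  from bchoice[OF this] obtain f
    where f: "\<forall>V\<in>{V \<in> B. 0 \<in> V}. fst (f V) \<in> PP \<and> 0 < snd (f V) \<and> {y \<in> A. fst (f V) y < snd (f V)} \<subseteq> V"
    by (elim exE)
  define P e where "P V = fst (f V)" and "e V = snd (f V)" for V
  have Pe: "P V \<in> PP" "0 < e V" "{y \<in> A. P V y < e V} \<subseteq> V" if "V \<in> B" "0 \<in> V" for V
    using f that by (auto simp: P_def e_def)
  have "\<exists>p\<in>P ` {V \<in> B. 0 \<in> V}. \<exists>N::nat. \<forall>x\<in>A. q x \<le> real N * p x" if q: "q \<in> PP" for q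
  proof -
    have "openin topo {y \<in> A. q (y - 0) < 1}" using openin_ball[OF q carrier_closed(1)] by simp
    then have "\<exists>V\<in>B. 0 \<in> V \<and> V \<subseteq> {y \<in> A. q (y - 0) < 1}"
      using seminorm_zero[OF q] carrier_closed(1) by (intro B(3)) simp
    then obtain V where V: "V \<in> B" "0 \<in> V" "V \<subseteq> {y \<in> A. q y < 1}" by auto
    obtain N :: nat where N: "1 / e V < real N" using reals_Archimedean2 by blast
    have "q x \<le> real N * P V x" if x: "x \<in> A" for x
    proof (rule field_le_epsilon)
      fix d :: real assume d: "0 < d"
      have P0: "0 \<le> P V x" using seminorm_onD(1)[OF seminorm[OF Pe(1)[OF V(1,2)]] x] .
      have eV: "0 < e V" by (rule Pe(2)[OF V(1,2)])
      define s where "s = real N * P V x + d"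
      have s: "s > 0" using P0 d by (simp add: s_def add_nonneg_pos)
      let ?y = "smul (of_real (1 / s)) x"
      have y: "?y \<in> A" using x subspace_carrier subspace_scale by blast
      have "1 * P V x \<le> (real N * e V) * P V x"
        using N eV P0 by (intro mult_right_mono) (auto simp: field_simps)
      also have "\<dots> < s * e V" using eV d by (simp add: s_def algebra_simps)
      finally have "P V x < s * e V" by simp
      then have "P V ?y < e V"
        unfolding seminorm_onD(3)[OF seminorm[OF Pe(1)[OF V(1,2)]] x] norm_of_real
        using s by (simp add: field_simps)
      then have "q ?y < 1" using Pe(3)[OF V(1,2)] V(3) y by blast
      then have "q x < s"
        unfolding seminorm_onD(3)[OF seminorm[OF q] x] norm_of_real
        using s by (simp add: field_simps)
      then show "q x \<le> real N * P V x + d" by (simp add: s_def)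
    qed
    then show ?thesis using V by blast
  qed
  moreover have "countable (P ` {V \<in> B. 0 \<in> V})" using B(1) by simp
  moreover have "P ` {V \<in> B. 0 \<in> V} \<subseteq> PP" using Pe(1) by auto
  ultimately show ?thesis by blast
qed

end

section \<open>Continuous seminorms of a locally convex space\<close>

locale lcs =
  fixes smul :: "'k::real_normed_field \<Rightarrow> 'v::ab_group_add \<Rightarrow> 'v" and T :: "'v topology"
  assumes lcs: "locally_convex_space smul UNIV T"
begin

sublocale vector_space smul using lcs by (simp add: locally_convex_space_def)

abbreviation "csn \<equiv> continuous_seminorm smul T"

lemma seminorm_continuous:
  "csn p \<Longrightarrow> seminorm_on smul UNIV p" by (simp add: continuous_seminorm_def)

text \<open>
  The seminorms that define the topology need not be directed; all continuous seminorms are, and they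
  define the same topology.
\<close>

lemma topology_of_continuous_seminorms:
  "T = seminorm_topology UNIV {p. csn p}"
proof -
  obtain P where P: "\<And>p. p \<in> P \<Longrightarrow> seminorm_on smul UNIV p" and T: "T = seminorm_topology UNIV P"
    using lcs unfolding locally_convex_space_def by auto
  interpret P: seminorm_family smul UNIV P by unfold_locales (auto simp: P)
  let ?C = "{p. csn p}"
  interpret C: seminorm_family smul UNIV ?C
    by unfold_locales (auto simp: seminorm_continuous)
  have top: "topspace T = UNIV" unfolding T by (rule P.topspace_seminorm_topology)
  have "continuous_map T euclideanreal p" if p: "p \<in> P" for p
    unfolding continuous_map_def top
  proof (intro conjI allI impI)
    fix U :: "real set" assume "openin euclideanreal U"
    then have U: "open U" by simp
    have "openin T {x. p x \<in> U}"
      unfolding T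
    proof (rule P.openin_if_contains_balls)
      fix x assume "x \<in> {x. p x \<in> U}"
      then obtain e where e: "e > 0" "\<And>y. dist y (p x) < e \<Longrightarrow> y \<in> U"
        using U by (auto simp: open_dist)
      have "dist (p y) (p x) < e" if "p (y - x) < e" for y
        using that seminorm_onD(2)[OF P[OF p], of "y - x" x] seminorm_onD(2)[OF P[OF p], of "x - y" y]
          P.seminorm_minus_commute[OF p, of x y]
        by (auto simp: dist_real_def)
      then have "{y \<in> UNIV. \<forall>q\<in>{p}. q (y - x) < e} \<subseteq> {x. p x \<in> U}" using e(2) by auto
      then show "\<exists>F e. finite F \<and> F \<subseteq> P \<and> 0 < e \<and> {y \<in> UNIV. \<forall>q\<in>F. q (y - x) < e} \<subseteq> {x. p x \<in> U}"
        using e(1) p by (intro exI[of _ "{p}"] exI[of _ e]) auto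
    qed simp
    then show "openin T {x \<in> UNIV. p x \<in> U}" by simp
  qed auto
  then have sub: "P \<subseteq> ?C" using P by (auto simp: continuous_seminorm_def)
  have ball: "openin T {y. q (y - x) < e}" if q: "csn q" and e: "0 < e" for q x e
    unfolding T
  proof (rule P.openin_if_contains_balls)
    fix y assume y: "y \<in> {y. q (y - x) < e}"
    have qC: "q \<in> ?C" using q by simp
    have "openin T {w \<in> topspace T. q w \<in> {..<e - q (y - x)}}"
      using q by (intro openin_continuous_map_preimage[of T euclideanreal]) (auto simp: continuous_seminorm_def)
    then have "openin (seminorm_topology UNIV P) {w. q w < e - q (y - x)}"
      unfolding top unfolding T by simp
    moreover have "0 \<in> {w. q w < e - q (y - x)}" using y C.seminorm_zero[OF qC] by simp
    ultimately have "\<exists>F d. finite F \<and> F \<subseteq> P \<and> 0 < d \<and>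
      {w \<in> UNIV. \<forall>p\<in>F. p (w - 0) < d} \<subseteq> {w. q w < e - q (y - x)}"
      by (rule P.finite_ball_subset_open)
    then obtain F d where F: "finite F" "F \<subseteq> P" "0 < d"
      "{w \<in> UNIV. \<forall>p\<in>F. p (w - 0) < d} \<subseteq> {w. q w < e - q (y - x)}"
      by (elim exE conjE)
    have "q (w - x) < e" if "\<forall>p\<in>F. p (w - y) < d" for w
    proof -
      have "q (w - y) < e - q (y - x)" using F(4) that by auto
      then show ?thesis using C.seminorm_triangle[OF qC, of w y x] by simp
    qed
    then show "\<exists>F d. finite F \<and> F \<subseteq> P \<and> 0 < d \<and> {w \<in> UNIV. \<forall>p\<in>F. p (w - y) < d} \<subseteq> {y. q (y - x) < e}"
      using F(1-3) by (intro exI[of _ F] exI[of _ d]) auto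
  qed simp
  show ?thesis
  proof (rule topology_eq[THEN iffD2], intro allI iffI)
    fix U assume U: "openin T U"
    show "openin (seminorm_topology UNIV ?C) U"
    proof (rule C.openin_if_contains_balls)
      fix x assume "x \<in> U"
      then show "\<exists>F e. finite F \<and> F \<subseteq> ?C \<and> 0 < e \<and> {y \<in> UNIV. \<forall>p\<in>F. p (y - x) < e} \<subseteq> U"
        using P.finite_ball_subset_open[of U x] U sub T by (meson order_trans)
    qed simp
  next
    fix U assume U: "openin (seminorm_topology UNIV ?C) U"
    show "openin T U"
    proof (subst openin_subopen, intro ballI)
      fix x assume x: "x \<in> U"
      obtain F e where F: "finite F" "F \<subseteq> ?C" "0 < e" "{y \<in> UNIV. \<forall>p\<in>F. p (y - x) < e} \<subseteq> U"
        using C.finite_ball_subset_open[OF U x] by blast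
      have zero_F: "p 0 = 0" if "p \<in> F" for p using C.seminorm_zero[of p] that F(2) by auto
      have "openin T (topspace T \<inter> (\<Inter>p\<in>F. {y. p (y - x) < e}))"
        using F(1-3) ball by (intro openin_Int_Inter) auto
      moreover have "x \<in> topspace T \<inter> (\<Inter>p\<in>F. {y. p (y - x) < e})"
        using F(3) by (auto simp: top zero_F)
      moreover have "topspace T \<inter> (\<Inter>p\<in>F. {y. p (y - x) < e}) \<subseteq> U" using F(4) by auto
      ultimately show "\<exists>W. openin T W \<and> x \<in> W \<and> W \<subseteq> U" by (intro exI conjI)
    qed
  qed
qed

lemma topspace_lcs: "topspace T = UNIV"
proof -
  interpret seminorm_family smul UNIV "{p. csn p}"
    by unfold_locales (auto simp: seminorm_continuous)
  show ?thesis using topspace_seminorm_topology topology_of_continuous_seminorms by simp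
qed

lemma continuous_seminorm_add:
  assumes "csn p" "csn q"
  shows "csn (\<lambda>x. p x + q x)"
  using assms unfolding continuous_seminorm_def seminorm_on_def
  by (auto intro!: continuous_map_add simp: algebra_simps add_mono)
    (metis add.assoc add.left_commute add_mono)

lemma continuous_seminorm_mult:
  assumes "csn p" "0 \<le> C"
  shows "csn (\<lambda>x. C * p x)"
  using assms unfolding continuous_seminorm_def seminorm_on_def
  by (auto intro!: continuous_map_real_mult simp: algebra_simps)
    (metis distrib_left mult_left_mono)

lemma continuous_seminorm_zero: "csn (\<lambda>_. 0)"
  by (simp add: continuous_seminorm_def seminorm_on_def)

sublocale directed_seminorm_family smul UNIV "{p. csn p}"
proof
  show "{p. csn p} \<noteq> {}" using continuous_seminorm_zero by blast
  show "\<exists>r\<in>{p. csn p}. \<forall>x\<in>UNIV. p x \<le> r x \<and> q x \<le> r x"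
    if "p \<in> {p. csn p}" "q \<in> {p. csn p}" for p q
    using that seminorm_onD(1)[OF seminorm_continuous]
    by (intro bexI[of _ "\<lambda>x. p x + q x"]) (auto intro: continuous_seminorm_add)
qed (auto simp: seminorm_continuous)

lemma first_countable_if_countable_bound:
  assumes "countable C" "\<And>p. p \<in> C \<Longrightarrow> csn p"
    and "\<And>q. csn q \<Longrightarrow> \<exists>p\<in>C. \<exists>N::nat. \<forall>x. q x \<le> real N * p x"
  shows "first_countable T"
proof (subst topology_of_continuous_seminorms, rule first_countable_if_countable_cofinal)
  let ?C = "(\<lambda>(p, N::nat) x. real N * p x) ` (C \<times> UNIV)"
  show "countable ?C" using assms(1) by (intro countable_image countable_SIGMA) auto
  show "?C \<subseteq> {p. csn p}" using assms(2) by (auto intro: continuous_seminorm_mult)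
  show "\<exists>q\<in>?C. \<forall>x\<in>UNIV. p x \<le> q x" if "p \<in> {p. csn p}" for p
    using assms(3)[of p] that by auto
qed

lemma countable_cofinal_seminorms:
  assumes "first_countable T"
  shows "\<exists>C. countable C \<and> (\<forall>p\<in>C. csn p) \<and>
    (\<forall>q. csn q \<longrightarrow> (\<exists>p\<in>C. \<forall>x. q x \<le> p x))"
proof -
  obtain C where C: "countable C" "C \<subseteq> {p. csn p}"
    "\<forall>q\<in>{p. csn p}. \<exists>p\<in>C. \<exists>N::nat. \<forall>x\<in>UNIV. q x \<le> real N * p x"
    using countable_cofinal_if_first_countable assms topology_of_continuous_seminorms by auto
  let ?C = "(\<lambda>(p, N::nat) x. real N * p x) ` (C \<times> UNIV)"
  have "countable ?C" using C(1) by (intro countable_image countable_SIGMA) auto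
  moreover have "\<forall>p\<in>?C. csn p" using C(2) by (auto intro: continuous_seminorm_mult)
  moreover have "\<exists>p\<in>?C. \<forall>x. q x \<le> p x" if q: "csn q" for q
  proof -
    obtain p and N :: nat where "p \<in> C" "\<forall>x. q x \<le> real N * p x" using C(3) q by auto
    then show ?thesis by (intro bexI[of _ "\<lambda>x. real N * p x"]) (auto intro!: image_eqI[of _ _ "(p, N)"])
  qed
  ultimately show ?thesis by blast
qed

text \<open>
  Continuity at the origin gives \<open>|\<Lambda>(v, w)| < 1\<close> on a ball of a seminorm, and homogeneity gives the rest.
\<close>

lemma bilinear_form_bound:
  fixes \<Lambda> :: "'v \<Rightarrow> 'v \<Rightarrow> 'k"
  assumes bilinear: "bilinear_on smul UNIV (*) \<Lambda>"
    and continuous: "continuous_map (prod_topology T T) euclidean (\<lambda>(v, w). \<Lambda> v w)"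
  shows "\<exists>q. csn q \<and> (\<forall>v w. norm (\<Lambda> v w) \<le> q v * q w)"
proof -
  have sc: "\<Lambda> (smul c x) y = c * \<Lambda> x y" "\<Lambda> x (smul c y) = c * \<Lambda> x y" for c x y
    using bilinear by (auto simp: bilinear_on_def)
  let ?S = "{a \<in> topspace (prod_topology T T). (\<lambda>(v, w). \<Lambda> v w) a \<in> ball 0 1}"
  have "openin (prod_topology T T) ?S"
    using continuous by (rule openin_continuous_map_preimage) auto
  moreover have "(0, 0) \<in> ?S" using sc(1)[of 0 0 0] by (simp add: topspace_lcs)
  ultimately have "\<exists>U W. openin T U \<and> openin T W \<and> 0 \<in> U \<and> 0 \<in> W \<and> U \<times> W \<subseteq> ?S"
    by (rule openin_prod_topology_alt[THEN iffD1, rule_format])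
  then obtain U W where UW: "openin T U" "openin T W" "0 \<in> U" "0 \<in> W" "U \<times> W \<subseteq> ?S"
    by (elim exE conjE)
  have nb: "\<exists>p\<in>{p. csn p}. \<exists>e>0. {y \<in> UNIV. p (y - 0) < e} \<subseteq> U"
    if "openin T U" "0 \<in> U" for U
    by (rule ball_subset_open) (use that topology_of_continuous_seminorms in auto)
  obtain p d where p: "csn p" "0 < d" "{y. p y < d} \<subseteq> U"
    using nb[OF UW(1,3)] by auto
  obtain q e where q: "csn q" "0 < e" "{y. q y < e} \<subseteq> W"
    using nb[OF UW(2,4)] by auto
  define r where "r x = 1 / d * p x + 1 / e * q x" for x
  have r: "csn r"
    unfolding r_def using p q by (intro continuous_seminorm_add continuous_seminorm_mult) auto
  have pos: "0 \<le> p x" "0 \<le> q x" "0 \<le> r x" for x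
    using seminorm_onD(1)[OF seminorm_continuous] p(1) q(1) r by auto
  have lt1: "norm (\<Lambda> v w) < 1" if "r v < 1" "r w < 1" for v w
  proof -
    have "0 \<le> 1 / e * q v" "0 \<le> 1 / d * p w"
      by (intro mult_nonneg_nonneg divide_nonneg_pos pos p(2) q(2) zero_le_one)+
    then have "1 / d * p v < 1" "1 / e * q w < 1" using that unfolding r_def by linarith+
    then have "v \<in> U" "w \<in> W" using p q by (auto simp: field_simps)
    then show ?thesis using UW(5) by (auto simp: subset_iff)
  qed
  have st: "norm (\<Lambda> v w) < s * t" if "r v < s" "r w < t" for v w s t
  proof -
    have pos': "0 < s" "0 < t" using that pos(3)[of v] pos(3)[of w] by linarith+
    have "r (smul (of_real (1 / s)) v) < 1" "r (smul (of_real (1 / t)) w) < 1"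
      using seminorm_onD(3)[OF seminorm_continuous[OF r]] that pos'
      by (auto simp: field_simps norm_divide)
    from lt1[OF this] have "norm (of_real (1 / t) * (of_real (1 / s) * \<Lambda> v w)) < 1"
      by (simp only: sc)
    then show ?thesis using pos' by (simp add: norm_mult norm_divide field_simps)
  qed
  have "norm (\<Lambda> v w) \<le> r v * r w" for v w
  proof -
    (* r v or r w may be 0, so the scaled bound is used with r v + e and r w + e for small e *)
    have "((\<lambda>e. (r v + e) * (r w + e)) \<longlongrightarrow> (r v + 0) * (r w + 0)) (at_right 0)"
      by (intro tendsto_intros)
    moreover have "\<forall>\<^sub>F e in at_right 0. norm (\<Lambda> v w) \<le> (r v + e) * (r w + e)"
      using st[of v _ w] by (intro eventually_at_right_less[of 0, THEN eventually_mono]) (simp add: less_imp_le)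
    ultimately show ?thesis
      by (intro tendsto_lowerbound[of _ _ "at_right (0::real)"]) auto
  qed
  then show ?thesis using r by blast
qed

end

section \<open>Projective seminorms\<close>

abbreviation "pnorm \<equiv> projective_seminorm"

definition rep_costs ::
    "('k::real_normed_field \<Rightarrow> 'v::ab_group_add \<Rightarrow> 'v) \<Rightarrow> nat \<Rightarrow> ('v \<Rightarrow> real) \<Rightarrow> ('v, 'k) tensor \<Rightarrow> real set"
  where "rep_costs smul n p t =
    {(\<Sum>i<N. norm (c i) * (\<Prod>x\<leftarrow>v i. p x)) | N (c :: nat \<Rightarrow> 'k) (v :: nat \<Rightarrow> 'v list).
      (\<forall>i<N. length (v i) = n) \<and> t = (\<Sum>i<N. tensor_scale (c i) (pure_tensor smul (v i)))}"

abbreviation "rep_cost p (N :: nat) c v \<equiv> \<Sum>i<N. norm (c i) * (\<Prod>x\<leftarrow>v i. p x)"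
abbreviation "rep_tensor smul (N :: nat) c v \<equiv> \<Sum>i<N. tensor_scale (c i) (pure_tensor smul (v i))"

lemma projective_seminorm_Inf: "pnorm smul n p t = Inf (rep_costs smul n p t)"
  by (simp add: projective_seminorm_def rep_costs_def)

lemma rep_costsE:
  fixes smul :: "'k::real_normed_field \<Rightarrow> 'v::ab_group_add \<Rightarrow> 'v"
  assumes "A \<in> rep_costs smul n p t"
  obtains N :: nat and c :: "nat \<Rightarrow> 'k" and v :: "nat \<Rightarrow> 'v list"
  where "A = rep_cost p N c v" "\<forall>i<N. length (v i) = n" "t = rep_tensor smul N c v"
  using assms unfolding rep_costs_def mem_Collect_eq
proof (elim exE conjE)
  fix N :: nat and c :: "nat \<Rightarrow> 'k" and v :: "nat \<Rightarrow> 'v list"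
  assume "A = rep_cost p N c v" "\<forall>i<N. length (v i) = n" "t = rep_tensor smul N c v"
  then show ?thesis by (rule that)
qed

lemma rep_costsI:
  fixes N :: nat
  assumes "\<forall>i<N. length (v i) = n"
  shows "rep_cost p N c v \<in> rep_costs smul n p (rep_tensor smul N c v)"
  unfolding rep_costs_def mem_Collect_eq using assms
  by (intro exI[of _ N] exI[of _ c] exI[of _ v] conjI refl)

lemma sum_lessThan_add:
  fixes f :: "nat \<Rightarrow> 'a::comm_monoid_add"
  shows "(\<Sum>i<N + M. f i) = (\<Sum>i<N. f i) + (\<Sum>i<M. f (N + i))"
  by (induction M) (simp_all add: add.assoc)

lemma rep_costs_add:
  assumes "A \<in> rep_costs smul n p t" "B \<in> rep_costs smul n p u"
  shows "A + B \<in> rep_costs smul n p (t + u)"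
proof -
  obtain N c v where 1: "A = rep_cost p N c v" "\<forall>i<N. length (v i) = n" "t = rep_tensor smul N c v"
    using assms(1) by (rule rep_costsE)
  obtain M d w where 2: "B = rep_cost p M d w" "\<forall>i<M. length (w i) = n"
      "u = rep_tensor smul M d w"
    using assms(2) by (rule rep_costsE)
  let ?c = "\<lambda>i. if i < N then c i else d (i - N)" and ?v = "\<lambda>i. if i < N then v i else w (i - N)"
  have "A + B = (\<Sum>i<N + M. norm (?c i) * (\<Prod>x\<leftarrow>?v i. p x))"
    unfolding sum_lessThan_add 1 2 by simp
  moreover have "t + u = (\<Sum>i<N + M. tensor_scale (?c i) (pure_tensor smul (?v i)))"
    unfolding sum_lessThan_add 1 2 by simp
  moreover have "\<forall>i<N + M. length (?v i) = n" using 1 2 by auto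
  ultimately show ?thesis unfolding rep_costs_def mem_Collect_eq
    by (intro exI[of _ "N + M"] exI[of _ ?c] exI[of _ ?v] conjI)
qed

lemma rep_costs_scale:
  assumes "A \<in> rep_costs smul n p t"
  shows "norm r * A \<in> rep_costs smul n p (tensor_scale r t)"
proof -
  obtain N c v where 1: "A = rep_cost p N c v" "\<forall>i<N. length (v i) = n" "t = rep_tensor smul N c v"
    using assms(1) by (rule rep_costsE)
  have "norm r * A = (\<Sum>i<N. norm (r * c i) * (\<Prod>x\<leftarrow>v i. p x))"
    unfolding 1 by (simp add: sum_distrib_left norm_mult mult.assoc)
  moreover have "tensor_scale r t = (\<Sum>i<N. tensor_scale (r * c i) (pure_tensor smul (v i)))"
    unfolding 1 tensor.scale_sum_right tensor.scale_scale by (rule refl)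
  ultimately show ?thesis using 1(2) unfolding rep_costs_def mem_Collect_eq
    by (intro exI[of _ N] exI[of _ "\<lambda>i. r * c i"] exI[of _ v] conjI)
qed

lemma rep_costs_pure: "length v = n \<Longrightarrow> (\<Prod>x\<leftarrow>v. p x) \<in> rep_costs smul n p (pure_tensor smul v)"
  unfolding rep_costs_def mem_Collect_eq
  by (intro exI[of _ 1] exI[of _ "\<lambda>_. 1"] exI[of _ "\<lambda>_. v"]) simp

lemma rep_costs_zero: "0 \<in> rep_costs smul n p 0"
  unfolding rep_costs_def mem_Collect_eq by (intro exI[of _ 0]) simp

lemma rep_costs_nonempty:
  assumes "t \<in> tensor_power smul n"
  shows "rep_costs smul n p t \<noteq> {}"
  using assms unfolding tensor_power_def
proof (induction rule: tensor.span_induct_alt)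
  case base
  then show ?case using rep_costs_zero by blast
next
  case (step c x y)
  then obtain v where v: "length v = n" "x = pure_tensor smul v" by auto
  obtain A where "A \<in> rep_costs smul n p y" using step by blast
  from rep_costs_add[OF rep_costs_scale[OF rep_costs_pure[OF v(1)]] this]
  show ?case unfolding v by blast
qed

lemma prod_list_map_nonneg:
  fixes p :: "'v \<Rightarrow> real"
  shows "(\<And>x. 0 \<le> p x) \<Longrightarrow> 0 \<le> (\<Prod>x\<leftarrow>v. p x)"
  by (induction v) auto

lemma rep_costs_nonneg:
  fixes smul :: "'a::real_normed_field \<Rightarrow> 'b::ab_group_add \<Rightarrow> 'b"
  assumes "\<And>x. 0 \<le> p x" "A \<in> rep_costs smul n p t"
  shows "0 \<le> A"
proof -
  obtain N :: nat and c :: "nat \<Rightarrow> 'a" and v where "A = rep_cost p N c v"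
    by (rule rep_costsE[OF assms(2)])
  then show ?thesis using prod_list_map_nonneg[OF assms(1)]
    by (auto intro!: sum_nonneg mult_nonneg_nonneg)
qed

lemma projective_seminorm_le:
  assumes "\<And>x. 0 \<le> p x" "A \<in> rep_costs smul n p t"
  shows "pnorm smul n p t \<le> A"
  unfolding projective_seminorm_Inf
  using assms(2) by (intro cInf_lower bdd_belowI[of _ 0]) (auto intro: rep_costs_nonneg[OF assms(1)])

lemma projective_seminorm_greatest:
  assumes "t \<in> tensor_power smul n" "\<And>A. A \<in> rep_costs smul n p t \<Longrightarrow> x \<le> A"
  shows "x \<le> pnorm smul n p t"
  unfolding projective_seminorm_Inf
  using assms(2) by (intro cInf_greatest rep_costs_nonempty[OF assms(1)])

lemma projective_seminorm_nonneg:
  assumes "\<And>x. 0 \<le> p x" "t \<in> tensor_power smul n"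
  shows "0 \<le> pnorm smul n p t"
  by (rule projective_seminorm_greatest[OF assms(2)]) (rule rep_costs_nonneg[of p, OF assms(1)])

lemma projective_seminorm_pure:
  assumes "\<And>x. 0 \<le> p x" "length v = n"
  shows "pnorm smul n p (pure_tensor smul v) \<le> (\<Prod>x\<leftarrow>v. p x)"
  by (rule projective_seminorm_le[of p, OF assms(1) rep_costs_pure[OF assms(2)]])

text \<open>
  The defining property of the projective seminorm: a linear map that is bounded on pure tensors has
  the same bound on all tensors.  It reduces the estimates below to pure tensors.
\<close>

lemma bounded_by_projective_seminorm:
  assumes L: "linmap tensor_scale s L"
    and \<nu>: "seminorm_on s A \<nu>" and A: "module.subspace s A" and K: "0 \<le> K"
    and pure: "\<And>v. length v = n \<Longrightarrow> L (pure_tensor smul v) \<in> A \<and> \<nu> (L (pure_tensor smul v)) \<le> K * (\<Prod>x\<leftarrow>v. p x)"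
    and t: "t \<in> tensor_power smul n"
  shows "\<nu> (L t) \<le> K * pnorm smul n p t"
proof -
  interpret L: Vector_Spaces.linear tensor_scale s L by fact
  have bound: "\<nu> (L t) \<le> K * C" if C: "C \<in> rep_costs smul n p t" for C
  proof -
    obtain N c v where 1: "C = rep_cost p N c v" "\<forall>i<N. length (v i) = n" "t = rep_tensor smul N c v"
      using C by (rule rep_costsE)
    let ?x = "\<lambda>i. s (c i) (L (pure_tensor smul (v i)))"
    have x: "?x i \<in> A" "\<nu> (?x i) \<le> K * (norm (c i) * (\<Prod>x\<leftarrow>v i. p x))" if "i < N" for i
    proof -
      have pi: "L (pure_tensor smul (v i)) \<in> A" "\<nu> (L (pure_tensor smul (v i))) \<le> K * (\<Prod>x\<leftarrow>v i. p x)"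
        using pure[OF 1(2)[rule_format, OF that]] by auto
      show "?x i \<in> A" using pi(1) A by (rule L.vs2.subspace_scale[rotated])
      have "\<nu> (?x i) = norm (c i) * \<nu> (L (pure_tensor smul (v i)))" by (rule seminorm_onD(3)[OF \<nu> pi(1)])
      also have "\<dots> \<le> norm (c i) * (K * (\<Prod>x\<leftarrow>v i. p x))" by (rule mult_left_mono[OF pi(2)]) simp
      finally show "\<nu> (?x i) \<le> K * (norm (c i) * (\<Prod>x\<leftarrow>v i. p x))" by (simp add: mult.left_commute)
    qed
    have "(\<Sum>i<M. ?x i) \<in> A \<and> \<nu> (\<Sum>i<M. ?x i) \<le> (\<Sum>i<M. K * (norm (c i) * (\<Prod>x\<leftarrow>v i. p x)))" if "M \<le> N" for M
      using that
    proof (induction M)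
      case 0
      have "\<nu> 0 = 0" using seminorm_onD(3)[OF \<nu> L.vs2.subspace_0[OF A], of 0] by simp
      then show ?case using L.vs2.subspace_0[OF A] by simp
    next
      case (Suc M)
      then have IH: "(\<Sum>i<M. ?x i) \<in> A" "\<nu> (\<Sum>i<M. ?x i) \<le> (\<Sum>i<M. K * (norm (c i) * (\<Prod>x\<leftarrow>v i. p x)))"
        and M: "M < N" by auto
      show ?case
        using L.vs2.subspace_add[OF A IH(1) x(1)[OF M]] seminorm_onD(2)[OF \<nu> IH(1) x(1)[OF M]] IH(2) x(2)[OF M]
        by simp
    qed
    then show ?thesis unfolding 1(1,3) L.sum L.scale sum_distrib_left by blast
  qed
  show ?thesis
  proof (cases "K = 0")
    case True
    then show ?thesis using bound rep_costs_nonempty[OF t] by fastforce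
  next
    case False
    then have "\<nu> (L t) / K \<le> pnorm smul n p t"
      using bound K by (intro projective_seminorm_greatest[OF t]) (simp add: field_simps)
    then show ?thesis using False K by (simp add: field_simps)
  qed
qed

lemma seminorm_projective:
  assumes "\<And>x. 0 \<le> p x"
  shows "seminorm_on tensor_scale (tensor_power smul n) (pnorm smul n p)"
  unfolding seminorm_on_def
proof (intro conjI ballI allI)
  fix t assume t: "t \<in> tensor_power smul n"
  show "0 \<le> pnorm smul n p t" by (rule projective_seminorm_nonneg[OF assms t])
next
  fix t u assume t: "t \<in> tensor_power smul n" and u: "u \<in> tensor_power smul n"
  have "pnorm smul n p (t + u) - B \<le> A"
    if "A \<in> rep_costs smul n p t" "B \<in> rep_costs smul n p u" for A B
    using projective_seminorm_le[OF assms rep_costs_add[OF that]] by simp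
  then have le: "pnorm smul n p (t + u) - pnorm smul n p t \<le> B"
    if "B \<in> rep_costs smul n p u" for B
    using projective_seminorm_greatest[OF t, of p "pnorm smul n p (t + u) - B"] that by force
  show "pnorm smul n p (t + u) \<le> pnorm smul n p t + pnorm smul n p u"
    using projective_seminorm_greatest[OF u, of p, OF le] by simp
next
  fix c t assume t: "t \<in> tensor_power smul n"
  have le: "pnorm smul n p (tensor_scale c t) \<le> norm c * pnorm smul n p t"
    if t: "t \<in> tensor_power smul n" for c t
  proof (cases "c = 0")
    case True
    then show ?thesis using projective_seminorm_le[OF assms rep_costs_zero] by simp
  next
    case False
    then have "pnorm smul n p (tensor_scale c t) / norm c \<le> pnorm smul n p t"
      using projective_seminorm_le[OF assms rep_costs_scale]
      by (intro projective_seminorm_greatest[OF t]) (simp add: field_simps)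
    then show ?thesis using False by (simp add: field_simps)
  qed
  show "pnorm smul n p (tensor_scale c t) = norm c * pnorm smul n p t"
  proof (cases "c = 0")
    case True
    have "tensor_scale c t \<in> tensor_power smul n"
      using t unfolding tensor_power_def by (rule tensor.span_scale)
    from projective_seminorm_nonneg[of p, OF assms this] show ?thesis using le[OF t, of c] True by simp
  next
    case False
    have "tensor_scale c t \<in> tensor_power smul n"
      using t unfolding tensor_power_def by (rule tensor.span_scale)
    from le[OF this, of "inverse c"]
    have "pnorm smul n p t \<le> inverse (norm c) * pnorm smul n p (tensor_scale c t)"
      using False by (simp add: norm_inverse)
    then show ?thesis using le[OF t, of c] False by (simp add: field_simps)
  qed
qed

lemma projective_seminorm_mono:
  assumes "\<And>x. 0 \<le> p x" "\<And>x. p x \<le> q x" "t \<in> tensor_power smul n"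
  shows "pnorm smul n p t \<le> pnorm smul n q t"
proof (rule projective_seminorm_greatest[OF assms(3)])
  fix A assume "A \<in> rep_costs smul n q t"
  then obtain N c v where 1: "A = rep_cost q N c v" "\<forall>i<N. length (v i) = n" "t = rep_tensor smul N c v"
    by (rule rep_costsE)
  have "(\<Prod>x\<leftarrow>u. p x) \<le> (\<Prod>x\<leftarrow>u. q x)" for u
  proof (induction u)
    case (Cons y u)
    then show ?case
      using assms(1,2) prod_list_map_nonneg[of p u] order_trans[OF assms(1) assms(2)]
      by (auto intro!: mult_mono)
  qed simp
  then have "rep_cost p N c v \<le> A"
    unfolding 1 by (intro sum_mono mult_left_mono) auto
  moreover have "rep_cost p N c v \<in> rep_costs smul n p t"
    unfolding 1(3) by (rule rep_costsI[OF 1(2)])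
  ultimately show "pnorm smul n p t \<le> A"
    using projective_seminorm_le[of p, OF assms(1)] order_trans by blast
qed

lemma projective_seminorm_mult:
  assumes "\<And>x. 0 \<le> p x" "0 \<le> C" "t \<in> tensor_power smul n"
  shows "C ^ n * pnorm smul n p t \<le> pnorm smul n (\<lambda>x. C * p x) t"
proof (rule projective_seminorm_greatest[OF assms(3)])
  fix A assume "A \<in> rep_costs smul n (\<lambda>x. C * p x) t"
  then obtain N c v where 1: "A = (\<Sum>i<N. norm (c i) * (\<Prod>x\<leftarrow>v i. C * p x))" "\<forall>i<N. length (v i) = n" "t = rep_tensor smul N c v"
    by (rule rep_costsE)
  have prod: "(\<Prod>x\<leftarrow>u. C * p x) = C ^ length u * (\<Prod>x\<leftarrow>u. p x)" for u
    by (induction u) auto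
  have "C ^ n * rep_cost p N c v = A"
    unfolding 1(1) sum_distrib_left using 1(2) by (intro sum.cong) (auto simp: prod)
  moreover have "pnorm smul n p t \<le> rep_cost p N c v"
    unfolding 1(3) by (rule projective_seminorm_le[of p, OF assms(1) rep_costsI[OF 1(2)]])
  from mult_left_mono[OF this, of "C ^ n"]
  have "C ^ n * pnorm smul n p t \<le> C ^ n * rep_cost p N c v"
    using assms(2) by simp
  ultimately show "C ^ n * pnorm smul n p t \<le> A" by simp
qed

text \<open>
  Evaluating a representation of \<open>v\<close> in \<open>V\<close> itself shows that none is cheaper than \<open>p v\<close>.
\<close>

lemma projective_seminorm_degree_one:
  assumes "vector_space smul" and p: "seminorm_on smul UNIV p"
  shows "pnorm smul 1 p (pure_tensor smul [v]) = p v"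
proof (rule antisym)
  interpret vector_space smul by fact
  have p0: "0 \<le> p x" for x using seminorm_onD(1)[OF p] by simp
  show "pnorm smul 1 p (pure_tensor smul [v]) \<le> p v"
    using projective_seminorm_pure[of p "[v]" 1 smul] p0 by simp
  have "multilinear smul smul 1 hd"
    using linear_id[unfolded id_def] by (auto simp: multilinear_def)
  from tensor_power_universal[OF vector_space_axioms this]
  obtain L where L: "linmap tensor_scale smul L" "\<And>v. length v = 1 \<Longrightarrow> L (pure_tensor smul v) = hd v"
    by blast
  have "p (L (pure_tensor smul [v])) \<le> 1 * pnorm smul 1 p (pure_tensor smul [v])"
  proof (rule bounded_by_projective_seminorm[OF L(1) p subspace_UNIV])
    show "pure_tensor smul [v] \<in> tensor_power smul 1"
      unfolding tensor_power_def by (intro tensor.span_base) auto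
    show "L (pure_tensor smul u) \<in> UNIV \<and> p (L (pure_tensor smul u)) \<le> 1 * (\<Prod>x\<leftarrow>u. p x)"
      if "length u = 1" for u
      using that L(2)[OF that] by (cases u) auto
  qed simp
  then show "p v \<le> pnorm smul 1 p (pure_tensor smul [v])" using L(2)[of "[v]"] by simp
qed

section \<open>The seminorms of the Weyl algebra\<close>

text \<open>
  The seminorm estimates hold here; the symmetric algebra is the subspace to which they are applied.
\<close>

definition tensor_algebra :: "('k::field \<Rightarrow> 'v::ab_group_add \<Rightarrow> 'v) \<Rightarrow> ('v, 'k) tensor_alg set"
  where "tensor_algebra smul = {a. finite {n. a n \<noteq> 0} \<and> (\<forall>n. a n \<in> tensor_power smul n)}"

lemma finite_support_add:
  fixes a b :: "nat \<Rightarrow> 'a::monoid_add"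
  assumes "finite {n. a n \<noteq> 0}" "finite {n. b n \<noteq> 0}"
  shows "finite {n. (a + b) n \<noteq> 0}"
  by (rule finite_subset[of _ "{n. a n \<noteq> 0} \<union> {n. b n \<noteq> 0}"]) (use assms in auto)

lemma subspace_graded_sum:
  assumes "\<And>n. tensor.subspace (U n)"
  shows "alg.subspace {a. finite {n. a n \<noteq> 0} \<and> (\<forall>n. a n \<in> U n)}"
proof (rule alg.subspaceI)
  show "0 \<in> {a. finite {n. a n \<noteq> 0} \<and> (\<forall>n. a n \<in> U n)}"
    using assms tensor.subspace_0 by auto
  show "x + y \<in> {a. finite {n. a n \<noteq> 0} \<and> (\<forall>n. a n \<in> U n)}"
    if "x \<in> {a. finite {n. a n \<noteq> 0} \<and> (\<forall>n. a n \<in> U n)}" "y \<in> {a. finite {n. a n \<noteq> 0} \<and> (\<forall>n. a n \<in> U n)}" for x y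
    using that assms tensor.subspace_add[OF assms] finite_support_add[of x y] by simp
  show "alg_scale c x \<in> {a. finite {n. a n \<noteq> 0} \<and> (\<forall>n. a n \<in> U n)}"
    if "x \<in> {a. finite {n. a n \<noteq> 0} \<and> (\<forall>n. a n \<in> U n)}" for c x
  proof -
    have "{n. alg_scale c x n \<noteq> 0} \<subseteq> {n. x n \<noteq> 0}" by (auto simp: alg_scale_def)
    then show ?thesis using that tensor.subspace_scale[OF assms]
      by (auto simp: alg_scale_def intro: finite_subset)
  qed
qed

lemma subspace_tensor_algebra: "alg.subspace (tensor_algebra smul)"
  unfolding tensor_algebra_def
  by (rule subspace_graded_sum) (simp add: tensor_power_def tensor.subspace_span)

context graded_vector_space
begin

lemma sym_algebra_subset: "S \<subseteq> tensor_algebra smul"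
  unfolding sym_algebra_def tensor_algebra_def using sym_power_subset by auto

lemma subspace_sym_algebra: "alg.subspace S"
  unfolding sym_algebra_def by (rule subspace_graded_sum[OF subspace_sym_power])

end

lemma projective_seminorm_zero:
  assumes "\<And>x. 0 \<le> p x"
  shows "pnorm smul n p 0 = 0"
proof (rule antisym)
  show "pnorm smul n p 0 \<le> 0" by (rule projective_seminorm_le[OF assms rep_costs_zero])
  show "0 \<le> pnorm smul n p 0"
    by (rule projective_seminorm_nonneg[OF assms]) (simp add: tensor_power_def tensor.span_zero)
qed

abbreviation "wnorm \<equiv> weyl_seminorm"

lemma weyl_seminorm_sum:
  assumes "\<And>x. 0 \<le> p x" "finite I" "\<And>n. n \<notin> I \<Longrightarrow> a n = 0"
  shows "wnorm smul p R a = (\<Sum>n\<in>I. pnorm smul n p (a n) * fact n powr R)"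
  unfolding weyl_seminorm_def
proof (rule Sum_any.expand_superset[OF assms(2)])
  show "{n. pnorm smul n p (a n) * fact n powr R \<noteq> 0} \<subseteq> I"
  proof
    fix n assume "n \<in> {n. pnorm smul n p (a n) * fact n powr R \<noteq> 0}"
    then show "n \<in> I"
      using assms(3)[of n] projective_seminorm_zero[of p smul n, OF assms(1)] by (cases "n \<in> I") auto
  qed
qed

lemma seminorm_weyl:
  assumes p: "\<And>x. 0 \<le> p x"
  shows "seminorm_on alg_scale (tensor_algebra smul) (wnorm smul p R)"
  unfolding seminorm_on_def
proof (intro conjI ballI allI)
  fix a assume a: "a \<in> tensor_algebra smul"
  show "0 \<le> wnorm smul p R a"
  proof -
    have I: "finite {n. a n \<noteq> 0}" and an: "\<And>n. a n \<in> tensor_power smul n"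
      using a by (auto simp: tensor_algebra_def)
    have "wnorm smul p R a = (\<Sum>n | a n \<noteq> 0. pnorm smul n p (a n) * fact n powr R)"
      by (rule weyl_seminorm_sum[of p, OF p I]) simp
    also have "\<dots> \<ge> 0"
      by (intro sum_nonneg mult_nonneg_nonneg projective_seminorm_nonneg[of p, OF p] an) simp
    finally show ?thesis .
  qed
next
  fix a b assume a: "a \<in> tensor_algebra smul" and b: "b \<in> tensor_algebra smul"
  let ?I = "{n. a n \<noteq> 0} \<union> {n. b n \<noteq> 0}"
  have I: "finite ?I" using a b by (simp add: tensor_algebra_def)
  have "wnorm smul p R (a + b) = (\<Sum>n\<in>?I. pnorm smul n p (a n + b n) * fact n powr R)"
    using weyl_seminorm_sum[of p ?I "a + b" smul R, OF p I] by simp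
  also have "\<dots> \<le> (\<Sum>n\<in>?I. (pnorm smul n p (a n) + pnorm smul n p (b n)) * fact n powr R)"
    using a b seminorm_onD(2)[OF seminorm_projective[of p smul, OF p]]
    by (intro sum_mono mult_right_mono) (auto simp: tensor_algebra_def)
  also have "\<dots> = wnorm smul p R a + wnorm smul p R b"
    using weyl_seminorm_sum[of p ?I a smul R, OF p I] weyl_seminorm_sum[of p ?I b smul R, OF p I]
    by (simp add: distrib_right sum.distrib)
  finally show "wnorm smul p R (a + b) \<le> wnorm smul p R a + wnorm smul p R b" .
next
  fix c a assume a: "a \<in> tensor_algebra smul"
  let ?I = "{n. a n \<noteq> 0}"
  have I: "finite ?I" and an: "\<And>n. a n \<in> tensor_power smul n" using a by (auto simp: tensor_algebra_def)
  have sc: "alg_scale c a n = tensor_scale c (a n)" for n by (simp add: alg_scale_def)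
  have "wnorm smul p R (alg_scale c a) =
      (\<Sum>n\<in>?I. pnorm smul n p (tensor_scale c (a n)) * fact n powr R)"
    using weyl_seminorm_sum[of p ?I "alg_scale c a" smul R, OF p I] by (simp add: sc)
  also have "\<dots> = norm c * wnorm smul p R a"
    using weyl_seminorm_sum[of p ?I a smul R, OF p I] seminorm_onD(3)[OF seminorm_projective[of p smul, OF p] an]
    by (simp add: sum_distrib_left mult.assoc)
  finally show "wnorm smul p R (alg_scale c a) = norm c * wnorm smul p R a" .
qed

lemma weyl_seminorm_mono:
  assumes "\<And>x. 0 \<le> p x" "\<And>x. p x \<le> q x" "R \<le> R'" and a: "a \<in> tensor_algebra smul"
  shows "wnorm smul p R a \<le> wnorm smul q R' a"
proof -
  have q: "0 \<le> q x" for x using assms(1,2) order_trans by blast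
  have I: "finite {n. a n \<noteq> 0}" and an: "\<And>n. a n \<in> tensor_power smul n" using a by (auto simp: tensor_algebra_def)
  have "pnorm smul n p (a n) * fact n powr R \<le> pnorm smul n q (a n) * fact n powr R'" for n
    by (intro mult_mono projective_seminorm_mono[of p q, OF assms(1,2) an]
        projective_seminorm_nonneg[of q, OF q an] powr_mono assms(3)) auto
  then show ?thesis
    using weyl_seminorm_sum[of p "{n. a n \<noteq> 0}" a smul R, OF assms(1) I]
      weyl_seminorm_sum[of q "{n. a n \<noteq> 0}" a smul R', OF q I]
    by (simp add: sum_mono)
qed

lemma weyl_seminorm_in_degree:
  assumes "\<And>x. 0 \<le> p x"
  shows "wnorm smul p R (in_degree n t) = pnorm smul n p t * fact n powr R"
  using weyl_seminorm_sum[of p "{n}" "in_degree n t" smul R, OF assms] by (simp add: in_degree_def)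

text \<open>Factors growing geometrically with the degree are absorbed by rescaling \<open>p\<close>.\<close>

lemma weyl_seminorm_mult:
  assumes p: "\<And>x. 0 \<le> p x" and C: "0 \<le> C" and a: "\<And>n. a n \<in> tensor_power smul n"
    and I: "finite I" "\<And>n. n \<notin> I \<Longrightarrow> a n = 0"
  shows "(\<Sum>n\<in>I. C ^ n * pnorm smul n p (a n) * fact n powr R) \<le>
    wnorm smul (\<lambda>x. C * p x) R a"
proof -
  have Cp: "0 \<le> C * p x" for x using p C by simp
  have "wnorm smul (\<lambda>x. C * p x) R a =
      (\<Sum>n\<in>I. pnorm smul n (\<lambda>x. C * p x) (a n) * fact n powr R)"
    by (rule weyl_seminorm_sum[of "\<lambda>x. C * p x", OF Cp I(1)]) (rule I(2))
  then show ?thesis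
    using projective_seminorm_mult[of p, OF p C a] by (simp add: sum_mono mult_right_mono)
qed

section \<open>Estimates for the star product\<close>

text \<open>
  The inequality behind the bound on the exponent, with \<open>P = n! m!\<close>, \<open>Q = (n - k)! (m - k)!\<close>, \<open>K = k!\<close>,
  \<open>w = (n + m - 2k)!\<close> and \<open>M = 2\<^sup>n\<^sup>+\<^sup>m\<close>.  Binomial coefficients are at most powers of \<open>2\<close>, so up to powers
  of \<open>M\<close> one has \<open>P \<le> K\<^sup>2 Q\<close> and \<open>w \<le> Q\<close>.  For \<open>R \<le> 1\<close> what remains of the quotient is \<open>K\<close> to the power
  \<open>1 - 2R\<close>; for \<open>R > 1\<close> already \<open>Q \<le> P\<close> suffices.
\<close>

lemma powr_estimate:
  fixes P Q K M w R :: real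
  assumes "1 \<le> K" "1 \<le> M" "1 \<le> Q" "Q \<le> P" "P \<le> M * K\<^sup>2 * Q" "0 \<le> w" "w \<le> M * Q" "1/2 \<le> R"
  shows "P * w powr R / (Q * K) \<le> M powr (1 + R) * P powr R"
proof -
  have pos: "0 < K" "0 < M" "0 < Q" "0 < P" using assms by auto
  have P: "P powr (1 - R) \<le> M * Q powr (1 - R) * K"
  proof (cases "R \<le> 1")
    case True
    have "P powr (1 - R) \<le> (M * K\<^sup>2 * Q) powr (1 - R)"
      using assms pos True by (intro powr_mono2) auto
    also have "\<dots> = M powr (1 - R) * (K powr (2 * (1 - R))) * Q powr (1 - R)"
      using pos powr_powr[of K 2 "1 - R"] by (simp add: powr_mult)
    also have "\<dots> \<le> M powr 1 * K powr 1 * Q powr (1 - R)"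
      using assms pos by (intro mult_right_mono mult_mono powr_mono) auto
    finally show ?thesis using pos by (simp add: mult_ac)
  next
    case False
    then have "P powr (1 - R) \<le> 1 * Q powr (1 - R) * 1"
      using assms pos by (simp add: powr_mono2')
    also have "\<dots> \<le> M * Q powr (1 - R) * K"
      using assms by (intro mult_mono) auto
    finally show ?thesis .
  qed
  have w: "w powr R \<le> M powr R * Q powr R"
    using powr_mono2[of R w "M * Q"] assms pos by (simp add: powr_mult)
  have "P * w powr R = P powr R * (P powr (1 - R) * w powr R)"
    using pos by (simp add: powr_diff)
  also have "\<dots> \<le> P powr R * ((M * Q powr (1 - R) * K) * (M powr R * Q powr R))"
    using P w by (intro mult_left_mono mult_mono) (auto intro: order_trans[OF _ P])
  also have "\<dots> = M powr (1 + R) * P powr R * (Q * K)"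
    using pos by (simp add: powr_add powr_diff)
  finally show ?thesis using pos by (simp add: field_simps)
qed

lemma fact_le_power2:
  assumes "k \<le> n"
  shows "(fact n :: real) \<le> 2 ^ n * (fact k * fact (n - k))"
proof -
  have "(fact n :: real) = of_nat (n choose k) * (fact k * fact (n - k))"
    using binomial_fact_lemma[OF assms] by (metis mult.commute of_nat_fact of_nat_mult)
  also have "real (n choose k) \<le> 2 ^ n"
    using binomial_le_pow2[of n k] by (metis of_nat_le_iff of_nat_numeral of_nat_power)
  then have "of_nat (n choose k) * (fact k * fact (n - k)) \<le> 2 ^ n * (fact k * fact (n - k) :: real)"
    by (rule mult_right_mono) simp
  finally show ?thesis .
qed

text \<open>
  A bound, up to the factor \<open>1 / k!\<close>, for the \<open>k\<close>-th term of the star product in degrees \<open>n\<close> and \<open>m\<close>: the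
  number of ways to choose \<open>k\<close> factors in order on either side, times the weight of degree \<open>n + m - 2k\<close>.
\<close>

definition contraction_cost :: "real \<Rightarrow> nat \<Rightarrow> nat \<Rightarrow> nat \<Rightarrow> real"
  where "contraction_cost R k n m = (if k \<le> n \<and> k \<le> m then
    fact n / fact (n - k) * (fact m / fact (m - k)) * fact (n - k + (m - k)) powr R else 0)"

lemma contraction_cost_nonneg: "0 \<le> contraction_cost R k n m"
  by (simp add: contraction_cost_def)

lemma contraction_cost_le:
  assumes R: "1/2 \<le> R" and k: "k \<le> n" "k \<le> m"
  shows "contraction_cost R k n m / fact k \<le> (2 powr (1 + R)) ^ (n + m) * (fact n powr R * fact m powr R)"
proof -
  define A B K P w M :: real where "A = fact (n - k)" and "B = fact (m - k)" and "K = fact k"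
    and "P = fact n * fact m" and "w = fact (n - k + (m - k))" and "M = 2 ^ (n + m)"
  have 1: "1 \<le> A" "1 \<le> B" "1 \<le> K" "1 \<le> M" "0 \<le> w"
    by (simp_all add: A_def B_def K_def M_def w_def)
  have "P \<le> (2 ^ n * (K * A)) * (2 ^ m * (K * B))"
    unfolding P_def A_def B_def K_def
    by (intro mult_mono fact_le_power2 k) auto
  then have P: "P \<le> M * K\<^sup>2 * (A * B)"
    by (simp add: M_def power_add power2_eq_square mult_ac)
  have AB: "A * B \<le> P" unfolding A_def B_def P_def by (intro mult_mono fact_mono) auto
  have "w \<le> 2 ^ (n - k + (m - k)) * (A * B)"
    unfolding w_def A_def B_def using fact_le_power2[of "n - k" "n - k + (m - k)"] by simp
  also have "\<dots> \<le> M * (A * B)"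
    unfolding M_def using 1 by (intro mult_right_mono power_increasing) auto
  finally have w: "w \<le> M * (A * B)" .
  have AB1: "1 \<le> A * B" using 1 mult_mono[of 1 A 1 B] by simp
  have "contraction_cost R k n m / fact k = P * w powr R / (A * B * K)"
    using k by (simp add: contraction_cost_def A_def B_def K_def P_def w_def)
  also have "\<dots> \<le> M powr (1 + R) * P powr R"
    by (rule powr_estimate) (use 1 P AB w AB1 R in auto)
  also have "M powr (1 + R) = (2 powr (1 + R)) ^ (n + m)"
    unfolding M_def by (simp add: powr_realpow[symmetric] powr_powr mult.commute)
  also have "P powr R = fact n powr R * fact m powr R" unfolding P_def by (simp add: powr_mult)
  finally show ?thesis .
qed

text \<open>
  The terms with \<open>k \<le> min n m\<close>, at most \<open>2\<^sup>n\<^sup>+\<^sup>m\<close> of them, are bounded one by one.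
\<close>

lemma sum_contraction_cost_le:
  fixes z :: "'k::real_normed_field"
  assumes R: "1/2 \<le> R"
  defines "C \<equiv> 2 * (1 + norm z) * 2 powr (1 + R)"
  shows "(\<Sum>k\<le>N. norm (z ^ k / fact k) * contraction_cost R k n m) \<le>
    C ^ n * fact n powr R * (C ^ m * fact m powr R)"
proof -
  let ?X = "(1 + norm z) ^ (n + m) * ((2 powr (1 + R)) ^ (n + m) * (fact n powr R * fact m powr R))"
  have X: "0 \<le> ?X" by simp
  have le: "norm (z ^ k / fact k) * contraction_cost R k n m \<le> ?X" if k: "k \<le> n" "k \<le> m" for k
  proof -
    have "norm (z ^ k / fact k) * contraction_cost R k n m = norm z ^ k * (contraction_cost R k n m / fact k)"
      by (simp add: norm_divide norm_power)
    also have "\<dots> \<le> (1 + norm z) ^ (n + m) * ((2 powr (1 + R)) ^ (n + m) * (fact n powr R * fact m powr R))"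
    proof (rule mult_mono[OF _ contraction_cost_le[OF R k]])
      have "norm z ^ k \<le> (1 + norm z) ^ k" by (intro power_mono) auto
      also have "\<dots> \<le> (1 + norm z) ^ (n + m)" using k by (intro power_increasing) auto
      finally show "norm z ^ k \<le> (1 + norm z) ^ (n + m)" .
    qed (auto simp: contraction_cost_nonneg)
    finally show ?thesis .
  qed
  have "(\<Sum>k\<le>N. norm (z ^ k / fact k) * contraction_cost R k n m)
      = (\<Sum>k\<in>{..N} \<inter> {k. k \<le> n \<and> k \<le> m}. norm (z ^ k / fact k) * contraction_cost R k n m)"
    by (intro sum.mono_neutral_right) (auto simp: contraction_cost_def)
  also have "\<dots> \<le> (\<Sum>k\<in>{..N} \<inter> {k. k \<le> n \<and> k \<le> m}. ?X)"
    using le by (intro sum_mono) auto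
  also have "\<dots> = real (card ({..N} \<inter> {k. k \<le> n \<and> k \<le> m})) * ?X" by simp
  also have "\<dots> \<le> 2 ^ (n + m) * ?X"
  proof (rule mult_right_mono[OF _ X])
    have "card ({..N} \<inter> {k. k \<le> n \<and> k \<le> m}) \<le> card {..n + m}" by (intro card_mono) auto
    also have "card {..n + m} \<le> 2 ^ (n + m)" by (simp only: card_atMost Suc_leI less_exp)
    finally show "real (card ({..N} \<inter> {k. k \<le> n \<and> k \<le> m})) \<le> 2 ^ (n + m)"
      by (metis of_nat_le_iff of_nat_numeral of_nat_power)
  qed
  also have "\<dots> = C ^ n * fact n powr R * (C ^ m * fact m powr R)"
    unfolding C_def by (simp only: power_mult_distrib power_add mult_ac)
  finally show ?thesis .
qed

lemma seminorm_on_sum: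
  assumes \<nu>: "seminorm_on s A \<nu>" and s: "vector_space s" and A: "module.subspace s A"
    and "finite I" "\<And>i. i \<in> I \<Longrightarrow> f i \<in> A"
  shows "(\<Sum>i\<in>I. f i) \<in> A \<and> \<nu> (\<Sum>i\<in>I. f i) \<le> (\<Sum>i\<in>I. \<nu> (f i))"
proof -
  interpret vector_space s by fact
  show ?thesis using assms(4,5)
  proof (induction I rule: finite_induct)
    case empty
    show ?case using seminorm_onD(3)[OF \<nu> subspace_0[OF A], of 0] subspace_0[OF A] by simp
  next
    case (insert i I)
    then have "(\<Sum>i\<in>I. f i) \<in> A" "\<nu> (\<Sum>i\<in>I. f i) \<le> (\<Sum>i\<in>I. \<nu> (f i))" "f i \<in> A" by auto
    then show ?case using insert.hyps subspace_add[OF A, of "f i" "\<Sum>i\<in>I. f i"]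
      seminorm_onD(2)[OF \<nu>, of "f i" "\<Sum>i\<in>I. f i"] by simp
  qed
qed

lemma prod_falling:
  "k \<le> n \<Longrightarrow> (\<Prod>i<k. real (n - i)) = fact n / fact (n - k)"
proof (induction k)
  case (Suc k)
  then have "n - k = Suc (n - Suc k)" by simp
  then have "(fact (n - k) :: real) = real (n - k) * fact (n - Suc k)" by (metis fact_Suc of_nat_mult of_nat_fact)
  moreover have "real (n - k) \<noteq> 0" using Suc by simp
  ultimately show ?case using Suc by simp
qed simp

lemma prod_list_take:
  fixes p :: "'a \<Rightarrow> real"
  shows "k \<le> length v \<Longrightarrow> (\<Prod>x\<leftarrow>v. p x) = (\<Prod>x\<leftarrow>take (length v - k) v. p x) * (\<Prod>i<k. p (v ! (length v - Suc i)))"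
proof (induction k)
  case (Suc k)
  have "take (length v - k) v = take (length v - Suc k) v @ [v ! (length v - Suc k)]"
    using Suc take_Suc_conv_app_nth[of "length v - Suc k" v] by (simp add: Suc_diff_Suc)
  then show ?case using Suc by simp
qed simp

lemma prod_list_drop:
  fixes p :: "'a \<Rightarrow> real"
  shows "k \<le> length w \<Longrightarrow> (\<Prod>x\<leftarrow>w. p x) = (\<Prod>i<k. p (w ! i)) * (\<Prod>x\<leftarrow>drop k w. p x)"
proof (induction k)
  case (Suc k)
  have "drop k w = w ! k # drop (Suc k) w" using Suc by (simp add: Cons_nth_drop_Suc)
  then show ?case using Suc by simp
qed simp

text \<open>
  The condition \<open>p_split\<close> makes \<open>p\<close> compatible with the grading: it is what makes the signed
  permutations of tensor factors contractions.
\<close>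

locale weyl_estimate = graded_form smul V0 V1 \<Lambda>
  for smul :: "'k::real_normed_field \<Rightarrow> 'v::ab_group_add \<Rightarrow> 'v" and V0 V1 \<Lambda> +
  fixes p :: "'v \<Rightarrow> real"
  assumes p: "seminorm_on smul UNIV p"
    and p_split: "\<And>v. p v = p (part False v) + p (part True v)"
    and form_bound: "\<And>v w. norm (\<Lambda> v w) \<le> p v * p w"
begin

lemma p_nonneg: "0 \<le> p v"
  using seminorm_onD(1)[OF p] by simp

abbreviation "pprod v \<equiv> \<Prod>x\<leftarrow>v. p x"
abbreviation "pn n \<equiv> pnorm smul n p"
abbreviation "W R \<equiv> wnorm smul p R"

lemmas pn_seminorm = seminorm_projective[of p smul, OF p_nonneg]
lemmas W_seminorm = seminorm_weyl[of p smul, OF p_nonneg]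
lemmas pn_nonneg = projective_seminorm_nonneg[of p, OF p_nonneg]

lemma prod_list_nonneg: "0 \<le> pprod v"
  by (rule prod_list_map_nonneg) (rule p_nonneg)

text \<open>
  The parity patterns are the terms in the expansion of \<open>(p v\<^sub>1\<^sub>0 + p v\<^sub>1\<^sub>1) \<cdots> (p v\<^sub>n\<^sub>0 + p v\<^sub>n\<^sub>1)\<close>, where \<open>v\<^sub>i\<^sub>0\<close> and
  \<open>v\<^sub>i\<^sub>1\<close> are the components of \<open>v\<^sub>i\<close>; by \<open>p_split\<close> this product is \<open>p v\<^sub>1 \<cdots> p v\<^sub>n\<close>.
\<close>

lemma perm_image_bound:
  assumes \<sigma>: "\<sigma> permutes {..<n}" and v: "length v = n"
  shows "perm_image n \<sigma> v \<in> tpower n \<and> pn n (perm_image n \<sigma> v) \<le> pprod v"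
proof -
  let ?u = "\<lambda>s. map (\<lambda>i. component s v ! \<sigma> i) [0..<n]"
  let ?x = "\<lambda>s. tensor_scale ((-1) ^ odd_inversions n \<sigma> s) (ptensor (?u s))"
  have in_power: "?x s \<in> tpower n" for s
    by (intro tensor.subspace_scale[OF subspace_tensor_power] pure_tensor_in_tensor_power) simp
  have le: "pn n (?x s) \<le> (\<Prod>i<n. p (part (i \<in> s) (v ! i)))" for s
  proof -
    have "pn n (?x s) = pn n (ptensor (?u s))"
      using seminorm_onD(3)[OF pn_seminorm pure_tensor_in_tensor_power, of "?u s" n "(-1) ^ odd_inversions n \<sigma> s"]
      by (simp add: norm_power)
    also have "\<dots> \<le> pprod (?u s)"
      by (rule projective_seminorm_pure[of p, OF p_nonneg]) simp
    also have "\<dots> = (\<Prod>i<n. p (component s v ! \<sigma> i))"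
      using prod.distinct_set_conv_list[of "[0..<n]" "\<lambda>i. p (component s v ! \<sigma> i)"]
      by (simp add: o_def atLeast0LessThan)
    also have "\<dots> = (\<Prod>i<n. p (component s v ! i))"
      using prod.permute[OF \<sigma>, of "\<lambda>i. p (component s v ! i)"] by (simp add: o_def)
    also have "\<dots> = (\<Prod>i<n. p (part (i \<in> s) (v ! i)))"
      using v by (intro prod.cong) (auto simp: nth_component)
    finally show ?thesis .
  qed
  have "pn n (perm_image n \<sigma> v) \<le> (\<Sum>s\<in>Pow {..<n}. pn n (?x s))"
    and in_pow: "perm_image n \<sigma> v \<in> tpower n"
    using seminorm_on_sum[OF pn_seminorm vector_space_tensor_scale subspace_tensor_power, of "Pow {..<n}"
      ?x] in_power
    by (simp_all add: perm_image_def)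
  note this(1)
  also have "(\<Sum>s\<in>Pow {..<n}. pn n (?x s))
      \<le> (\<Sum>s\<in>Pow {..<n}. \<Prod>i<n. p (part (i \<in> s) (v ! i)))" by (intro sum_mono le)
  also have "\<dots> = (\<Sum>s\<in>Pow {..<n}. (\<Prod>i\<in>s. p (part True (v ! i))) * (\<Prod>i\<in>{..<n} - s. p (part False (v ! i))))"
  proof (intro sum.cong refl)
    fix s assume s: "s \<in> Pow {..<n}"
    have "(\<Prod>i<n. p (part (i \<in> s) (v ! i))) =
        (\<Prod>i\<in>{..<n} - s. p (part (i \<in> s) (v ! i))) * (\<Prod>i\<in>s. p (part (i \<in> s) (v ! i)))"
      using s by (intro prod.subset_diff) auto
    then show "(\<Prod>i<n. p (part (i \<in> s) (v ! i))) =
        (\<Prod>i\<in>s. p (part True (v ! i))) * (\<Prod>i\<in>{..<n} - s. p (part False (v ! i)))"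
      by (simp add: mult.commute)
  qed
  also have "\<dots> = (\<Prod>i<n. p (part True (v ! i)) + p (part False (v ! i)))"
    by (rule prod_add[symmetric]) simp
  also have "\<dots> = (\<Prod>i<n. p (v ! i))"
    by (intro prod.cong refl) (metis p_split add.commute)
  also have "\<dots> = pprod v"
    using v by (simp add: prod.list_conv_set_nth atLeast0LessThan)
  finally show ?thesis using in_pow by simp
qed

lemma symmetrizer_bound:
  assumes v: "length v = n"
  shows "pn n (symm n (ptensor v)) \<le> pprod v"
proof -
  have S: "symm n (ptensor v) =
      tensor_scale (1 / fact n) (\<Sum>\<sigma> | \<sigma> permutes {..<n}. perm_image n \<sigma> v)"
    unfolding symmetrizer_def using v perm_action_pure by (intro arg_cong2[of _ _ _ _ tensor_scale] sum.cong) auto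
  have sum: "(\<Sum>\<sigma> | \<sigma> permutes {..<n}. perm_image n \<sigma> v) \<in> tpower n \<and>
      pn n (\<Sum>\<sigma> | \<sigma> permutes {..<n}. perm_image n \<sigma> v) \<le> (\<Sum>\<sigma> | \<sigma> permutes {..<n}. pn n (perm_image n \<sigma> v))"
    by (rule seminorm_on_sum[OF pn_seminorm vector_space_tensor_scale subspace_tensor_power])
      (use perm_image_bound v in \<open>auto simp: finite_permutations\<close>)
  note sum[THEN conjunct2]
  also have "(\<Sum>\<sigma> | \<sigma> permutes {..<n}. pn n (perm_image n \<sigma> v)) \<le> (\<Sum>\<sigma> | \<sigma> permutes {..<n}. pprod v)"
    using perm_image_bound v by (intro sum_mono) auto
  also have "\<dots> = fact n * pprod v" by (simp add: card_permutations)
  finally show ?thesis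
    unfolding S seminorm_onD(3)[OF pn_seminorm sum[THEN conjunct1]] by (simp add: norm_divide field_simps)
qed

lemma monomial_in_sym_algebra: "mono_of u \<in> S"
proof -
  have "{n. mono_of u n \<noteq> 0} \<subseteq> {length u}" by (auto simp: sym_monomial_def in_degree_def)
  moreover have "mono_of u n \<in> sym_power smul V0 V1 n" for n
    using tensor.subspace_0[OF subspace_sym_power] pure_tensor_in_tensor_power[of u]
    by (auto simp: sym_monomial_def in_degree_def sym_power_def)
  ultimately show ?thesis by (auto simp: sym_algebra_def intro: finite_subset)
qed

lemma W_mono: "W R (mono_of u) \<le> fact (length u) powr R * pprod u"
  unfolding sym_monomial_def weyl_seminorm_in_degree[of p, OF p_nonneg]
  using symmetrizer_bound[of u "length u"] by (simp add: mult.commute mult_left_mono)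

lemma star_coeff_bound:
  assumes k: "k \<le> length v" "k \<le> length w"
  shows "norm (star_coeff k v w) * (pprod (take (length v - k) v) * pprod (drop k w)) \<le>
    fact (length v) / fact (length v - k) * (fact (length w) / fact (length w - k)) * (pprod v * pprod w)"
proof -
  let ?r = "pprod (take (length v - k) v) * pprod (drop k w)"
  have "norm (star_coeff k v w) = (\<Prod>i<k. real ((length v - i) * (length w - i)) *
      norm (\<Lambda> (v ! (length v - Suc i)) (w ! i)))"
    unfolding star_coeff_def prod_norm[symmetric] norm_mult norm_of_nat ..
  also have "\<dots> \<le> (\<Prod>i<k. real ((length v - i) * (length w - i)) * (p (v ! (length v - Suc i)) * p (w ! i)))"
    by (intro prod_mono conjI mult_left_mono mult_nonneg_nonneg form_bound) auto
  also have "\<dots> = (\<Prod>i<k. real (length v - i)) * (\<Prod>i<k. real (length w - i)) *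
      ((\<Prod>i<k. p (v ! (length v - Suc i))) * (\<Prod>i<k. p (w ! i)))"
    by (simp only: prod.distrib of_nat_mult)
  finally have "norm (star_coeff k v w) * ?r \<le>
     (\<Prod>i<k. real (length v - i)) * (\<Prod>i<k. real (length w - i)) *
      ((\<Prod>i<k. p (v ! (length v - Suc i))) * (\<Prod>i<k. p (w ! i))) *
      ?r"
    by (rule mult_right_mono) (intro mult_nonneg_nonneg prod_list_nonneg)
  also have "\<dots> = (\<Prod>i<k. real (length v - i)) * (\<Prod>i<k. real (length w - i)) *
      ((pprod (take (length v - k) v) * (\<Prod>i<k. p (v ! (length v - Suc i)))) *
       ((\<Prod>i<k. p (w ! i)) * pprod (drop k w)))"
    by (simp only: mult_ac)
  finally show ?thesis
    unfolding prod_falling[OF k(1)] prod_falling[OF k(2)] prod_list_take[OF k(1), of p, symmetric]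
      prod_list_drop[OF k(2), of p, symmetric] .
qed

lemma star_term_word_bound:
  shows "star_term k (wd v) (wd w) \<in> S"
    and "W R (star_term k (wd v) (wd w)) \<le>
      contraction_cost R k (length v) (length w) * (pprod v * pprod w)"
proof -
  let ?u = "take (length v - k) v @ drop k w"
  show "star_term k (wd v) (wd w) \<in> S"
    unfolding star_term_word by (intro alg.subspace_scale[OF subspace_sym_algebra] monomial_in_sym_algebra)
  have W: "W R (star_term k (wd v) (wd w)) = norm (star_coeff k v w) * W R (mono_of ?u)"
    unfolding star_term_word using seminorm_onD(3)[OF W_seminorm] monomial_in_sym_algebra sym_algebra_subset by blast
  show "W R (star_term k (wd v) (wd w)) \<le>
      contraction_cost R k (length v) (length w) * (pprod v * pprod w)"
  proof (cases "k \<le> length v \<and> k \<le> length w")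
    case True
    have len: "length ?u = length v - k + (length w - k)" by simp
    have "W R (star_term k (wd v) (wd w)) \<le> norm (star_coeff k v w) *
        (fact (length ?u) powr R * pprod ?u)"
      unfolding W by (intro mult_left_mono W_mono) simp
    also have "\<dots> = fact (length ?u) powr R *
        (norm (star_coeff k v w) * (pprod (take (length v - k) v) * pprod (drop k w)))"
      by (simp only: map_append prod_list.append mult_ac)
    also have "\<dots> \<le> fact (length ?u) powr R * (fact (length v) / fact (length v - k) *
        (fact (length w) / fact (length w - k)) * (pprod v * pprod w))"
      using True by (intro mult_left_mono star_coeff_bound) auto
    also have "\<dots> = contraction_cost R k (length v) (length w) * (pprod v * pprod w)"
      unfolding contraction_cost_def len using True by simp
    finally show ?thesis .
  next
    case False
    then have "star_coeff k v w = 0" by (intro star_coeff_zero) auto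
    moreover have "contraction_cost R k (length v) (length w) = 0"
      unfolding contraction_cost_def using False by (rule if_not_P)
    ultimately show ?thesis unfolding W by simp
  qed
qed

abbreviation "word_span \<equiv> alg.span (range wd)"

lemma in_degree_in_word_span:
  assumes "t \<in> tpower n"
  shows "in_degree n t \<in> word_span"
proof -
  interpret L: Vector_Spaces.linear tensor_scale alg_scale "in_degree n" by (rule linear_in_degree)
  have "in_degree n t \<in> in_degree n ` tensor.span (ptensor ` {v. length v = n})"
    using assms unfolding tensor_power_def by (rule imageI)
  also have "\<dots> = alg.span (in_degree n ` ptensor ` {v. length v = n})" by (rule L.span_image[symmetric])
  also have "\<dots> \<subseteq> word_span" by (intro alg.span_mono) (auto simp: word_def)
  finally show ?thesis .
qed

lemma sym_algebra_subset_word_span: "S \<subseteq> word_span"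
proof
  fix a assume "a \<in> S"
  then have a: "finite {n. a n \<noteq> 0}" "\<And>n. a n \<in> tpower n"
    using sym_algebra_subset by (auto simp: tensor_algebra_def)
  have "a = (\<Sum>n | a n \<noteq> 0. in_degree n (a n))" by (rule sum_in_degree[OF a(1)]) simp
  also have "\<dots> \<in> word_span" by (intro alg.span_sum in_degree_in_word_span a(2))
  finally show "a \<in> word_span" .
qed

lemma star_term_in_sym_algebra:
  assumes a: "a \<in> word_span" and b: "b \<in> word_span"
  shows "star_term k a b \<in> S"
proof -
  interpret l: Vector_Spaces.linear alg_scale alg_scale "\<lambda>x. star_term k x u" for u by (rule star_term_linear)
  interpret r: Vector_Spaces.linear alg_scale alg_scale "\<lambda>x. star_term k u x" for u by (rule star_term_linear)
  have "star_term k (wd v) ` range wd \<subseteq> S" for v using star_term_word_bound(1) by auto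
  from alg.span_minimal[OF this subspace_sym_algebra] have "star_term k (wd v) b \<in> S" for v
    using b unfolding r.span_image by auto
  then have "(\<lambda>x. star_term k x b) ` range wd \<subseteq> S" by auto
  from alg.span_minimal[OF this subspace_sym_algebra] show ?thesis
    using a unfolding l.span_image by auto
qed

text \<open>
  By linearity in either argument it suffices to consider words, first on the left and then on the right.
\<close>

lemma star_term_bound:
  assumes t: "t \<in> tpower n" and u: "u \<in> tpower m"
  shows "W R (star_term k (in_degree n t) (in_degree m u)) \<le> contraction_cost R k n m * (pn n t * pn m u)"
proof -
  have wd_span: "wd v \<in> word_span" for v by (intro alg.span_base) auto
  have wd_deg: "in_degree n (ptensor v) = wd v" if "length v = n" for v n
    using that by (simp add: word_def)
  have inA: "star_term k a b \<in> tensor_algebra smul" if "a \<in> word_span" "b \<in> word_span" for a b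
    using star_term_in_sym_algebra[OF that] sym_algebra_subset by blast
  note lin = Vector_Spaces.linear_compose[OF linear_in_degree, unfolded o_def]
  have 1: "W R (star_term k (in_degree n t) (wd w)) \<le> contraction_cost R k n m * pprod w * pn n t"
    if w: "length w = m" for w
  proof (rule bounded_by_projective_seminorm[OF lin[OF star_term_linear(1)] W_seminorm subspace_tensor_algebra _ _ t])
    show "0 \<le> contraction_cost R k n m * pprod w"
      by (intro mult_nonneg_nonneg contraction_cost_nonneg prod_list_nonneg)
    show "star_term k (in_degree n (ptensor v)) (wd w) \<in> tensor_algebra smul \<and>
        W R (star_term k (in_degree n (ptensor v)) (wd w))
        \<le> contraction_cost R k n m * pprod w * pprod v" if "length v = n" for v
      unfolding wd_deg[OF that] using star_term_word_bound(2)[of R k v w] inA[OF wd_span wd_span] that w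
      by (simp add: mult_ac)
  qed
  have "W R (star_term k (in_degree n t) (in_degree m u)) \<le> contraction_cost R k n m * pn n t * pn m u"
  proof (rule bounded_by_projective_seminorm[OF lin[OF star_term_linear(2)] W_seminorm subspace_tensor_algebra _ _ u])
    show "0 \<le> contraction_cost R k n m * pn n t"
      by (intro mult_nonneg_nonneg contraction_cost_nonneg pn_nonneg t)
    show "star_term k (in_degree n t) (in_degree m (ptensor w)) \<in> tensor_algebra smul \<and>
        W R (star_term k (in_degree n t) (in_degree m (ptensor w)))
        \<le> contraction_cost R k n m * pn n t * pprod w" if "length w = m" for w
      unfolding wd_deg[OF that] using 1[OF that] inA[OF in_degree_in_word_span[OF t] wd_span]
      by (simp add: mult_ac)
  qed
  then show ?thesis by (simp add: mult.assoc)
qed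

lemma star_term_vanishes:
  assumes a: "a \<in> S" and b: "b \<in> S"
    and supp: "\<forall>n>N. a n = 0" and k: "N < k"
  shows "star_term k a b = 0"
proof -
  have an: "a n \<in> tpower n" for n using a sym_algebra_subset by (auto simp: tensor_algebra_def)
  interpret l: Vector_Spaces.linear alg_scale alg_scale "\<lambda>x. star_term k x u" for u by (rule star_term_linear)
  interpret r: Vector_Spaces.linear alg_scale alg_scale "\<lambda>x. star_term k u x" for u by (rule star_term_linear)
  have deg: "star_term k (in_degree n t) b = 0" if t: "t \<in> tpower n" and n: "n \<le> N" for n t
  proof -
    have "star_term k (wd v) b = 0" if v: "length v = n" for v
    proof (rule linear_eq_on_span_of[OF star_term_linear(2) _ _ subsetD[OF sym_algebra_subset_word_span b]])
      show "linmap alg_scale alg_scale (\<lambda>_. 0)"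
        by (simp add: linmap_iff vector_space_alg_scale)
      show "star_term k (wd v) x = 0" if "x \<in> range wd" for x
        using that star_coeff_zero[of v k] v n k by (auto simp: star_term_word)
    qed
    then have pure: "star_term k (in_degree n (ptensor v)) b = 0" if "length v = n" for v
      using that by (simp add: word_def)
    show ?thesis
    proof (rule linear_eq_on_span_of[OF _ _ _ t[unfolded tensor_power_def]])
      show "linmap tensor_scale alg_scale (\<lambda>t. star_term k (in_degree n t) b)"
        using Vector_Spaces.linear_compose[OF linear_in_degree star_term_linear(1)] by (simp add: o_def)
      show "linmap tensor_scale alg_scale (\<lambda>_. 0)"
        by (simp add: linmap_iff vector_space_alg_scale vector_space_tensor_scale)
    qed (use pure in auto)
  qed
  have "a = (\<Sum>n\<le>N. in_degree n (a n))" by (rule sum_in_degree) (use supp in auto)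
  then have "star_term k a b = (\<Sum>n\<le>N. star_term k (in_degree n (a n)) b)" by (metis star_term_sum(1))
  then show ?thesis using deg an by simp
qed

lemma star_finite_sum:
  assumes a: "a \<in> S" and b: "b \<in> S" and supp: "\<forall>n>N. a n = 0"
  shows "star smul V0 V1 \<Lambda> z a b = (\<Sum>k\<le>N. alg_scale (z ^ k / fact k) (star_term k a b))"
  unfolding star_eq_star_terms[OF a b]
proof (rule Sum_any.expand_superset)
  show "{k. alg_scale (z ^ k / fact k) (star_term k a b) \<noteq> 0} \<subseteq> {..N}"
  proof
    fix k assume k: "k \<in> {k. alg_scale (z ^ k / fact k) (star_term k a b) \<noteq> 0}"
    show "k \<in> {..N}"
    proof (rule ccontr)
      assume "k \<notin> {..N}"
      then have "star_term k a b = 0" by (intro star_term_vanishes[OF a b supp]) simp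
      then show False using k by simp
    qed
  qed
qed simp

lemma support_bound:
  assumes "a \<in> S"
  shows "\<exists>N. \<forall>n>N. a n = 0"
proof -
  have "finite {n. a n \<noteq> 0}" using assms by (simp add: sym_algebra_def)
  then obtain N where "\<forall>n\<in>{n. a n \<noteq> 0}. n \<le> N" using finite_nat_set_iff_bounded_le by blast
  then show ?thesis by (metis (mono_tags) mem_Collect_eq not_le)
qed

lemma star_in_sym_algebra:
  assumes a: "a \<in> S" and b: "b \<in> S"
  shows "star smul V0 V1 \<Lambda> z a b \<in> S"
proof -
  obtain N where N: "\<forall>n>N. a n = 0" using support_bound[OF a] by blast
  have "a \<in> word_span" "b \<in> word_span" using a b sym_algebra_subset_word_span by auto
  then show ?thesis
    unfolding star_finite_sum[OF a b N]
    by (intro alg.subspace_sum[OF subspace_sym_algebra] alg.subspace_scale[OF subspace_sym_algebra] star_term_in_sym_algebra)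
qed

lemma star_bilinear: "bilinear_on alg_scale S alg_scale (star smul V0 V1 \<Lambda> z)"
  unfolding bilinear_on_def
proof (intro conjI ballI allI)
  fix x y u assume x: "x \<in> S" and y: "y \<in> S" and u: "u \<in> S"
  have xy: "x + y \<in> S" using alg.subspace_add[OF subspace_sym_algebra x y] .
  obtain N1 N2 N3 where N: "\<And>n. N1 < n \<Longrightarrow> x n = 0" "\<And>n. N2 < n \<Longrightarrow> y n = 0" "\<And>n. N3 < n \<Longrightarrow> u n = 0"
    using support_bound x y u by metis
  define M where "M = max N1 (max N2 N3)"
  have M: "\<forall>n>M. x n = 0" "\<forall>n>M. y n = 0" "\<forall>n>M. u n = 0" "\<forall>n>M. (x + y) n = 0"
    using N by (auto simp: M_def)
  show "star smul V0 V1 \<Lambda> z (x + y) u = star smul V0 V1 \<Lambda> z x u + star smul V0 V1 \<Lambda> z y u"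
    unfolding star_finite_sum[OF xy u M(4)] star_finite_sum[OF x u M(1)] star_finite_sum[OF y u M(2)]
    by (simp only: star_term_bilinear alg.scale_right_distrib sum.distrib)
  show "star smul V0 V1 \<Lambda> z u (x + y) = star smul V0 V1 \<Lambda> z u x + star smul V0 V1 \<Lambda> z u y"
    unfolding star_finite_sum[OF u xy M(3)] star_finite_sum[OF u x M(3)] star_finite_sum[OF u y M(3)]
    by (simp only: star_term_bilinear alg.scale_right_distrib sum.distrib)
next
  fix c x y assume x: "x \<in> S" and y: "y \<in> S"
  have cx: "alg_scale c x \<in> S" and cy: "alg_scale c y \<in> S"
    using alg.subspace_scale[OF subspace_sym_algebra] x y by auto
  obtain N where N: "\<forall>n>N. x n = 0" using support_bound[OF x] by blast
  then have Nc: "\<forall>n>N. alg_scale c x n = 0" by (simp add: alg_scale_def)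
  show "star smul V0 V1 \<Lambda> z (alg_scale c x) y = alg_scale c (star smul V0 V1 \<Lambda> z x y)"
    unfolding star_finite_sum[OF cx y Nc] star_finite_sum[OF x y N]
    by (simp only: star_term_bilinear alg.scale_sum_right alg.scale_left_commute)
  show "star smul V0 V1 \<Lambda> z x (alg_scale c y) = alg_scale c (star smul V0 V1 \<Lambda> z x y)"
    unfolding star_finite_sum[OF x cy N] star_finite_sum[OF x y N]
    by (simp only: star_term_bilinear alg.scale_sum_right alg.scale_left_commute)
qed

text \<open>
  Decompose \<open>a\<close> and \<open>b\<close> into homogeneous parts and sum the bounds for their products; for fixed degrees
  the sum over \<open>k\<close> is \<open>sum_contraction_cost_le\<close>.
\<close>

lemma star_bound:
  fixes z :: 'k
  assumes R: "1/2 \<le> R" and a: "a \<in> S" and b: "b \<in> S"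
  defines "C \<equiv> 2 * (1 + norm z) * 2 powr (1 + R)"
  shows "W R (star smul V0 V1 \<Lambda> z a b) \<le>
    wnorm smul (\<lambda>x. C * p x) R a * wnorm smul (\<lambda>x. C * p x) R b"
proof -
  have an: "a n \<in> tpower n" and bn: "b n \<in> tpower n" for n
    using a b sym_algebra_subset by (auto simp: tensor_algebra_def)
  obtain N1 N2 where N12: "\<And>n. N1 < n \<Longrightarrow> a n = 0" "\<And>n. N2 < n \<Longrightarrow> b n = 0"
    using support_bound a b by metis
  define N where "N = max N1 N2"
  have N: "\<forall>n>N. a n = 0" "\<forall>n>N. b n = 0" using N12 by (auto simp: N_def)
  have I: "n \<notin> {..N} \<Longrightarrow> a n = 0" "n \<notin> {..N} \<Longrightarrow> b n = 0" for n using N by auto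
  have sums: "a = (\<Sum>n\<le>N. in_degree n (a n))" "b = (\<Sum>m\<le>N. in_degree m (b m))"
    using I by (intro sum_in_degree; auto)+
  let ?t = "\<lambda>k n m. star_term k (in_degree n (a n)) (in_degree m (b m))"
  let ?x = "\<lambda>k n m. alg_scale (z ^ k / fact k) (?t k n m)"
  let ?A = "\<lambda>a. \<Sum>n\<le>N. C ^ n * pn n (a n) * fact n powr R"
  let ?y = "\<lambda>k n m. norm (z ^ k / fact k) * contraction_cost R k n m"
  have TA: "?t k n m \<in> tensor_algebra smul" for k n m
    using star_term_in_sym_algebra in_degree_in_word_span an bn sym_algebra_subset by blast
  have TA': "alg_scale c (?t k n m) \<in> tensor_algebra smul" for c k n m
    using TA alg.subspace_scale[OF subspace_tensor_algebra] by blast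
  have C0: "0 \<le> C" by (simp add: C_def)
  note sn = seminorm_on_sum[OF W_seminorm[of R] vector_space_alg_scale subspace_tensor_algebra]
  have "star_term k a b = (\<Sum>n\<le>N. \<Sum>m\<le>N. ?t k n m)" for k
  proof -
    have "star_term k a b = (\<Sum>n\<le>N. star_term k (in_degree n (a n)) b)"
      by (subst sums(1)) (simp only: star_term_sum(1))
    also have "\<dots> = (\<Sum>n\<le>N. \<Sum>m\<le>N. ?t k n m)"
      by (subst sums(2)) (simp only: star_term_sum(2))
    finally show ?thesis .
  qed
  then have star: "star smul V0 V1 \<Lambda> z a b = (\<Sum>k\<le>N. \<Sum>n\<le>N. \<Sum>m\<le>N. ?x k n m)"
    unfolding star_finite_sum[OF a b N(1)] by (simp only: alg.scale_sum_right)
  have m_sum: "(\<Sum>m\<le>N. ?x k n m) \<in> tensor_algebra smul \<and>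
      W R (\<Sum>m\<le>N. ?x k n m) \<le> (\<Sum>m\<le>N. W R (?x k n m))" for k n
    by (rule sn) (use TA' in auto)
  have n_sum: "(\<Sum>n\<le>N. \<Sum>m\<le>N. ?x k n m) \<in> tensor_algebra smul \<and>
      W R (\<Sum>n\<le>N. \<Sum>m\<le>N. ?x k n m) \<le> (\<Sum>n\<le>N. W R (\<Sum>m\<le>N. ?x k n m))" for k
    by (rule sn) (use m_sum in auto)
  have "W R (star smul V0 V1 \<Lambda> z a b) \<le> (\<Sum>k\<le>N. W R (\<Sum>n\<le>N. \<Sum>m\<le>N. ?x k n m))"
    unfolding star by (rule sn[THEN conjunct2]) (use n_sum in auto)
  also have "\<dots> \<le> (\<Sum>k\<le>N. \<Sum>n\<le>N. W R (\<Sum>m\<le>N. ?x k n m))"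
    using n_sum by (intro sum_mono) blast
  also have "\<dots> \<le> (\<Sum>k\<le>N. \<Sum>n\<le>N. \<Sum>m\<le>N. W R (?x k n m))"
    using m_sum by (intro sum_mono) blast
  also have "\<dots> \<le> (\<Sum>k\<le>N. \<Sum>n\<le>N. \<Sum>m\<le>N. ?y k n m * (pn n (a n) * pn m (b m)))"
  proof (intro sum_mono)
    fix k n m
    have "W R (?x k n m) = norm (z ^ k / fact k) * W R (?t k n m)"
      by (rule seminorm_onD(3)[OF W_seminorm TA])
    also have "\<dots> \<le> norm (z ^ k / fact k) * (contraction_cost R k n m * (pn n (a n) * pn m (b m)))"
      by (intro mult_left_mono star_term_bound an bn) simp
    finally show "W R (?x k n m) \<le> ?y k n m * (pn n (a n) * pn m (b m))"
      by (simp only: mult.assoc)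
  qed
  also have "\<dots> = (\<Sum>n\<le>N. \<Sum>k\<le>N. \<Sum>m\<le>N. ?y k n m * (pn n (a n) * pn m (b m)))"
    by (rule sum.swap)
  also have "\<dots> = (\<Sum>n\<le>N. \<Sum>m\<le>N. \<Sum>k\<le>N. ?y k n m * (pn n (a n) * pn m (b m)))"
    by (intro sum.cong refl sum.swap)
  also have "\<dots> = (\<Sum>n\<le>N. \<Sum>m\<le>N. (\<Sum>k\<le>N. ?y k n m) * (pn n (a n) * pn m (b m)))"
    by (simp only: sum_distrib_right)
  also have "\<dots> \<le> (\<Sum>n\<le>N. \<Sum>m\<le>N.
      (C ^ n * fact n powr R * (C ^ m * fact m powr R)) * (pn n (a n) * pn m (b m)))"
    unfolding C_def
    by (intro sum_mono mult_right_mono sum_contraction_cost_le R mult_nonneg_nonneg pn_nonneg an bn)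
  also have "\<dots> = ?A a * ?A b"
    unfolding sum_product by (intro sum.cong refl) (simp only: mult_ac)
  also have "\<dots> \<le> wnorm smul (\<lambda>x. C * p x) R a * wnorm smul (\<lambda>x. C * p x) R b"
  proof (intro mult_mono)
    show "?A a \<le> wnorm smul (\<lambda>x. C * p x) R a"
      by (rule weyl_seminorm_mult[of p, OF p_nonneg C0 an finite_atMost I(1)])
    show "?A b \<le> wnorm smul (\<lambda>x. C * p x) R b"
      by (rule weyl_seminorm_mult[of p, OF p_nonneg C0 bn finite_atMost I(2)])
    show "0 \<le> ?A b"
      using C0 by (intro sum_nonneg mult_nonneg_nonneg pn_nonneg bn) auto
    show "0 \<le> wnorm smul (\<lambda>x. C * p x) R a"
      using a sym_algebra_subset C0 p_nonneg by (intro seminorm_onD(1)[OF seminorm_weyl]) auto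
  qed
  finally show ?thesis .
qed

end

section \<open>The Weyl algebra\<close>

context graded_lcs
begin

sublocale lcs smul T
  by unfold_locales (rule locally_convex)

sublocale graded_vector_space smul V0 V1
  by unfold_locales (rule subspace_even subspace_odd trivial_Int sum_UNIV)+

lemma continuous_part: "continuous_map T T (part b)"
  using continuous_projection_even continuous_projection_odd by (simp add: part_def)

definition split_seminorm :: "('v \<Rightarrow> real) \<Rightarrow> 'v \<Rightarrow> real"
  where "split_seminorm q v = q (part False v) + q (part True v)"

lemma split_seminorm_continuous:
  assumes q: "csn q"
  shows "csn (split_seminorm q)"
proof -
  have "csn (\<lambda>v. q (part b v))" for b
  proof -
    have lin: "part b (x + y) = part b x + part b y" "part b (smul c x) = smul c (part b x)" for x y c
      using linear_part by (simp_all add: linmap_iff)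
    have "continuous_map T euclideanreal (q \<circ> part b)"
      by (rule continuous_map_compose[OF continuous_part]) (use q in \<open>simp add: continuous_seminorm_def\<close>)
    then show ?thesis
      using q unfolding continuous_seminorm_def seminorm_on_def by (simp add: lin o_def)
  qed
  from continuous_seminorm_add[OF this[of False] this[of True]] show ?thesis
    by (simp add: split_seminorm_def[abs_def])
qed

lemma split_seminorm_ge:
  assumes q: "csn q"
  shows "q v \<le> split_seminorm q v"
  using seminorm_onD(2)[OF seminorm_continuous[OF q], of "part False v" "part True v"]
  by (simp add: part_sum split_seminorm_def)

lemma split_seminorm_split:
  assumes q: "csn q"
  shows "split_seminorm q v = split_seminorm q (part False v) + split_seminorm q (part True v)"
proof -
  have "q 0 = 0" using seminorm_onD(3)[OF seminorm_continuous[OF q], of 0 0] by simp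
  moreover have "part False v \<in> V0" "part True v \<in> V1" using part_in[of False v] part_in[of True v] by auto
  ultimately show ?thesis by (simp add: split_seminorm_def part_even part_odd)
qed

text \<open>
  One family for both topologies: \<open>X\<close> is \<open>{R}\<close> in the first case and \<open>{..<R}\<close> in the second.
\<close>

definition weyl_family :: "real set \<Rightarrow> (('v, 'k) tensor_alg \<Rightarrow> real) set"
  where "weyl_family X = {wnorm smul p r | p r. csn p \<and> r \<in> X}"

lemma seminorm_nonneg: "csn p \<Longrightarrow> 0 \<le> p v"
  using seminorm_onD(1)[OF seminorm_continuous, of p v] by simp

lemma directed_weyl_family:
  assumes X: "X \<noteq> {}"
  shows "directed_seminorm_family alg_scale S (weyl_family X)"
proof (intro directed_seminorm_family.intro seminorm_family.intro seminorm_family_axioms.intro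
    directed_seminorm_family_axioms.intro vector_space_alg_scale)
  show "alg.subspace S" by (rule subspace_sym_algebra)
  show "weyl_family X \<noteq> {}" using X continuous_seminorm_zero by (auto simp: weyl_family_def)
next
  fix w assume "w \<in> weyl_family X"
  then obtain p r where p: "csn p" and w: "w = wnorm smul p r"
    by (auto simp: weyl_family_def)
  have "seminorm_on alg_scale (tensor_algebra smul) w"
    unfolding w by (rule seminorm_weyl) (rule seminorm_nonneg[OF p])
  then show "seminorm_on alg_scale S w"
    using sym_algebra_subset unfolding seminorm_on_def by blast
next
  fix w w' assume "w \<in> weyl_family X" "w' \<in> weyl_family X"
  then obtain p r p' r' where p: "csn p" "r \<in> X" "w = wnorm smul p r"
    and p': "csn p'" "r' \<in> X" "w' = wnorm smul p' r'"
    by (auto simp: weyl_family_def)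
  let ?w = "wnorm smul (\<lambda>x. p x + p' x) (max r r')"
  have "?w \<in> weyl_family X"
    using continuous_seminorm_add[OF p(1) p'(1)] p(2) p'(2) unfolding weyl_family_def max_def by auto
  moreover have "w x \<le> ?w x" "w' x \<le> ?w x" if "x \<in> S" for x
    using that sym_algebra_subset seminorm_nonneg[OF p(1)] seminorm_nonneg[OF p'(1)]
    unfolding p(3) p'(3) by (auto intro!: weyl_seminorm_mono)
  ultimately show "\<exists>r\<in>weyl_family X. \<forall>x\<in>S. w x \<le> r x \<and> w' x \<le> r x" by blast
qed

abbreviation embed :: "'v \<Rightarrow> ('v, 'k) tensor_alg"
  where "embed v \<equiv> in_degree 1 (ptensor [v])"

lemma embed_in_sym_algebra: "embed v \<in> S"
proof -
  have "{n. embed v n \<noteq> 0} \<subseteq> {1}" by (auto simp: in_degree_def)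
  moreover have "embed v n \<in> sym_power smul V0 V1 n" for n
    using tensor.subspace_0[OF subspace_sym_power] sym_power_one[OF pure_tensor_in_tensor_power[of "[v]" 1]]
    by (simp add: in_degree_def)
  ultimately show ?thesis by (auto simp: sym_algebra_def intro: finite_subset)
qed

lemma weyl_seminorm_embed:
  assumes p: "csn p"
  shows "wnorm smul p r (embed v) = p v"
  using weyl_seminorm_in_degree[of p smul r 1 "ptensor [v]"] seminorm_nonneg[OF p]
    projective_seminorm_degree_one[OF vector_space_axioms seminorm_continuous[OF p]]
  by simp

text \<open>
  Countable cofinal families of seminorms on \<open>V\<close> and of exponents combine to one on the Weyl algebra;
  conversely, seminorms on the Weyl algebra are restricted to degree one.
\<close>

lemma first_countable_weyl_iff:
  assumes X: "X \<noteq> {}" and Y: "countable Y" "Y \<subseteq> X" "\<And>r. r \<in> X \<Longrightarrow> \<exists>r'\<in>Y. r \<le> r'"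
  shows "first_countable (seminorm_topology S (weyl_family X)) \<longleftrightarrow> first_countable T"
proof
  interpret W: directed_seminorm_family alg_scale S "weyl_family X" by (rule directed_weyl_family[OF X])
  {
    assume "first_countable T"
    then obtain C where C: "countable C" "\<forall>p\<in>C. csn p"
      "\<forall>q. csn q \<longrightarrow> (\<exists>p\<in>C. \<forall>x. q x \<le> p x)"
      using countable_cofinal_seminorms by blast
    let ?D = "(\<lambda>(p, r). wnorm smul p r) ` (C \<times> Y)"
    show "first_countable (seminorm_topology S (weyl_family X))"
    proof (rule W.first_countable_if_countable_cofinal)
      show "countable ?D" using C(1) Y(1) by (intro countable_image countable_SIGMA) auto
      show "?D \<subseteq> weyl_family X" using C(2) Y(2) by (auto simp: weyl_family_def)
      fix w assume "w \<in> weyl_family X"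
      then obtain p r where p: "csn p" "r \<in> X" "w = wnorm smul p r"
        by (auto simp: weyl_family_def)
      obtain q where q: "q \<in> C" "\<And>x. p x \<le> q x" using C(3) p(1) by blast
      obtain r' where r': "r' \<in> Y" "r \<le> r'" using Y(3)[OF p(2)] by blast
      have "wnorm smul p r x \<le> wnorm smul q r' x" if "x \<in> S" for x
        by (rule weyl_seminorm_mono[of p q, OF seminorm_nonneg[OF p(1)] q(2) r'(2)
              subsetD[OF sym_algebra_subset that]])
      moreover have "wnorm smul q r' \<in> ?D"
        using q(1) r'(1) by (intro image_eqI[of _ _ "(q, r')"]) auto
      ultimately show "\<exists>v\<in>?D. \<forall>x\<in>S. w x \<le> v x" unfolding p(3) by blast
    qed
  }
  assume "first_countable (seminorm_topology S (weyl_family X))"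
  from W.countable_cofinal_if_first_countable[OF this]
  obtain D where D: "countable D" "D \<subseteq> weyl_family X"
    "\<forall>q\<in>weyl_family X. \<exists>d\<in>D. \<exists>N::nat. \<forall>x\<in>S. q x \<le> real N * d x"
    by (elim exE conjE)
  have "\<forall>d\<in>D. \<exists>p. csn p \<and> (\<exists>r. d = wnorm smul p r)"
  proof
    fix d assume "d \<in> D"
    then have "d \<in> weyl_family X" using D(2) by blast
    then show "\<exists>p. csn p \<and> (\<exists>r. d = wnorm smul p r)"
      unfolding weyl_family_def by blast
  qed
  from bchoice[OF this] obtain P
    where P: "\<forall>d\<in>D. csn (P d) \<and> (\<exists>r. d = wnorm smul (P d) r)"
    by (elim exE)
  obtain r where r: "r \<in> X" using X by blast
  show "first_countable T"
  proof (rule first_countable_if_countable_bound)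
    show "countable (P ` D)" using D(1) by simp
    show "csn p" if "p \<in> P ` D" for p using that P by auto
    fix q assume q: "csn q"
    have "wnorm smul q r \<in> weyl_family X" using q r by (auto simp: weyl_family_def)
    from bspec[OF D(3) this] obtain d and N :: nat
      where d: "d \<in> D" "\<forall>x\<in>S. wnorm smul q r x \<le> real N * d x"
      by (elim bexE exE)
    obtain r' where Pd: "csn (P d)" "d = wnorm smul (P d) r'"
      using P d(1) by blast
    have "q v \<le> real N * P d v" for v
    proof -
      have "wnorm smul q r (embed v) \<le> real N * wnorm smul (P d) r' (embed v)"
        using d(2) embed_in_sym_algebra Pd(2) by metis
      then show ?thesis by (simp only: weyl_seminorm_embed[OF q] weyl_seminorm_embed[OF Pd(1)])
    qed
    then show "\<exists>p\<in>P ` D. \<exists>N::nat. \<forall>x. q x \<le> real N * p x" using d(1) by blast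
  qed
qed

text \<open>
  Only an upper part of the exponents has to satisfy the bound \<open>1/2\<close>, as seminorms with smaller exponents
  are dominated by those with larger ones.
\<close>

lemma locally_convex_algebra_weyl:
  fixes \<Lambda> :: "'v \<Rightarrow> 'v \<Rightarrow> 'k" and z :: 'k
  assumes bilinear: "bilinear_on smul UNIV (*) \<Lambda>"
    and continuous: "continuous_map (prod_topology T T) euclidean (\<lambda>(v, w). \<Lambda> v w)"
    and X: "X \<noteq> {}" "\<And>r. r \<in> X \<Longrightarrow> \<exists>r'\<in>X. r \<le> r' \<and> 1/2 \<le> r'"
  shows "locally_convex_algebra alg_scale S (seminorm_topology S (weyl_family X)) (star smul V0 V1 \<Lambda> z)"
proof -
  interpret W: directed_seminorm_family alg_scale S "weyl_family X" by (rule directed_weyl_family[OF X(1)])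
  obtain q0 where q0: "csn q0" "\<And>v w. norm (\<Lambda> v w) \<le> q0 v * q0 w"
    using bilinear_form_bound[OF bilinear continuous] by blast
  have form: "graded_form smul V0 V1 \<Lambda>" by unfold_locales (rule bilinear)
  have estimate: "weyl_estimate smul V0 V1 \<Lambda> (split_seminorm (\<lambda>x. p x + q0 x))"
    if p: "csn p" for p
  proof -
    let ?q = "\<lambda>x. p x + q0 x"
    have q: "csn ?q" by (rule continuous_seminorm_add[OF p q0(1)])
    have le: "q0 v \<le> split_seminorm ?q v" for v
      using split_seminorm_ge[OF q, of v] seminorm_nonneg[OF p, of v] by simp
    have "norm (\<Lambda> v w) \<le> split_seminorm ?q v * split_seminorm ?q w" for v w
      by (rule order_trans[OF q0(2) mult_mono[OF le le]])
        (use seminorm_nonneg[OF q0(1)] seminorm_nonneg[OF split_seminorm_continuous[OF q]] in auto)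
    then show ?thesis
      using form seminorm_continuous[OF split_seminorm_continuous[OF q]] split_seminorm_split[OF q]
      by (intro weyl_estimate.intro weyl_estimate_axioms.intro)
  qed
  interpret E: weyl_estimate smul V0 V1 \<Lambda> "split_seminorm (\<lambda>x. 0 + q0 x)"
    by (rule estimate[OF continuous_seminorm_zero])
  have bound: "\<exists>w'\<in>weyl_family X. \<forall>a\<in>S. \<forall>b\<in>S. w (star smul V0 V1 \<Lambda> z a b) \<le> w' a * w' b"
    if w: "w \<in> weyl_family X" for w
  proof -
    obtain p r where p: "csn p" "r \<in> X" "w = wnorm smul p r"
      using w by (auto simp: weyl_family_def)
    obtain r' where r': "r' \<in> X" "r \<le> r'" "1/2 \<le> r'" using X(2)[OF p(2)] by blast
    let ?q = "\<lambda>x. p x + q0 x"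
    have q: "csn ?q" by (rule continuous_seminorm_add[OF p(1) q0(1)])
    interpret P: weyl_estimate smul V0 V1 \<Lambda> "split_seminorm ?q" by (rule estimate[OF p(1)])
    let ?C = "2 * (1 + norm z) * 2 powr (1 + r')"
    let ?w = "wnorm smul (\<lambda>x. ?C * split_seminorm ?q x) r'"
    have "csn (\<lambda>x. ?C * split_seminorm ?q x)"
      by (intro continuous_seminorm_mult split_seminorm_continuous[OF q]) simp
    then have "?w \<in> weyl_family X" using r'(1) unfolding weyl_family_def by blast
    moreover have "w (star smul V0 V1 \<Lambda> z a b) \<le> ?w a * ?w b" if a: "a \<in> S" and b: "b \<in> S" for a b
    proof -
      have le: "p x \<le> split_seminorm ?q x" for x
        using split_seminorm_ge[OF q, of x] seminorm_nonneg[OF q0(1), of x] by simp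
      have "w (star smul V0 V1 \<Lambda> z a b) \<le> wnorm smul (split_seminorm ?q) r' (star smul V0 V1 \<Lambda> z a b)"
        unfolding p(3)
        by (rule weyl_seminorm_mono[of p, OF seminorm_nonneg[OF p(1)] le r'(2)
              subsetD[OF sym_algebra_subset P.star_in_sym_algebra[OF a b]]])
      also have "\<dots> \<le> ?w a * ?w b" by (rule P.star_bound[OF r'(3) a b])
      finally show ?thesis .
    qed
    ultimately show ?thesis by blast
  qed
  have "locally_convex_space alg_scale S (seminorm_topology S (weyl_family X))"
    unfolding locally_convex_space_def
    using vector_space_alg_scale W.subspace_carrier W.seminorm by blast
  then show ?thesis
    unfolding locally_convex_algebra_def
    using E.star_in_sym_algebra E.star_bilinear W.continuous_bilinear[OF _ E.star_bilinear bound]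
    by (intro conjI ballI) auto
qed

end

theorem theorem3p17:
  fixes smul :: "'k::real_normed_field \<Rightarrow> 'v::ab_group_add \<Rightarrow> 'v"
    and T :: "'v topology" and V0 V1 :: "'v set"
    and \<Lambda> :: "'v \<Rightarrow> 'v \<Rightarrow> 'k" and z :: 'k and R :: real
  assumes V: "graded_lcs smul T V0 V1"
    and bilinear: "bilinear_on smul UNIV (*) \<Lambda>"
    and even: "even_form V0 V1 \<Lambda>"
    and continuous: "continuous_map (prod_topology T T) euclidean (\<lambda>(v, w). \<Lambda> v w)"
  shows
    "(1/2 \<le> R \<longrightarrow>
        locally_convex_algebra alg_scale (sym_algebra smul V0 V1)
          (weyl_topology smul T V0 V1 R) (star smul V0 V1 \<Lambda> z) \<and>
        (first_countable (weyl_topology smul T V0 V1 R) \<longleftrightarrow> first_countable T)) \<and>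
     (1/2 < R \<longrightarrow>
        locally_convex_algebra alg_scale (sym_algebra smul V0 V1)
          (weyl_topology_minus smul T V0 V1 R) (star smul V0 V1 \<Lambda> z) \<and>
        (first_countable (weyl_topology_minus smul T V0 V1 R) \<longleftrightarrow> first_countable T))"
proof -
  interpret graded_lcs smul T V0 V1 by (rule V)
  have top: "weyl_topology smul T V0 V1 R = seminorm_topology S (weyl_family {R})"
    unfolding weyl_topology_def weyl_family_def by simp
  have "{wnorm smul p (R - \<epsilon>) | p \<epsilon>. continuous_seminorm smul T p \<and> 0 < \<epsilon>} = weyl_family {..<R}"
  proof -
    have "\<exists>\<epsilon>. r = R - \<epsilon> \<and> 0 < \<epsilon>" if "r < R" for r using that by (intro exI[of _ "R - r"]) simp
    then show ?thesis unfolding weyl_family_def by fastforce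
  qed
  then have top_minus: "weyl_topology_minus smul T V0 V1 R = seminorm_topology S (weyl_family {..<R})"
    unfolding weyl_topology_minus_def by simp
  have "first_countable (weyl_topology smul T V0 V1 R) \<longleftrightarrow> first_countable T"
    unfolding top by (rule first_countable_weyl_iff[of _ "{R}"]) auto
  moreover have "first_countable (weyl_topology_minus smul T V0 V1 R) \<longleftrightarrow> first_countable T"
    unfolding top_minus
  proof (rule first_countable_weyl_iff)
    show "countable (range (\<lambda>n. R - inverse (real (Suc n))))" by simp
    show "range (\<lambda>n. R - inverse (real (Suc n))) \<subseteq> {..<R}" by auto
    show "{..<R} \<noteq> {}" by (simp add: lt_ex)
    show "\<exists>r'\<in>range (\<lambda>n. R - inverse (real (Suc n))). r \<le> r'" if r: "r \<in> {..<R}" for r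
    proof -
      obtain n where "inverse (real (Suc n)) < R - r" using reals_Archimedean[of "R - r"] r by auto
      then show ?thesis by (intro bexI[of _ "R - inverse (real (Suc n))"]) auto
    qed
  qed
  moreover have "locally_convex_algebra alg_scale S (weyl_topology smul T V0 V1 R) (star smul V0 V1 \<Lambda> z)"
    if "1/2 \<le> R"
    unfolding top by (rule locally_convex_algebra_weyl[OF bilinear continuous]) (use that in auto)
  moreover have "locally_convex_algebra alg_scale S (weyl_topology_minus smul T V0 V1 R) (star smul V0 V1 \<Lambda> z)"
    if "1/2 < R"
    unfolding top_minus
  proof (rule locally_convex_algebra_weyl[OF bilinear continuous])
    show "{..<R} \<noteq> {}" by (simp add: lt_ex)
    show "\<exists>r'\<in>{..<R}. r \<le> r' \<and> 1/2 \<le> r'" if "r \<in> {..<R}" for r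
      using that \<open>1/2 < R\<close> by (intro bexI[of _ "max r (1/2)"]) auto
  qed
  ultimately show ?thesis by blast
qed

end
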